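(* Let $m\ge3$, let $\mathcal{N}=(N,g_N)$ be a homogeneous pseudo-Riemannian manifold of dimension $m-1$, and for $t\in\mathbb{R}$ let $\mathcal{M}_t:=(\mathbb{R}\times N,\,g_{M,t})$ where $g_{M,t}:=e^{tx}(dx^2+g_N)$ and $x$ is the coordinate on the factor $\mathbb{R}$. Let $\tau_{\mathcal{N}}$ be the (constant) scalar curvature of $\mathcal{N}$. (1) $\mathcal{M}_t$ is homothety homogeneous and hence homothety $k$-curvature homogeneous for all $k$. (2) Suppose that $t\ne0$ is chosen so that $\tau_{\mathcal{N}}-\frac{(m-1)(m-2)}4t^2\ne0$. Then $\mathcal{M}_t$ is not $0$-curvature homogeneous and in particular not locally homogeneous.
   Context: For a pseudo-Riemannian manifold $\mathcal{M}=(M,g)$, $R$ is the $(0,4)$ curvature tensor of the Levi-Civita connection and $\nabla^\ell R\in\otimes^{\ell+4}T^*M$ is its $\ell$-th covariant derivative. The sign convention for the scalar curvature is that round spheres have positive scalar curvature. $\mathcal{M}$ is homogeneous if the group of isometries $\{T \text{ a diffeomorphism of } M: T^*g=g\}$ acts transitively on $M$; it is locally homogeneous if for any $P,Q\in M$ there is an isometry from a neighborhood of $P$ onto a neighborhood of $Q$ sending $P$ to $Q$. $\mathcal{M}$ is homothety homogeneous if the group of homotheties $\{T \text{ a diffeomorphism of } M:\exists\, 0\ne\lambda\in\mathbb{R},\ T^*g=\lambda^2g\}$ acts transitively on $M$. $\mathcal{M}$ is $k$-curvature homogeneous if given $P,Q\in M$ there is a linear isometry $\phi:T_PM\to T_QM$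 with $\phi^*(\nabla^\ell R_Q)=\nabla^\ell R_P$ for $0\le\ell\le k$. $\mathcal{M}$ is homothety $k$-curvature homogeneous if given $P,Q\in M$ there exist a linear isometry $\Phi:T_PM\to T_QM$ and $0\neq\lambda\in\mathbb{R}$ with $\Phi^*(\nabla^\ell R_Q)=\lambda^{-\ell-2}\nabla^\ell R_P$ for $0\le\ell\le k$. *)

theory Defs
  imports "HOL-Analysis.Analysis"
begin

section \<open>Smooth manifolds\<close>

primrec Ck_on :: "nat \<Rightarrow> 'e::euclidean_space set \<Rightarrow> ('e \<Rightarrow> 'f::real_normed_vector) \<Rightarrow> bool" where
  "Ck_on 0 S f \<longleftrightarrow> continuous_on S f"
| "Ck_on (Suc k) S f \<longleftrightarrow>
     (\<forall>x\<in>S. f differentiable (at x)) \<and> (\<forall>v. Ck_on k S (\<lambda>x. frechet_derivative f (at x) v))"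

text \<open>Intended for open \<open>S\<close>.\<close>

definition smooth_on :: "'e::euclidean_space set \<Rightarrow> ('e \<Rightarrow> 'f::real_normed_vector) \<Rightarrow> bool" where
  "smooth_on S f \<longleftrightarrow> (\<forall>k. Ck_on k S f)"

text \<open>A topological space with an indexed atlas, not necessarily maximal, modelled on the Euclidean
  space \<open>'e\<close>, so that the dimension of the manifold is \<open>DIM('e)\<close>.\<close>

record ('i, 'a, 'e) manifold =
  mtop :: "'a topology"
  index :: "'i set"
  cdom :: "'i \<Rightarrow> 'a set"
  cmap :: "'i \<Rightarrow> 'a \<Rightarrow> 'e"

abbreviation points :: "('i, 'a, 'e) manifold \<Rightarrow> 'a set" where
  "points M \<equiv> topspace (mtop M)"

definition cinv :: "('i, 'a, 'e) manifold \<Rightarrow> 'i \<Rightarrow> 'e \<Rightarrow> 'a" where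
  "cinv M i = inv_into (cdom M i) (cmap M i)"

definition charts_at :: "('i, 'a, 'e) manifold \<Rightarrow> 'a \<Rightarrow> 'i set" where
  "charts_at M p = {i \<in> index M. p \<in> cdom M i}"

definition chart_at :: "('i, 'a, 'e) manifold \<Rightarrow> 'a \<Rightarrow> 'i" where
  "chart_at M p = (SOME i. i \<in> charts_at M p)"

definition smooth_manifold :: "('i, 'a, 'e::euclidean_space) manifold \<Rightarrow> bool" where
  "smooth_manifold M \<longleftrightarrow>
     Hausdorff_space (mtop M) \<and> second_countable (mtop M) \<and>
     (\<Union>i\<in>index M. cdom M i) = points M \<and>
     (\<forall>i\<in>index M. openin (mtop M) (cdom M i) \<and> open (cmap M i ` cdom M i) \<and>
        homeomorphic_map (subtopology (mtop M) (cdom M i))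
          (top_of_set (cmap M i ` cdom M i)) (cmap M i)) \<and>
     (\<forall>i\<in>index M. \<forall>j\<in>index M.
        smooth_on (cmap M i ` (cdom M i \<inter> cdom M j)) (cmap M j \<circ> cinv M i))"

text \<open>A tangent vector at \<open>p\<close> is the family of its components in all charts around \<open>p\<close>, related by
  the usual transformation law (and set to 0 at the other indices, so that equality of tangent
  vectors is equality of functions).\<close>

type_synonym ('i, 'e) tvector = "'i \<Rightarrow> 'e"

definition tangent_space ::
  "('i, 'a, 'e::euclidean_space) manifold \<Rightarrow> 'a \<Rightarrow> ('i, 'e) tvector set" where
  "tangent_space M p =
     {v. (\<forall>i\<in>charts_at M p. \<forall>j\<in>charts_at M p.
            v j = frechet_derivative (cmap M j \<circ> cinv M i) (at (cmap M i p)) (v i)) \<and>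
         (\<forall>i. i \<notin> charts_at M p \<longrightarrow> v i = 0)}"

definition tlincomb ::
  "real \<Rightarrow> ('i, 'e) tvector \<Rightarrow> real \<Rightarrow> ('i, 'e) tvector \<Rightarrow> ('i, 'e::real_vector) tvector" where
  "tlincomb a v b w = (\<lambda>i. a *\<^sub>R v i + b *\<^sub>R w i)"

text \<open>The tangent vector at \<open>p\<close> with components \<open>u\<close> in the chart \<open>i\<close> around \<open>p\<close>.\<close>

definition tvec ::
  "('i, 'a, 'e::euclidean_space) manifold \<Rightarrow> 'i \<Rightarrow> 'a \<Rightarrow> 'e \<Rightarrow> ('i, 'e) tvector" where
  "tvec M i p u = (\<lambda>j. if j \<in> charts_at M p
     then frechet_derivative (cmap M j \<circ> cinv M i) (at (cmap M i p)) u else 0)"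

text \<open>Intended for open \<open>W\<close>; together with continuity this makes the sets on which the local
  representatives have to be smooth open.\<close>

definition smooth_map_on :: "('i, 'a, 'e::euclidean_space) manifold \<Rightarrow> 'a set \<Rightarrow>
    ('j, 'b, 'f::euclidean_space) manifold \<Rightarrow> ('a \<Rightarrow> 'b) \<Rightarrow> bool" where
  "smooth_map_on M W M' T \<longleftrightarrow>
     continuous_map (subtopology (mtop M) W) (mtop M') T \<and>
     (\<forall>i\<in>index M. \<forall>j\<in>index M'.
        smooth_on (cmap M i ` {p \<in> W \<inter> cdom M i. T p \<in> cdom M' j})
          (cmap M' j \<circ> T \<circ> cinv M i))"

definition diffeo_on :: "('i, 'a, 'e::euclidean_space) manifold \<Rightarrow> 'a set \<Rightarrow>
    ('j, 'b, 'f::euclidean_space) manifold \<Rightarrow> 'b set \<Rightarrow> ('a \<Rightarrow> 'b) \<Rightarrow> bool" where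
  "diffeo_on M W M' V T \<longleftrightarrow>
     openin (mtop M) W \<and> openin (mtop M') V \<and> bij_betw T W V \<and>
     smooth_map_on M W M' T \<and> smooth_map_on M' V M (inv_into W T)"

definition differential :: "('i, 'a, 'e::euclidean_space) manifold \<Rightarrow>
    ('j, 'b, 'f::euclidean_space) manifold \<Rightarrow> ('a \<Rightarrow> 'b) \<Rightarrow> 'a \<Rightarrow>
    ('i, 'e) tvector \<Rightarrow> ('j, 'f) tvector" where
  "differential M M' T p v = (\<lambda>j. if j \<in> charts_at M' (T p)
     then frechet_derivative (cmap M' j \<circ> T \<circ> cinv M (chart_at M p))
            (at (cmap M (chart_at M p) p)) (v (chart_at M p))
     else 0)"

definition dfun :: "('i, 'a, 'e::euclidean_space) manifold \<Rightarrow>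
    ('a \<Rightarrow> real) \<Rightarrow> 'a \<Rightarrow> ('i, 'e) tvector \<Rightarrow> real" where
  "dfun M f p v = frechet_derivative (f \<circ> cinv M (chart_at M p))
     (at (cmap M (chart_at M p) p)) (v (chart_at M p))"

section \<open>Pseudo-Riemannian metrics\<close>

type_synonym ('i, 'a, 'e) metric_field =
  "'a \<Rightarrow> ('i, 'e) tvector \<Rightarrow> ('i, 'e) tvector \<Rightarrow> real"

text \<open>The components of the metric in the chart \<open>i\<close>.\<close>

definition metric_in_chart :: "('i, 'a, 'e::euclidean_space) manifold \<Rightarrow>
    ('i, 'a, 'e) metric_field \<Rightarrow> 'i \<Rightarrow> 'e \<Rightarrow> 'e \<Rightarrow> 'e \<Rightarrow> real" where
  "metric_in_chart M g i x u w =
     g (cinv M i x) (tvec M i (cinv M i x) u) (tvec M i (cinv M i x) w)"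

text \<open>The signature is arbitrary. It is automatically locally constant, hence constant on connected
  manifolds, and also constant on homogeneous manifolds.\<close>

definition pseudo_riemannian :: "('i, 'a, 'e::euclidean_space) manifold \<Rightarrow>
    ('i, 'a, 'e) metric_field \<Rightarrow> bool" where
  "pseudo_riemannian M g \<longleftrightarrow>
     smooth_manifold M \<and>
     (\<forall>p\<in>points M.
        (\<forall>v\<in>tangent_space M p. \<forall>w\<in>tangent_space M p. g p v w = g p w v) \<and>
        (\<forall>v\<in>tangent_space M p. \<forall>v'\<in>tangent_space M p. \<forall>w\<in>tangent_space M p. \<forall>a b.
           g p (tlincomb a v b v') w = a * g p v w + b * g p v' w) \<and>
        (\<forall>v\<in>tangent_space M p. (\<forall>w\<in>tangent_space M p. g p v w = 0) \<longrightarrow> v = (\<lambda>_. 0))) \<and>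
     (\<forall>i\<in>index M. \<forall>u w. smooth_on (cmap M i ` cdom M i) (\<lambda>x. metric_in_chart M g i x u w))"

section \<open>Curvature in a chart\<close>

text \<open>Throughout, \<open>G x\<close> is a metric at the point \<open>x\<close> of an open set of the model space.
  The Levi-Civita connection is \<open>\<nabla>\<^sub>u Y = DY(u) + \<Gamma>(u, Y)\<close>, where \<open>\<Gamma>\<close> is symmetric (no torsion)
  and the metric is parallel.\<close>

definition levi_civita :: "('e::euclidean_space \<Rightarrow> 'e \<Rightarrow> 'e \<Rightarrow> real) \<Rightarrow> 'e \<Rightarrow> 'e \<Rightarrow> 'e \<Rightarrow> 'e" where
  "levi_civita G x = (THE \<Gamma>. bilinear \<Gamma> \<and> (\<forall>u v. \<Gamma> u v = \<Gamma> v u) \<and>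
     (\<forall>u v w. frechet_derivative (\<lambda>y. G y v w) (at x) u = G x (\<Gamma> u v) w + G x v (\<Gamma> u w)))"

text \<open>\<open>R(u,v)w = \<nabla>\<^sub>u\<nabla>\<^sub>v w - \<nabla>\<^sub>v\<nabla>\<^sub>u w\<close> for constant, hence commuting, vector fields \<open>u, v, w\<close>.\<close>

definition curvature_op ::
  "('e::euclidean_space \<Rightarrow> 'e \<Rightarrow> 'e \<Rightarrow> real) \<Rightarrow> 'e \<Rightarrow> 'e \<Rightarrow> 'e \<Rightarrow> 'e \<Rightarrow> 'e" where
  "curvature_op G x u v w =
     frechet_derivative (\<lambda>y. levi_civita G y v w) (at x) u
     - frechet_derivative (\<lambda>y. levi_civita G y u w) (at x) v
     + levi_civita G x u (levi_civita G x v w)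
     - levi_civita G x v (levi_civita G x u w)"

text \<open>A \<open>(0,n)\<close>-tensor field takes a point and a list of \<open>n\<close> vectors.\<close>

definition curvature_tensor ::
  "('e::euclidean_space \<Rightarrow> 'e \<Rightarrow> 'e \<Rightarrow> real) \<Rightarrow> 'e \<Rightarrow> 'e list \<Rightarrow> real" where
  "curvature_tensor G x vs = G x (curvature_op G x (vs!0) (vs!1) (vs!2)) (vs!3)"

text \<open>The direction of differentiation is the first argument of the new tensor:
  \<open>(\<nabla>T)(u,v\<^sub>1,\<dots>,v\<^sub>n) = (\<nabla>\<^sub>u T)(v\<^sub>1,\<dots>,v\<^sub>n)\<close>.\<close>

definition cov_deriv :: "('e::euclidean_space \<Rightarrow> 'e \<Rightarrow> 'e \<Rightarrow> real) \<Rightarrow>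
    ('e \<Rightarrow> 'e list \<Rightarrow> real) \<Rightarrow> 'e \<Rightarrow> 'e list \<Rightarrow> real" where
  "cov_deriv G T x us = (let u = hd us; vs = tl us in
     frechet_derivative (\<lambda>y. T y vs) (at x) u
     - (\<Sum>r<length vs. T x (vs[r := levi_civita G x u (vs!r)])))"

primrec nabla_curvature :: "('e::euclidean_space \<Rightarrow> 'e \<Rightarrow> 'e \<Rightarrow> real) \<Rightarrow>
    nat \<Rightarrow> 'e \<Rightarrow> 'e list \<Rightarrow> real" where
  "nabla_curvature G 0 = curvature_tensor G"
| "nabla_curvature G (Suc l) = cov_deriv G (nabla_curvature G l)"

text \<open>\<open>Ric(v,w)\<close> is the trace of \<open>u \<mapsto> R(u,v)w\<close>, which is positive on round spheres.\<close>

definition ricci :: "('e::euclidean_space \<Rightarrow> 'e \<Rightarrow> 'e \<Rightarrow> real) \<Rightarrow> 'e \<Rightarrow> 'e \<Rightarrow> 'e \<Rightarrow> real" where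
  "ricci G x v w = (\<Sum>b\<in>Basis. curvature_op G x b v w \<bullet> b)"

definition ricci_op :: "('e::euclidean_space \<Rightarrow> 'e \<Rightarrow> 'e \<Rightarrow> real) \<Rightarrow> 'e \<Rightarrow> 'e \<Rightarrow> 'e" where
  "ricci_op G x = (THE A. linear A \<and> (\<forall>v w. G x (A v) w = ricci G x v w))"

definition scalar_curvature_local :: "('e::euclidean_space \<Rightarrow> 'e \<Rightarrow> 'e \<Rightarrow> real) \<Rightarrow> 'e \<Rightarrow> real" where
  "scalar_curvature_local G x = (\<Sum>b\<in>Basis. ricci_op G x b \<bullet> b)"

section \<open>Curvature on a manifold\<close>

text \<open>These are evaluated in some chart around \<open>p\<close>; being tensorial, they do not depend on its
  choice.\<close>

definition nabla_R :: "('i, 'a, 'e::euclidean_space) manifold \<Rightarrow> ('i, 'a, 'e) metric_field \<Rightarrow>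
    nat \<Rightarrow> 'a \<Rightarrow> ('i, 'e) tvector list \<Rightarrow> real" where
  "nabla_R M g l p vs = (let i = chart_at M p in
     nabla_curvature (metric_in_chart M g i) l (cmap M i p) (map (\<lambda>v. v i) vs))"

definition scalar_curvature :: "('i, 'a, 'e::euclidean_space) manifold \<Rightarrow>
    ('i, 'a, 'e) metric_field \<Rightarrow> 'a \<Rightarrow> real" where
  "scalar_curvature M g p = (let i = chart_at M p in
     scalar_curvature_local (metric_in_chart M g i) (cmap M i p))"

section \<open>Homogeneity\<close>

definition pulls_back_to_multiple :: "('i, 'a, 'e::euclidean_space) manifold \<Rightarrow>
    ('i, 'a, 'e) metric_field \<Rightarrow> 'a set \<Rightarrow> ('a \<Rightarrow> 'a) \<Rightarrow> real \<Rightarrow> bool" where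
  "pulls_back_to_multiple M g W T c \<longleftrightarrow>
     (\<forall>p\<in>W. \<forall>v\<in>tangent_space M p. \<forall>w\<in>tangent_space M p.
        g (T p) (differential M M T p v) (differential M M T p w) = c * g p v w)"

definition isometry :: "('i, 'a, 'e::euclidean_space) manifold \<Rightarrow>
    ('i, 'a, 'e) metric_field \<Rightarrow> ('a \<Rightarrow> 'a) \<Rightarrow> bool" where
  "isometry M g T \<longleftrightarrow>
     diffeo_on M (points M) M (points M) T \<and> pulls_back_to_multiple M g (points M) T 1"

definition homothety :: "('i, 'a, 'e::euclidean_space) manifold \<Rightarrow>
    ('i, 'a, 'e) metric_field \<Rightarrow> ('a \<Rightarrow> 'a) \<Rightarrow> bool" where
  "homothety M g T \<longleftrightarrow>
     diffeo_on M (points M) M (points M) T \<and>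
     (\<exists>c. c \<noteq> 0 \<and> pulls_back_to_multiple M g (points M) T (c\<^sup>2))"

definition homogeneous :: "('i, 'a, 'e::euclidean_space) manifold \<Rightarrow>
    ('i, 'a, 'e) metric_field \<Rightarrow> bool" where
  "homogeneous M g \<longleftrightarrow> (\<forall>P\<in>points M. \<forall>Q\<in>points M. \<exists>T. isometry M g T \<and> T P = Q)"

definition homothety_homogeneous :: "('i, 'a, 'e::euclidean_space) manifold \<Rightarrow>
    ('i, 'a, 'e) metric_field \<Rightarrow> bool" where
  "homothety_homogeneous M g \<longleftrightarrow>
     (\<forall>P\<in>points M. \<forall>Q\<in>points M. \<exists>T. homothety M g T \<and> T P = Q)"

definition locally_homogeneous :: "('i, 'a, 'e::euclidean_space) manifold \<Rightarrow>
    ('i, 'a, 'e) metric_field \<Rightarrow> bool" where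
  "locally_homogeneous M g \<longleftrightarrow>
     (\<forall>P\<in>points M. \<forall>Q\<in>points M. \<exists>T W V. P \<in> W \<and> Q \<in> V \<and>
        diffeo_on M W M V T \<and> pulls_back_to_multiple M g W T 1 \<and> T P = Q)"

definition linear_isometry :: "('i, 'a, 'e::euclidean_space) manifold \<Rightarrow>
    ('i, 'a, 'e) metric_field \<Rightarrow> 'a \<Rightarrow> 'a \<Rightarrow> (('i, 'e) tvector \<Rightarrow> ('i, 'e) tvector) \<Rightarrow> bool" where
  "linear_isometry M g P Q \<Phi> \<longleftrightarrow>
     bij_betw \<Phi> (tangent_space M P) (tangent_space M Q) \<and>
     (\<forall>v\<in>tangent_space M P. \<forall>w\<in>tangent_space M P.
        (\<forall>a b. \<Phi> (tlincomb a v b w) = tlincomb a (\<Phi> v) b (\<Phi> w)) \<and>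
        g Q (\<Phi> v) (\<Phi> w) = g P v w)"

definition curvature_homogeneous :: "nat \<Rightarrow> ('i, 'a, 'e::euclidean_space) manifold \<Rightarrow>
    ('i, 'a, 'e) metric_field \<Rightarrow> bool" where
  "curvature_homogeneous k M g \<longleftrightarrow>
     (\<forall>P\<in>points M. \<forall>Q\<in>points M. \<exists>\<Phi>. linear_isometry M g P Q \<Phi> \<and>
        (\<forall>l\<le>k. \<forall>vs. set vs \<subseteq> tangent_space M P \<and> length vs = l + 4 \<longrightarrow>
           nabla_R M g l Q (map \<Phi> vs) = nabla_R M g l P vs))"

definition homothety_curvature_homogeneous :: "nat \<Rightarrow>
    ('i, 'a, 'e::euclidean_space) manifold \<Rightarrow> ('i, 'a, 'e) metric_field \<Rightarrow> bool" where
  "homothety_curvature_homogeneous k M g \<longleftrightarrow>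
     (\<forall>P\<in>points M. \<forall>Q\<in>points M. \<exists>\<Phi> c. linear_isometry M g P Q \<Phi> \<and> c \<noteq> 0 \<and>
        (\<forall>l\<le>k. \<forall>vs. set vs \<subseteq> tangent_space M P \<and> length vs = l + 4 \<longrightarrow>
           nabla_R M g l Q (map \<Phi> vs) = c powi (- int l - 2) * nabla_R M g l P vs))"

section \<open>The manifolds \<open>\<M>\<^sub>t\<close>\<close>

definition line_times :: "('i, 'a, 'e::euclidean_space) manifold \<Rightarrow>
    ('i, real \<times> 'a, real \<times> 'e) manifold" where
  "line_times N = \<lparr>
     mtop = prod_topology euclideanreal (mtop N),
     index = index N,
     cdom = (\<lambda>i. UNIV \<times> cdom N i),
     cmap = (\<lambda>i (x, p). (x, cmap N i p))\<rparr>"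

text \<open>\<open>e\<^bsup>tx\<^esup> (dx\<^sup>2 + g\<^sub>N)\<close>, with \<open>g\<^sub>N\<close> pulled back along the projection to \<open>N\<close>.\<close>

definition warped_metric :: "real \<Rightarrow> ('i, 'a, 'e::euclidean_space) manifold \<Rightarrow>
    ('i, 'a, 'e) metric_field \<Rightarrow> ('i, real \<times> 'a, real \<times> 'e) metric_field" where
  "warped_metric t N gN q v w = exp (t * fst q) *
     (dfun (line_times N) fst q v * dfun (line_times N) fst q w +
      gN (snd q) (differential (line_times N) N snd q v) (differential (line_times N) N snd q w))"

end

theory Submission
  imports Defs
begin

text \<open>Translations in \<open>x\<close> rescale \<open>e\<^bsup>tx\<^esup> (dx\<^sup>2 + g\<^sub>N)\<close> by a constant, so together with the isometries of
  \<open>N\<close> they act transitively by homotheties. If \<open>T\<^sup>*g = c\<^sup>2 g\<close>, then \<open>T\<close> preserves the Levi-Civita connection,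
  hence \<open>T\<^sup>*(\<nabla>\<^sup>l R) = c\<^sup>2 \<nabla>\<^sup>l R\<close>, and the linear isometry \<open>c\<^bsup>-1\<^esup> dT\<close> has the scaling behaviour required in
  homothety curvature homogeneity. Conversely, a linear isometry that preserves \<open>R\<close> preserves the scalar
  curvature, whereas the scalar curvature of \<open>\<M>\<^sub>t\<close> is \<open>e\<^bsup>-tx\<^esup> (\<tau> - (m - 1)(m - 2) t\<^sup>2 / 4)\<close>, which is not
  constant in \<open>x\<close>.\<close>

section \<open>Smooth maps between Euclidean spaces\<close>

text \<open>For \<open>t \<noteq> 0\<close> put \<open>r = (2/t) exp (t x / 2)\<close>: the metric
  becomes \<open>dr^2 + (t^2/4) r^2 g_N\<close>, a cone over a constant multiple of N. This explains
  why the curvature operator ignores the x direction and why, on N, it is the curvature of N minus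
  that of constant curvature \<open>t^2/4\<close>. Tracing twice over dimension
  \<open>n = m - 1\<close> yields \<open>n (n - 1) t^2/4 = (m - 1) (m - 2) t^2/4\<close>. The
  obstacle is that all curvature is defined chartwise through \<open>THE\<close>, so nothing is
  known of \<open>levi_civita\<close> in advance, not even differentiability. Koszul's formula
  exhibits it as the solution of a linear system with smooth coefficients, and such solutions are
  shown to be smooth directly, without determinants or a formula for the inverse metric. Naturality
  is proved for coordinate representatives between two arbitrary charts, because source and target
  point are evaluated in unrelated charts. Applied to the identity, it also shows that the scalar
  curvature depends only on the germ of the metric.\<close>

lemma Ck_on_SucD: "Ck_on (Suc k) S f \<Longrightarrow> Ck_on k S f"
proof (induction k arbitrary: f)
  case 0
  then show ?case
    by (auto intro!: continuous_at_imp_continuous_on differentiable_imp_continuous_within)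
next
  case (Suc k)
  then show ?case by (metis Ck_on.simps(2))
qed

lemma Ck_on_subset: "Ck_on k S f \<Longrightarrow> S' \<subseteq> S \<Longrightarrow> Ck_on k S' f"
  by (induction k arbitrary: f) (auto intro: continuous_on_subset)

text \<open>Openness of \<open>S\<close> matters: \<open>at x\<close> sees a full neighbourhood, so
  equality on \<open>S\<close> carries over to derivatives at points of \<open>S\<close>.\<close>

lemma Ck_on_cong:
  assumes "open S" "Ck_on k S f" "\<And>x. x \<in> S \<Longrightarrow> f x = g x"
  shows "Ck_on k S g"
  using assms(2,3)
proof (induction k arbitrary: f g)
  case 0
  then show ?case by (metis Ck_on.simps(1) continuous_on_cong)
next
  case (Suc k)
  have d: "(g has_derivative frechet_derivative f (at x)) (at x)" if "x \<in> S" for x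
    by (rule has_derivative_transform_within_open[where f=f and s=S])
      (use Suc.prems that assms(1) in \<open>auto simp: frechet_derivative_works[symmetric]\<close>)
  then have eq: "frechet_derivative f (at x) = frechet_derivative g (at x)" if "x \<in> S" for x
    using that frechet_derivative_at by blast
  have "Ck_on k S (\<lambda>x. frechet_derivative g (at x) v)" for v
    by (rule Suc.IH[of "\<lambda>x. frechet_derivative f (at x) v"])
      (use Suc.prems(1) eq in auto)
  then show ?case using d by (auto simp: differentiable_def)
qed

text \<open>\<open>Ck_on\<close> is phrased with the choice term \<open>frechet_derivative\<close>;
  this form accepts an explicit derivative \<open>f'\<close>, on which the differentiation rules can
  work.\<close>

lemma Ck_on_SucI:
  assumes "open S" "\<And>x. x \<in> S \<Longrightarrow> (f has_derivative f' x) (at x)" "\<And>v. Ck_on k S (\<lambda>x. f' x v)"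
  shows "Ck_on (Suc k) S f"
proof -
  have "Ck_on k S (\<lambda>x. frechet_derivative f (at x) v)" for v
    using assms(1) assms(3)[of v] by (rule Ck_on_cong) (metis assms(2) frechet_derivative_at)
  then show ?thesis using assms(2) by (auto simp: differentiable_def)
qed

lemma Ck_on_const: "Ck_on k S (\<lambda>x. c)"
  by (induction k arbitrary: c) auto

lemma Ck_on_bounded_linear:
  assumes "bounded_linear h" "open S"
  shows "Ck_on k S f \<Longrightarrow> Ck_on k S (\<lambda>x. h (f x))"
proof (induction k arbitrary: f)
  case 0
  then show ?case using assms by (auto intro: bounded_linear.continuous_on)
next
  case (Suc k)
  show ?case
  proof (rule Ck_on_SucI[where f'="\<lambda>x v. h (frechet_derivative f (at x) v)"])
    show "((\<lambda>x. h (f x)) has_derivative (\<lambda>v. h (frechet_derivative f (at x) v))) (at x)"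
      if "x \<in> S" for x
      using Suc.prems that
      by (intro bounded_linear.has_derivative[OF assms(1)]) (auto simp: frechet_derivative_works[symmetric])
  qed (use Suc assms in auto)
qed

lemma Ck_on_add:
  assumes "open S"
  shows "Ck_on k S f \<Longrightarrow> Ck_on k S g \<Longrightarrow> Ck_on k S (\<lambda>x. f x + g x)"
proof (induction k arbitrary: f g)
  case 0
  then show ?case by (auto intro: continuous_intros)
next
  case (Suc k)
  show ?case
  proof (rule Ck_on_SucI[where f'="\<lambda>x v. frechet_derivative f (at x) v + frechet_derivative g (at x) v"])
    show "((\<lambda>x. f x + g x) has_derivative
        (\<lambda>v. frechet_derivative f (at x) v + frechet_derivative g (at x) v)) (at x)"
      if "x \<in> S" for x
      using Suc.prems that
      by (intro has_derivative_add) (auto simp: frechet_derivative_works[symmetric])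
  qed (use Suc assms in auto)
qed

lemma Ck_on_diff:
  assumes "open S" "Ck_on k S f" "Ck_on k S g"
  shows "Ck_on k S (\<lambda>x. f x - g x)"
  using Ck_on_add[OF assms(1,2) Ck_on_bounded_linear[OF bounded_linear_minus[OF bounded_linear_ident] assms(1,3)]]
  by simp

lemma Ck_on_sum:
  "open S \<Longrightarrow> (\<And>i. i \<in> I \<Longrightarrow> Ck_on k S (f i)) \<Longrightarrow> Ck_on k S (\<lambda>x. \<Sum>i\<in>I. f i x)"
  by (induction I rule: infinite_finite_induct) (auto intro: Ck_on_const Ck_on_add)

lemma Ck_on_bounded_bilinear:
  assumes "bounded_bilinear h" "open S"
  shows "Ck_on k S f \<Longrightarrow> Ck_on k S g \<Longrightarrow> Ck_on k S (\<lambda>x. h (f x) (g x))"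
proof (induction k arbitrary: f g)
  case 0
  then show ?case using assms by (auto intro: bounded_bilinear.continuous_on)
next
  case (Suc k)
  \<comment> \<open>The product rule pairs a derivative of one factor with the other factor itself,
    which is therefore needed at order \<open>k\<close> as well.\<close>
  have "Ck_on k S f" "Ck_on k S g"
    using Suc.prems by (auto intro: Ck_on_SucD)
  then show ?case
  using Suc assms
  by (intro Ck_on_SucI[where f'="\<lambda>x v. h (f x) (frechet_derivative g (at x) v)
         + h (frechet_derivative f (at x) v) (g x)"])
    (auto intro!: Ck_on_add bounded_bilinear.FDERIV[OF assms(1)]
      simp: frechet_derivative_works[symmetric])
qed

lemma smooth_on_subset: "smooth_on S f \<Longrightarrow> S' \<subseteq> S \<Longrightarrow> smooth_on S' f"
  unfolding smooth_on_def using Ck_on_subset by blast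

lemma smooth_on_cong:
  "open S \<Longrightarrow> smooth_on S f \<Longrightarrow> (\<And>x. x \<in> S \<Longrightarrow> f x = g x) \<Longrightarrow> smooth_on S g"
  unfolding smooth_on_def using Ck_on_cong by blast

lemma smooth_on_const: "smooth_on S (\<lambda>x. c)"
  by (simp add: smooth_on_def Ck_on_const)

lemma smooth_on_bounded_linear:
  "bounded_linear h \<Longrightarrow> open S \<Longrightarrow> smooth_on S f \<Longrightarrow> smooth_on S (\<lambda>x. h (f x))"
  by (simp add: smooth_on_def Ck_on_bounded_linear)

lemma smooth_on_bounded_bilinear:
  "bounded_bilinear h \<Longrightarrow> open S \<Longrightarrow> smooth_on S f \<Longrightarrow> smooth_on S g
     \<Longrightarrow> smooth_on S (\<lambda>x. h (f x) (g x))"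
  by (simp add: smooth_on_def Ck_on_bounded_bilinear)

lemmas smooth_on_scaleR = smooth_on_bounded_bilinear[OF bounded_bilinear_scaleR]
lemmas smooth_on_mult = smooth_on_bounded_bilinear[OF bounded_bilinear_mult]
lemmas smooth_on_scaleR_left = smooth_on_bounded_linear[OF bounded_linear_scaleR_left]
lemmas smooth_on_inner_left = smooth_on_bounded_linear[OF bounded_linear_inner_left]

lemma smooth_on_add:
  "open S \<Longrightarrow> smooth_on S f \<Longrightarrow> smooth_on S g \<Longrightarrow> smooth_on S (\<lambda>x. f x + g x)"
  by (simp add: smooth_on_def Ck_on_add)

lemma smooth_on_diff:
  "open S \<Longrightarrow> smooth_on S f \<Longrightarrow> smooth_on S g \<Longrightarrow> smooth_on S (\<lambda>x. f x - g x)"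
  by (simp add: smooth_on_def Ck_on_diff)

lemma smooth_on_sum:
  "open S \<Longrightarrow> (\<And>i. i \<in> I \<Longrightarrow> smooth_on S (f i)) \<Longrightarrow> smooth_on S (\<lambda>x. \<Sum>i\<in>I. f i x)"
  by (simp add: smooth_on_def Ck_on_sum)

lemma smooth_on_frechet_derivative:
  "smooth_on S f \<Longrightarrow> smooth_on S (\<lambda>x. frechet_derivative f (at x) v)"
  unfolding smooth_on_def by (metis Ck_on.simps(2))

lemma smooth_on_differentiable: "smooth_on S f \<Longrightarrow> x \<in> S \<Longrightarrow> f differentiable (at x)"
  unfolding smooth_on_def by (metis Ck_on.simps(2))

lemma smooth_on_has_derivative:
  "smooth_on S f \<Longrightarrow> x \<in> S \<Longrightarrow> (f has_derivative frechet_derivative f (at x)) (at x)"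
  using smooth_on_differentiable frechet_derivative_works by blast

lemma smooth_on_SucI:
  assumes "open S" "\<And>x. x \<in> S \<Longrightarrow> (f has_derivative f' x) (at x)" "\<And>v. smooth_on S (\<lambda>x. f' x v)"
  shows "smooth_on S f"
  unfolding smooth_on_def
proof
  fix k show "Ck_on k S f"
    using assms Ck_on_SucI[of S f f' k] by (auto simp: smooth_on_def intro: Ck_on_SucD)
qed

lemma smooth_on_continuous_at: "smooth_on S f \<Longrightarrow> x \<in> S \<Longrightarrow> isCont f x"
  by (meson differentiable_imp_continuous_within smooth_on_differentiable)

section \<open>Linear equations with coefficients depending on a parameter\<close>

lemma has_derivative_zero_product:
  fixes f :: "'a::real_normed_vector \<Rightarrow> real" and g :: "'a \<Rightarrow> 'b::real_normed_vector"
  assumes f: "(f \<longlongrightarrow> 0) (at x)" and g: "(g has_derivative g') (at x)" and g0: "g x = 0"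
  shows "((\<lambda>y. f y *\<^sub>R g y) has_derivative (\<lambda>h. 0)) (at x)"
proof -
  interpret g': bounded_linear g' using g by (rule has_derivative_bounded_linear)
  obtain K where K: "\<And>h. norm (g' h) \<le> norm h * K" "K > 0"
    using g'.pos_bounded by blast
  have lim: "((\<lambda>y. norm (g y - g x - g' (y - x)) / norm (y - x)) \<longlongrightarrow> 0) (at x)"
    using g by (simp add: has_derivative_iff_norm)
  \<comment> \<open>After division by \<open>norm (y - x)\<close> the factor \<open>g\<close> stays
    bounded by its remainder plus \<open>K\<close>, so \<open>f\<close> tending to 0 suffices to
    make the product \<open>o(norm (y - x))\<close>.\<close>
  have "((\<lambda>y. \<bar>f y\<bar> * (norm (g y - g x - g' (y - x)) / norm (y - x) + K)) \<longlongrightarrow> \<bar>0\<bar> * (0 + K)) (at x)"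
    by (intro tendsto_intros f lim)
  then have "((\<lambda>y. \<bar>f y\<bar> * (norm (g y - g x - g' (y - x)) / norm (y - x) + K)) \<longlongrightarrow> 0) (at x)"
    by simp
  then have "((\<lambda>y. norm (f y *\<^sub>R g y) / norm (y - x)) \<longlongrightarrow> 0) (at x)"
  proof (rule Lim_null_comparison[rotated])
    show "\<forall>\<^sub>F y in at x. norm (norm (f y *\<^sub>R g y) / norm (y - x))
        \<le> \<bar>f y\<bar> * (norm (g y - g x - g' (y - x)) / norm (y - x) + K)"
      unfolding eventually_at_filter
    proof (rule always_eventually, intro allI impI)
      fix y assume y: "y \<noteq> x"
      have "norm (g y) \<le> norm (g y - g x - g' (y - x)) + norm (g' (y - x))"
        using norm_triangle_sub[of "g y" "g' (y - x)"] g0 by (simp add: add.commute)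
      also have "\<dots> \<le> norm (g y - g x - g' (y - x)) + norm (y - x) * K"
        using K by simp
      finally have "norm (g y) / norm (y - x) \<le> norm (g y - g x - g' (y - x)) / norm (y - x) + K"
        using y by (simp add: field_simps)
      then show "norm (norm (f y *\<^sub>R g y) / norm (y - x))
        \<le> \<bar>f y\<bar> * (norm (g y - g x - g' (y - x)) / norm (y - x) + K)"
        using mult_left_mono[of "norm (g y) / norm (y - x)" _ "\<bar>f y\<bar>"] by simp
    qed
  qed
  then show ?thesis
    by (simp add: has_derivative_iff_norm g0)
qed

lemma linear_euclidean_expansion:
  fixes f :: "'e::euclidean_space \<Rightarrow> 'f::real_vector"
  assumes "linear f"
  shows "f v = (\<Sum>b\<in>Basis. (v \<bullet> b) *\<^sub>R f b)"
proof -
  have "f v = f (\<Sum>b\<in>Basis. (v \<bullet> b) *\<^sub>R b)" by (simp add: euclidean_representation)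
  also have "\<dots> = (\<Sum>b\<in>Basis. (v \<bullet> b) *\<^sub>R f b)"
    by (simp add: linear_sum[OF assms] linear_cmul[OF assms] o_def)
  finally show ?thesis .
qed

text \<open>Only \<open>A x0\<close> is inverted, by a fixed left inverse \<open>L\<close>. With the
  perturbation \<open>E y = L (A y - A x0)\<close> the equation takes the form
  \<open>X y - X x0 = N y - E y (X y - X x0)\<close>, in which \<open>E y\<close> tends to 0, so the
  last term can be absorbed on the left.\<close>

lemma linear_equation_solution_continuous:
  fixes A :: "'d::euclidean_space \<Rightarrow> 'e::euclidean_space \<Rightarrow> 'e" and X :: "'d \<Rightarrow> 'e"
  assumes S: "open S" "x0 \<in> S"
    and A: "\<And>y. y \<in> S \<Longrightarrow> linear (A y)" and injA: "inj (A x0)"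
    and cA: "\<And>u. isCont (\<lambda>y. A y u) x0"
    and cb: "isCont b x0"
    and eq: "\<And>y. y \<in> S \<Longrightarrow> A y (X y) = b y"
  shows "isCont X x0"
proof -
  obtain L where L: "linear L" "\<And>u. L (A x0 u) = u"
    using linear_injective_left_inverse[OF A[OF S(2)] injA] by (metis comp_apply id_apply)
  have blL: "bounded_linear L" using L(1) by (simp add: linear_linear)
  define E where "E y u = L (A y u - A x0 u)" for y u
  have linE: "linear (E y)" if "y \<in> S" for y
  proof -
    have "linear (L \<circ> (\<lambda>u. A y u - A x0 u))"
      using A[OF that] A[OF S(2)] L(1) by (intro linear_compose linear_compose_sub) auto
    then show ?thesis by (simp add: E_def[abs_def] comp_def)
  qed
  have tE: "((\<lambda>y. E y u) \<longlongrightarrow> 0) (at x0)" for u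
  proof -
    have "((\<lambda>y. A y u - A x0 u) \<longlongrightarrow> A x0 u - A x0 u) (at x0)"
      using cA[of u] unfolding isCont_def by (intro tendsto_diff tendsto_const)
    then have "((\<lambda>y. A y u - A x0 u) \<longlongrightarrow> 0) (at x0)" by simp
    then show ?thesis unfolding E_def by (rule bounded_linear.tendsto_zero[OF blL])
  qed
  \<comment> \<open>The part of the increment that does not involve \<open>X y\<close>; it tends to
    0 because \<open>b\<close> and \<open>A\<close> are continuous at \<open>x0\<close>.\<close>
  define N where "N y = L (b y - b x0) - E y (X x0)" for y
  have fund: "X y - X x0 = N y - E y (X y - X x0)" if y: "y \<in> S" for y
  proof -
    have "L (b y - b x0) = L ((A y (X y) - A x0 (X y)) + (A x0 (X y - X x0)))"
      using eq[OF y] eq[OF S(2)] linear_diff[OF A[OF S(2)]] by simp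
    also have "\<dots> = E y (X y) + (X y - X x0)"
      by (simp add: E_def linear_add[OF L(1)] L(2))
    also have "E y (X y) = E y (X y - X x0) + E y (X x0)"
      by (simp add: linear_diff[OF linE[OF y]])
    finally show ?thesis by (simp add: N_def)
  qed
  have tN: "(N \<longlongrightarrow> 0) (at x0)"
  proof -
    have "((\<lambda>y. b y - b x0) \<longlongrightarrow> b x0 - b x0) (at x0)"
      using cb unfolding isCont_def by (intro tendsto_diff tendsto_const)
    then have "((\<lambda>y. b y - b x0) \<longlongrightarrow> 0) (at x0)" by simp
    then have "((\<lambda>y. L (b y - b x0)) \<longlongrightarrow> 0) (at x0)" by (rule bounded_linear.tendsto_zero[OF blL])
    from tendsto_diff[OF this tE] show ?thesis by (simp add: N_def[abs_def])
  qed
  define s where "s y = (\<Sum>e\<in>Basis. norm (E y e))" for y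
  have ts: "(s \<longlongrightarrow> 0) (at x0)"
    unfolding s_def using tE by (intro tendsto_null_sum tendsto_norm_zero)
  have Ebound: "norm (E y u) \<le> s y * norm u" if "y \<in> S" for y u
  proof -
    have "norm (E y u) \<le> (\<Sum>e\<in>Basis. norm ((u \<bullet> e) *\<^sub>R E y e))"
      by (subst linear_euclidean_expansion[OF linE[OF that]]) (rule norm_sum)
    also have "\<dots> \<le> (\<Sum>e\<in>Basis. norm (E y e) * norm u)"
      by (intro sum_mono) (simp add: Basis_le_norm mult.commute mult_right_mono)
    finally show ?thesis by (simp add: s_def sum_distrib_right)
  qed
  have evS: "\<forall>\<^sub>F y in at x0. y \<in> S"
    unfolding eventually_at_topological using S by blast
  have "((\<lambda>y. X y - X x0) \<longlongrightarrow> 0) (at x0)"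
  proof (rule Lim_null_comparison)
    have "\<forall>\<^sub>F y in at x0. s y < 1/2" using ts order_tendstoD(2)[of s 0 "at x0" "1/2"] by simp
    with evS show "\<forall>\<^sub>F y in at x0. norm (X y - X x0) \<le> 2 * norm (N y)"
    proof eventually_elim
      case (elim y)
      \<comment> \<open>Absorption: once the operator bound \<open>s y\<close> is below 1/2, at most
        half of the left side reappears on the right, whence the factor 2 in front of
        \<open>norm (N y)\<close>.\<close>
      have "norm (X y - X x0) \<le> norm (N y) + norm (E y (X y - X x0))"
        using fund[OF elim(1)] norm_triangle_ineq4 by metis
      also have "\<dots> \<le> norm (N y) + s y * norm (X y - X x0)"
        using Ebound[OF elim(1)] by simp
      also have "\<dots> \<le> norm (N y) + 1/2 * norm (X y - X x0)"
        using elim(2) by (intro add_left_mono mult_right_mono) auto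
      finally show ?case by simp
    qed
    show "((\<lambda>y. 2 * norm (N y)) \<longlongrightarrow> 0) (at x0)"
      using tendsto_mult_right_zero[OF tendsto_norm_zero[OF tN]] by auto
  qed
  then show ?thesis by (simp add: isCont_def LIM_zero_cancel)
qed

text \<open>The fixed-point identity from the continuity proof expresses \<open>X y\<close> by
  differentiable terms and by \<open>E y (X y - X x0)\<close>. Expanded in the basis, the latter is
  a sum of products of a coefficient of \<open>X y - X x0\<close>, which tends to 0 by continuity,
  with \<open>E y e\<close>, which is differentiable and vanishes at \<open>x0\<close>;
  \<open>has_derivative_zero_product\<close> applies.\<close>

lemma linear_equation_solution_differentiable:
  fixes A :: "'d::euclidean_space \<Rightarrow> 'e::euclidean_space \<Rightarrow> 'e" and X :: "'d \<Rightarrow> 'e"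
  assumes S: "open S" "x0 \<in> S"
    and A: "\<And>y. y \<in> S \<Longrightarrow> linear (A y)" and injA: "inj (A x0)"
    and dA: "\<And>u. (\<lambda>y. A y u) differentiable (at x0)"
    and db: "b differentiable (at x0)"
    and eq: "\<And>y. y \<in> S \<Longrightarrow> A y (X y) = b y"
  shows "X differentiable (at x0)"
proof -
  have "isCont X x0"
    by (rule linear_equation_solution_continuous[of S x0 A b])
      (use assms differentiable_imp_continuous_within in blast)+
  then have "((\<lambda>y. (X y - X x0) \<bullet> e) \<longlongrightarrow> (X x0 - X x0) \<bullet> e) (at x0)" for e
    unfolding isCont_def by (intro tendsto_inner tendsto_diff tendsto_const)
  then have tX: "((\<lambda>y. (X y - X x0) \<bullet> e) \<longlongrightarrow> 0) (at x0)" for e by simp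
  obtain L where L: "linear L" "\<And>u. L (A x0 u) = u"
    using linear_injective_left_inverse[OF A[OF S(2)] injA] by (metis comp_apply id_apply)
  have blL: "bounded_linear L" using L(1) by (simp add: linear_linear)
  have dL: "(\<lambda>y. L (f y)) differentiable (at x0)" if "f differentiable (at x0)" for f
    using that bounded_linear.has_derivative[OF blL] unfolding differentiable_def by blast
  define E where "E y u = L (A y u - A x0 u)" for y u
  have linE: "linear (E y)" if "y \<in> S" for y
  proof -
    have "linear (L \<circ> (\<lambda>u. A y u - A x0 u))"
      using A[OF that] A[OF S(2)] L(1) by (intro linear_compose linear_compose_sub) auto
    then show ?thesis by (simp add: E_def[abs_def] comp_def)
  qed
  have dE: "(\<lambda>y. E y u) differentiable (at x0)" for u
    unfolding E_def by (intro dL differentiable_diff dA differentiable_const)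
  have "(\<lambda>y. ((X y - X x0) \<bullet> e) *\<^sub>R E y e) differentiable (at x0)" for e
  proof -
    obtain D where "((\<lambda>y. E y e) has_derivative D) (at x0)" using dE differentiable_def by blast
    then have "((\<lambda>y. ((X y - X x0) \<bullet> e) *\<^sub>R E y e) has_derivative (\<lambda>h. 0)) (at x0)"
      using tX by (intro has_derivative_zero_product) (auto simp: E_def linear_0[OF L(1)])
    then show ?thesis by (auto simp: differentiable_def)
  qed
  then have "(\<lambda>y. X x0 + L (b y - b x0) - E y (X x0)
      - (\<Sum>e\<in>Basis. ((X y - X x0) \<bullet> e) *\<^sub>R E y e)) differentiable (at x0)"
    by (intro differentiable_add differentiable_diff differentiable_const dL db dE differentiable_sum) auto
  moreover have "X x0 + L (b y - b x0) - E y (X x0) - (\<Sum>e\<in>Basis. ((X y - X x0) \<bullet> e) *\<^sub>R E y e) = X y"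
    if y: "y \<in> S" for y
  proof -
    have "L (b y - b x0) = L ((A y (X y) - A x0 (X y)) + (A x0 (X y - X x0)))"
      using eq[OF y] eq[OF S(2)] linear_diff[OF A[OF S(2)]] by simp
    also have "\<dots> = E y (X y) + (X y - X x0)"
      by (simp add: E_def linear_add[OF L(1)] L(2))
    also have "E y (X y) = E y (X y - X x0) + E y (X x0)"
      by (simp add: linear_diff[OF linE[OF y]])
    finally show ?thesis
      unfolding linear_euclidean_expansion[OF linE[OF y], of "X y - X x0", symmetric]
      by (simp add: algebra_simps)
  qed
  ultimately show ?thesis
    unfolding differentiable_def
    by (metis (no_types, lifting) has_derivative_transform_within_open S)
qed

text \<open>The source of all smoothness of the Levi-Civita connection. The induction has to range
  over all right-hand sides, since differentiating the equation changes \<open>b\<close> but keeps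
  the operator \<open>A\<close>.\<close>

lemma linear_equation_solution_smooth:
  fixes A :: "'d::euclidean_space \<Rightarrow> 'e::euclidean_space \<Rightarrow> 'e" and X :: "'d \<Rightarrow> 'e"
  assumes S: "open S"
    and A: "\<And>y. y \<in> S \<Longrightarrow> linear (A y)" and injA: "\<And>y. y \<in> S \<Longrightarrow> inj (A y)"
    and sA: "\<And>u. smooth_on S (\<lambda>y. A y u)"
    and sb: "smooth_on S b"
    and eq: "\<And>y. y \<in> S \<Longrightarrow> A y (X y) = b y"
  shows "smooth_on S X"
proof -
  \<comment> \<open>The derivative of a solution solves the same equation with the right-hand side \<open>Db - (DA) Y\<close>.\<close>
  have "Ck_on k S Y" if "Ck_on k S c" "\<And>y. y \<in> S \<Longrightarrow> A y (Y y) = c y" for k Y c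
    using that
  proof (induction k arbitrary: Y c)
    case 0
    have "isCont Y x" if "x \<in> S" for x
    proof (rule linear_equation_solution_continuous[of S x A c])
      show "isCont c x" using 0 S that by (simp add: continuous_on_eq_continuous_at)
    qed (use 0 S A injA that smooth_on_continuous_at[OF sA that] in auto)
    then show ?case by (auto intro!: continuous_at_imp_continuous_on)
  next
    case (Suc k)
    have dc: "(c has_derivative frechet_derivative c (at x)) (at x)" if "x \<in> S" for x
      using Suc.prems that by (auto simp: frechet_derivative_works[symmetric])
    have dY: "(Y has_derivative frechet_derivative Y (at x)) (at x)" if "x \<in> S" for x
      unfolding frechet_derivative_works[symmetric]
      by (rule linear_equation_solution_differentiable[of S x A c])
        (use Suc.prems S A injA that smooth_on_differentiable[OF sA that] in auto)
    have YC: "Ck_on k S Y" by (rule Suc.IH[of c]) (use Suc.prems Ck_on_SucD in blast)+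
    have "Ck_on k S (\<lambda>x. frechet_derivative Y (at x) v)" for v
    proof (rule Suc.IH)
      let ?r = "\<lambda>x. frechet_derivative c (at x) v
         - (\<Sum>e\<in>Basis. (Y x \<bullet> e) *\<^sub>R frechet_derivative (\<lambda>y. A y e) (at x) v)"
      have "Ck_on k S (\<lambda>x. (Y x \<bullet> e) *\<^sub>R frechet_derivative (\<lambda>y. A y e) (at x) v)" for e
        using smooth_on_frechet_derivative[OF sA[of e], of v]
        by (intro Ck_on_bounded_bilinear[OF bounded_bilinear_scaleR] S YC
            Ck_on_bounded_linear[OF bounded_linear_inner_left]) (auto simp: smooth_on_def)
      then show "Ck_on k S ?r"
        using Suc.prems S by (intro Ck_on_diff Ck_on_sum) auto
      fix x assume x: "x \<in> S"
      \<comment> \<open>\<open>A y\<close> is known to be smooth only on fixed vectors, so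
        \<open>A y (Y y)\<close> is expanded in the basis before the product rule is
        applied.\<close>
      have "((\<lambda>y. \<Sum>e\<in>Basis. (Y y \<bullet> e) *\<^sub>R A y e) has_derivative
         (\<lambda>v. \<Sum>e\<in>Basis. (Y x \<bullet> e) *\<^sub>R frechet_derivative (\<lambda>y. A y e) (at x) v
             + (frechet_derivative Y (at x) v \<bullet> e) *\<^sub>R A x e)) (at x)"
        by (intro has_derivative_sum has_derivative_scaleR has_derivative_inner_left dY x
            smooth_on_has_derivative[OF sA])
      then have dc': "(c has_derivative
         (\<lambda>v. \<Sum>e\<in>Basis. (Y x \<bullet> e) *\<^sub>R frechet_derivative (\<lambda>y. A y e) (at x) v
             + (frechet_derivative Y (at x) v \<bullet> e) *\<^sub>R A x e)) (at x)"
        by (rule has_derivative_transform_within_open[OF _ S x])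
          (metis Suc.prems(2) linear_euclidean_expansion[OF A])
      have "frechet_derivative c (at x) v = (\<Sum>e\<in>Basis. (Y x \<bullet> e) *\<^sub>R frechet_derivative (\<lambda>y. A y e) (at x) v
             + (frechet_derivative Y (at x) v \<bullet> e) *\<^sub>R A x e)"
        by (rule fun_cong[OF has_derivative_unique[OF dc[OF x] dc']])
      then show "A x (frechet_derivative Y (at x) v) = ?r x"
        by (subst linear_euclidean_expansion[OF A[OF x]]) (simp add: sum.distrib)
    qed
    then show ?case using dY by (auto simp: differentiable_def)
  qed
  then show ?thesis using sb eq unfolding smooth_on_def by blast
qed

section \<open>Symmetry of second derivatives\<close>

lemma DERIV_along_line:
  fixes F :: "'e::real_normed_vector \<Rightarrow> real"
  assumes "(F has_derivative F') (at (p + t *\<^sub>R v))"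
  shows "((\<lambda>t. F (p + t *\<^sub>R v)) has_real_derivative F' v) (at t)"
proof -
  have "((\<lambda>t. p + t *\<^sub>R v) has_derivative (\<lambda>h. 0 + h *\<^sub>R v)) (at t)"
    by (intro has_derivative_add has_derivative_const has_derivative_scaleR_left has_derivative_ident)
  then have "((\<lambda>t. F (p + t *\<^sub>R v)) has_derivative (\<lambda>h. F' (h *\<^sub>R v))) (at t)"
    using has_derivative_compose[of "\<lambda>t. p + t *\<^sub>R v", OF _ assms] by simp
  moreover have "F' (h *\<^sub>R v) = F' v * h" for h
    using has_derivative_linear[OF assms] by (simp add: linear_cmul)
  ultimately show ?thesis by (simp add: has_field_derivative_def)
qed

text \<open>The mean value theorem twice: first in direction \<open>u\<close> for the difference of
  \<open>f\<close> along two parallel edges of the parallelogram, then in direction \<open>v\<close>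
  for the derivative of \<open>f\<close> along \<open>u\<close>.\<close>

lemma second_difference_mean_value:
  fixes f :: "'e::euclidean_space \<Rightarrow> real"
  assumes f: "smooth_on S f" and e: "e > 0"
    and sub: "\<And>s t. 0 \<le> s \<Longrightarrow> s \<le> e \<Longrightarrow> 0 \<le> t \<Longrightarrow> t \<le> e \<Longrightarrow> x + s *\<^sub>R u + t *\<^sub>R v \<in> S"
  obtains s t where "0 < s" "s < e" "0 < t" "t < e"
    "f (x + e *\<^sub>R u + e *\<^sub>R v) - f (x + e *\<^sub>R u) - f (x + e *\<^sub>R v) + f x
       = e * e * frechet_derivative (\<lambda>y. frechet_derivative f (at y) u) (at (x + s *\<^sub>R u + t *\<^sub>R v)) v"
proof -
  let ?D = "\<lambda>y. frechet_derivative f (at y) u"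
  have D: "((\<lambda>s. f (p + s *\<^sub>R u)) has_real_derivative ?D (p + s *\<^sub>R u)) (at s)"
    if "p + s *\<^sub>R u \<in> S" for p s
    by (intro DERIV_along_line smooth_on_has_derivative[OF f] that)
  have "\<exists>z>0. z < e \<and> (f (x + e *\<^sub>R v + e *\<^sub>R u) - f (x + e *\<^sub>R u)) - (f (x + e *\<^sub>R v + 0 *\<^sub>R u) - f (x + 0 *\<^sub>R u))
      = (e - 0) * (?D (x + e *\<^sub>R v + z *\<^sub>R u) - ?D (x + z *\<^sub>R u))"
  proof (rule MVT2[OF e])
    fix s assume s: "0 \<le> s" "s \<le> e"
    have "x + e *\<^sub>R v + s *\<^sub>R u \<in> S" using sub[of s e] s e by (simp add: algebra_simps)
    moreover have "x + s *\<^sub>R u \<in> S" using sub[of s 0] s e by simp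
    ultimately show "((\<lambda>s. f (x + e *\<^sub>R v + s *\<^sub>R u) - f (x + s *\<^sub>R u)) has_real_derivative
         ?D (x + e *\<^sub>R v + s *\<^sub>R u) - ?D (x + s *\<^sub>R u)) (at s)"
      by (intro DERIV_diff D)
  qed
  then obtain s where s: "0 < s" "s < e"
    and 1: "f (x + e *\<^sub>R u + e *\<^sub>R v) - f (x + e *\<^sub>R u) - f (x + e *\<^sub>R v) + f x
      = e * (?D (x + e *\<^sub>R v + s *\<^sub>R u) - ?D (x + s *\<^sub>R u))"
    by (auto simp: algebra_simps)
  have "\<exists>z>0. z < e \<and> ?D (x + s *\<^sub>R u + e *\<^sub>R v) - ?D (x + s *\<^sub>R u + 0 *\<^sub>R v)
      = (e - 0) * frechet_derivative ?D (at (x + s *\<^sub>R u + z *\<^sub>R v)) v"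
  proof (rule MVT2[OF e])
    fix t assume t: "0 \<le> t" "t \<le> e"
    show "((\<lambda>t. ?D (x + s *\<^sub>R u + t *\<^sub>R v)) has_real_derivative
         frechet_derivative ?D (at (x + s *\<^sub>R u + t *\<^sub>R v)) v) (at t)"
      using sub[of s t] s t
      by (intro DERIV_along_line smooth_on_has_derivative[OF smooth_on_frechet_derivative[OF f]]) auto
  qed
  then obtain t where t: "0 < t" "t < e"
    and 2: "?D (x + s *\<^sub>R u + e *\<^sub>R v) - ?D (x + s *\<^sub>R u)
      = e * frechet_derivative ?D (at (x + s *\<^sub>R u + t *\<^sub>R v)) v"
    by auto
  have "x + e *\<^sub>R v + s *\<^sub>R u = x + s *\<^sub>R u + e *\<^sub>R v" by simp
  with 1 2 show thesis using that[OF s t] by (simp only: mult.assoc)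
qed

text \<open>The second difference over a parallelogram does not change when \<open>u\<close> and
  \<open>v\<close> are exchanged. The two mixed derivatives therefore agree at some nearby points,
  and continuity moves this to \<open>x\<close>.\<close>

lemma second_derivative_symmetric_real:
  fixes f :: "'e::euclidean_space \<Rightarrow> real"
  assumes S: "open S" "x \<in> S" and f: "smooth_on S f"
  shows "frechet_derivative (\<lambda>y. frechet_derivative f (at y) u) (at x) v
       = frechet_derivative (\<lambda>y. frechet_derivative f (at y) v) (at x) u"
proof -
  let ?H = "\<lambda>u v y. frechet_derivative (\<lambda>y. frechet_derivative f (at y) u) (at y) v"
  have cont: "isCont (?H u v) x" for u v
    using smooth_on_continuous_at[OF _ S(2)] smooth_on_frechet_derivative f by blast
  have "\<bar>?H u v x - ?H v u x\<bar> < 2 * \<epsilon>" if \<epsilon>: "\<epsilon> > 0" for \<epsilon>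
  proof -
    obtain d1 where d1: "d1 > 0" "\<And>y. dist y x < d1 \<Longrightarrow> dist (?H u v y) (?H u v x) < \<epsilon>"
      using cont[of u v] \<epsilon> unfolding continuous_at_eps_delta by blast
    obtain d2 where d2: "d2 > 0" "\<And>y. dist y x < d2 \<Longrightarrow> dist (?H v u y) (?H v u x) < \<epsilon>"
      using cont[of v u] \<epsilon> unfolding continuous_at_eps_delta by blast
    obtain r where r: "r > 0" "ball x r \<subseteq> S" using S open_contains_ball by blast
    define d where "d = min r (min d1 d2)"
    \<comment> \<open>Small enough that the whole parallelogram stays within \<open>d / 2\<close> of
      \<open>x\<close>; the summand 1 keeps the denominator positive when \<open>u\<close> and
      \<open>v\<close> vanish.\<close>
    define e where "e = d / (2 * (norm u + norm v + 1))"
    have pos: "d > 0" "norm u + norm v + 1 > 0"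
      using r d1 d2 norm_ge_zero[of u] norm_ge_zero[of v] by (auto simp: d_def intro: add_nonneg_pos)
    then have e: "e > 0" by (simp add: e_def)
    have small: "dist (x + s *\<^sub>R u + t *\<^sub>R v) x < d" if "0 \<le> s" "s \<le> e" "0 \<le> t" "t \<le> e" for s t
    proof -
      have "dist (x + s *\<^sub>R u + t *\<^sub>R v) x \<le> norm (s *\<^sub>R u) + norm (t *\<^sub>R v)"
        by (simp add: dist_norm add.assoc norm_triangle_ineq del: norm_scaleR)
      also have "\<dots> \<le> e * norm u + e * norm v" using that by (intro add_mono) (auto intro: mult_right_mono)
      also have "\<dots> \<le> e * (norm u + norm v + 1)" using e by (simp add: algebra_simps)
      also have "\<dots> = d / 2" using pos(2) by (simp add: e_def field_simps)
      also have "\<dots> < d" using pos by simp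
      finally show ?thesis .
    qed
    have sub: "y \<in> S" if "dist y x < d" for y
      using that r(2) by (auto simp: d_def dist_commute subset_iff)
    obtain s t where st: "0 < s" "s < e" "0 < t" "t < e"
      "f (x + e *\<^sub>R u + e *\<^sub>R v) - f (x + e *\<^sub>R u) - f (x + e *\<^sub>R v) + f x
        = e * e * ?H u v (x + s *\<^sub>R u + t *\<^sub>R v)"
      using second_difference_mean_value[OF f e, of x u v] sub small by blast
    have small': "dist (x + s *\<^sub>R v + t *\<^sub>R u) x < d" if "0 \<le> s" "s \<le> e" "0 \<le> t" "t \<le> e" for s t
      using small[of t s] that by (simp add: algebra_simps)
    obtain s' t' where st': "0 < s'" "s' < e" "0 < t'" "t' < e"
      "f (x + e *\<^sub>R v + e *\<^sub>R u) - f (x + e *\<^sub>R v) - f (x + e *\<^sub>R u) + f x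
        = e * e * ?H v u (x + s' *\<^sub>R v + t' *\<^sub>R u)"
      using second_difference_mean_value[OF f e, of x v u] sub small' by blast
    have "f (x + e *\<^sub>R v + e *\<^sub>R u) = f (x + e *\<^sub>R u + e *\<^sub>R v)" by (simp add: algebra_simps)
    with st(5) st'(5) have "e * e * ?H u v (x + s *\<^sub>R u + t *\<^sub>R v) = e * e * ?H v u (x + s' *\<^sub>R v + t' *\<^sub>R u)"
      by linarith
    with e have "?H u v (x + s *\<^sub>R u + t *\<^sub>R v) = ?H v u (x + s' *\<^sub>R v + t' *\<^sub>R u)"
      by simp
    moreover have "dist (?H u v (x + s *\<^sub>R u + t *\<^sub>R v)) (?H u v x) < \<epsilon>"
      using small[of s t] st d1(2) by (auto simp: d_def)
    moreover have "dist (?H v u (x + s' *\<^sub>R v + t' *\<^sub>R u)) (?H v u x) < \<epsilon>"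
      using small'[of s' t'] st' d2(2) by (auto simp: d_def)
    ultimately show ?thesis by (simp add: dist_real_def)
  qed
  \<comment> \<open>If the two values differed, half their distance as \<open>\<epsilon>\<close>
    would make the distance strictly smaller than itself.\<close>
  from this[of "\<bar>?H u v x - ?H v u x\<bar> / 2"] show ?thesis by auto
qed

lemma frechet_derivative_inner_left:
  assumes "f differentiable (at x)"
  shows "frechet_derivative (\<lambda>y. f y \<bullet> b) (at x) v = frechet_derivative f (at x) v \<bullet> b"
  using has_derivative_inner_left[OF assms[unfolded frechet_derivative_works], of b]
  by (metis frechet_derivative_at)

lemma frechet_derivative_cong_open:
  assumes "open S" "x \<in> S" "\<And>y. y \<in> S \<Longrightarrow> f y = g y"
  shows "frechet_derivative f (at x) = frechet_derivative g (at x)"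
proof -
  have "(f has_derivative f') (at x) = (g has_derivative f') (at x)" for f'
    using assms has_derivative_transform_within_open[OF _ assms(1,2)] by (metis (no_types))
  then show ?thesis by (simp add: frechet_derivative_def)
qed

lemma second_derivative_symmetric:
  fixes f :: "'e::euclidean_space \<Rightarrow> 'f::euclidean_space"
  assumes S: "open S" "x \<in> S" and f: "smooth_on S f"
  shows "frechet_derivative (\<lambda>y. frechet_derivative f (at y) u) (at x) v
       = frechet_derivative (\<lambda>y. frechet_derivative f (at y) v) (at x) u"
proof (rule euclidean_eqI)
  fix b :: 'f assume "b \<in> Basis"
  have "frechet_derivative (\<lambda>y. frechet_derivative f (at y) u) (at x) v \<bullet> b
      = frechet_derivative (\<lambda>y. frechet_derivative (\<lambda>z. f z \<bullet> b) (at y) u) (at x) v" for u v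
  proof -
    have "frechet_derivative (\<lambda>y. frechet_derivative f (at y) u) (at x) v \<bullet> b
        = frechet_derivative (\<lambda>y. frechet_derivative f (at y) u \<bullet> b) (at x) v"
      using smooth_on_differentiable[OF smooth_on_frechet_derivative[OF f] S(2)]
      by (simp add: frechet_derivative_inner_left)
    also have "\<dots> = frechet_derivative (\<lambda>y. frechet_derivative (\<lambda>z. f z \<bullet> b) (at y) u) (at x) v"
      using smooth_on_differentiable[OF f]
      by (subst frechet_derivative_cong_open[OF S]) (auto simp: frechet_derivative_inner_left)
    finally show ?thesis .
  qed
  then show "frechet_derivative (\<lambda>y. frechet_derivative f (at y) u) (at x) v \<bullet> b
       = frechet_derivative (\<lambda>y. frechet_derivative f (at y) v) (at x) u \<bullet> b"
    using second_derivative_symmetric_real[OF S smooth_on_inner_left[OF S(1) f, of b], of u v] by simp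
qed

section \<open>Multilinear maps on lists and their product rule\<close>

definition multilinear :: "nat \<Rightarrow> ('e::real_vector list \<Rightarrow> 'f::real_vector) \<Rightarrow> bool" where
  "multilinear n T \<longleftrightarrow> (\<forall>vs r. length vs = n \<longrightarrow> r < n \<longrightarrow> linear (\<lambda>v. T (vs[r := v])))"

lemma multilinearD: "multilinear n T \<Longrightarrow> length vs = n \<Longrightarrow> r < n \<Longrightarrow> linear (\<lambda>v. T (vs[r := v]))"
  by (simp add: multilinear_def)

lemma multilinear_Cons_linear: "multilinear (Suc n) T \<Longrightarrow> length vs = n \<Longrightarrow> linear (\<lambda>v. T (v # vs))"
  using multilinearD[of "Suc n" T "0 # vs" 0] by simp

lemma multilinear_Cons: "multilinear (Suc n) T \<Longrightarrow> multilinear n (\<lambda>vs. T (v # vs))"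
  unfolding multilinear_def
proof (intro allI impI)
  fix vs :: "'a list" and r
  assume "\<forall>vs r. length vs = Suc n \<longrightarrow> r < Suc n \<longrightarrow> linear (\<lambda>v. T (vs[r := v]))"
    and "length vs = n" "r < n"
  then have "linear (\<lambda>w. T ((v # vs)[Suc r := w]))" by (metis length_Cons Suc_less_eq)
  then show "linear (\<lambda>w. T (v # vs[r := w]))" by simp
qed

text \<open>\<open>cov_deriv\<close> differentiates tensors at constant vectors only, whereas
  naturality has to differentiate a tensor along a map \<open>\<phi>\<close> with moving arguments.
  Expanding the head argument in the basis leaves products of a scalar function with a tensor of one
  slot less, to which the induction hypothesis applies. The list updates in the result have the
  shape of those in \<open>cov_deriv\<close>.\<close>

lemma has_derivative_multilinear:
  fixes T :: "'e::euclidean_space \<Rightarrow> 'e list \<Rightarrow> 'f::real_normed_vector"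
    and \<phi> :: "'d::real_normed_vector \<Rightarrow> 'e"
  assumes V: "open V" "\<phi> x \<in> V" and ml: "\<And>y. y \<in> V \<Longrightarrow> multilinear n (T y)"
    and dT: "\<And>vs. length vs = n \<Longrightarrow> (\<lambda>y. T y vs) differentiable (at (\<phi> x))"
    and d\<phi>: "(\<phi> has_derivative \<phi>') (at x)"
    and das: "\<And>r. r < n \<Longrightarrow> (as ! r has_derivative as' r) (at x)"
    and len: "length as = n"
  shows "((\<lambda>y. T (\<phi> y) (map (\<lambda>a. a y) as)) has_derivative
    (\<lambda>h. frechet_derivative (\<lambda>y. T y (map (\<lambda>a. a x) as)) (at (\<phi> x)) (\<phi>' h)
       + (\<Sum>r<n. T (\<phi> x) ((map (\<lambda>a. a x) as)[r := as' r h])))) (at x)"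
  using ml dT das len
proof (induction as arbitrary: n T as')
  case Nil
  then show ?case
    using has_derivative_compose[OF d\<phi>, of "\<lambda>y. T y []"] by (simp add: frechet_derivative_works)
next
  case (Cons a as)
  obtain m where n: "n = Suc m" using Cons.prems by (cases n) auto
  have lm: "length as = m" using Cons.prems n by simp
  let ?vs = "map (\<lambda>a. a x) as"
  have da: "(a has_derivative as' 0) (at x)" using Cons.prems(3)[of 0] n by simp
  have lin: "linear (\<lambda>v. T y (v # vs))" if "y \<in> V" "length vs = m" for y vs
    using Cons.prems(1) that n by (auto intro: multilinear_Cons_linear)
  have ev: "\<forall>\<^sub>F y in at x. \<phi> y \<in> V"
    using topological_tendstoD[OF _ V] has_derivative_continuous[OF d\<phi>] unfolding isCont_def by blast
  have exp: "(\<Sum>b\<in>Basis. (w \<bullet> b) *\<^sub>R T y (b # vs)) = T y (w # vs)" if "y \<in> V" "length vs = m" for y vs w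
    by (rule linear_euclidean_expansion[OF lin[OF that], symmetric])
  have IH: "((\<lambda>y. T (\<phi> y) (b # map (\<lambda>a. a y) as)) has_derivative
    (\<lambda>h. frechet_derivative (\<lambda>y. T y (b # ?vs)) (at (\<phi> x)) (\<phi>' h)
       + (\<Sum>r<m. T (\<phi> x) (b # ?vs[r := as' (Suc r) h])))) (at x)" for b
  proof (rule Cons.IH)
    show "multilinear m (\<lambda>vs. T y (b # vs))" if "y \<in> V" for y
      using Cons.prems(1)[OF that] n by (simp add: multilinear_Cons)
    show "(as ! r has_derivative as' (Suc r)) (at x)" if "r < m" for r
      using Cons.prems(3)[of "Suc r"] that n by simp
  qed (use Cons.prems n lm in auto)
  have "((\<lambda>y. \<Sum>b\<in>Basis. (a y \<bullet> b) *\<^sub>R T (\<phi> y) (b # map (\<lambda>a. a y) as)) has_derivative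
     (\<lambda>h. \<Sum>b\<in>Basis. (a x \<bullet> b) *\<^sub>R (frechet_derivative (\<lambda>y. T y (b # ?vs)) (at (\<phi> x)) (\<phi>' h)
       + (\<Sum>r<m. T (\<phi> x) (b # ?vs[r := as' (Suc r) h]))) + (as' 0 h \<bullet> b) *\<^sub>R T (\<phi> x) (b # ?vs))) (at x)"
    by (intro has_derivative_sum has_derivative_scaleR has_derivative_inner_left da IH)
  then have D: "((\<lambda>y. T (\<phi> y) (a y # map (\<lambda>a. a y) as)) has_derivative
     (\<lambda>h. \<Sum>b\<in>Basis. (a x \<bullet> b) *\<^sub>R (frechet_derivative (\<lambda>y. T y (b # ?vs)) (at (\<phi> x)) (\<phi>' h)
       + (\<Sum>r<m. T (\<phi> x) (b # ?vs[r := as' (Suc r) h]))) + (as' 0 h \<bullet> b) *\<^sub>R T (\<phi> x) (b # ?vs))) (at x)"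
  proof (rule has_derivative_transform_eventually)
    show "\<forall>\<^sub>F y in at x. (\<Sum>b\<in>Basis. (a y \<bullet> b) *\<^sub>R T (\<phi> y) (b # map (\<lambda>a. a y) as))
       = T (\<phi> y) (a y # map (\<lambda>a. a y) as)"
      using ev by eventually_elim (simp add: exp lm)
  qed (use V(2) lm in \<open>auto simp: exp\<close>)
  \<comment> \<open>The expansion is undone: the coefficients are now constants, so the sum of
    derivatives is the derivative at the fixed head \<open>a x\<close>.\<close>
  have "(\<Sum>b\<in>Basis. (a x \<bullet> b) *\<^sub>R frechet_derivative (\<lambda>y. T y (b # ?vs)) (at (\<phi> x)) k)
      = frechet_derivative (\<lambda>y. T y (a x # ?vs)) (at (\<phi> x)) k" for k
  proof -
    have "((\<lambda>y. \<Sum>b\<in>Basis. (a x \<bullet> b) *\<^sub>R T y (b # ?vs)) has_derivative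
        (\<lambda>k. \<Sum>b\<in>Basis. (a x \<bullet> b) *\<^sub>R frechet_derivative (\<lambda>y. T y (b # ?vs)) (at (\<phi> x)) k)) (at (\<phi> x))"
      using Cons.prems(2) n lm
      by (intro has_derivative_sum has_derivative_scaleR_right) (simp add: frechet_derivative_works[symmetric])
    then have "((\<lambda>y. T y (a x # ?vs)) has_derivative
        (\<lambda>k. \<Sum>b\<in>Basis. (a x \<bullet> b) *\<^sub>R frechet_derivative (\<lambda>y. T y (b # ?vs)) (at (\<phi> x)) k)) (at (\<phi> x))"
      by (rule has_derivative_transform_within_open[OF _ V]) (simp add: exp lm)
    from fun_cong[OF frechet_derivative_at[OF this]] show ?thesis .
  qed
  moreover have "(\<Sum>b\<in>Basis. (a x \<bullet> b) *\<^sub>R (\<Sum>r<m. T (\<phi> x) (b # ?vs[r := w r])))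
     = (\<Sum>r<m. T (\<phi> x) (a x # ?vs[r := w r]))" for w
    using V(2) lm by (simp add: scaleR_sum_right exp sum.swap[of _ "{..<m}"])
  ultimately have "(\<lambda>h. \<Sum>b\<in>Basis. (a x \<bullet> b) *\<^sub>R (frechet_derivative (\<lambda>y. T y (b # ?vs)) (at (\<phi> x)) (\<phi>' h)
       + (\<Sum>r<m. T (\<phi> x) (b # ?vs[r := as' (Suc r) h]))) + (as' 0 h \<bullet> b) *\<^sub>R T (\<phi> x) (b # ?vs))
    = (\<lambda>h. frechet_derivative (\<lambda>y. T y (map (\<lambda>a. a x) (a # as))) (at (\<phi> x)) (\<phi>' h)
       + (\<Sum>r<n. T (\<phi> x) ((map (\<lambda>a. a x) (a # as))[r := as' r h])))"
    using V(2) lm by (auto simp: n sum.distrib scaleR_add_right exp sum.lessThan_Suc_shift fun_eq_iff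
        simp del: sum.lessThan_Suc)
  with D show ?case by simp
qed

text \<open>Linearity in the parameter holds near \<open>x\<close>, so it passes to the derivative
  by uniqueness of derivatives. This makes the derivatives of \<open>G\<close> and
  \<open>levi_civita\<close> tensorial in their vector arguments.\<close>

lemma linear_frechet_derivative_parameter:
  assumes "open S" "x \<in> S" "\<And>y. y \<in> S \<Longrightarrow> linear (f y)"
    and "\<And>v. (\<lambda>y. f y v) differentiable (at x)"
  shows "linear (\<lambda>v. frechet_derivative (\<lambda>y. f y v) (at x) u)"
proof (rule linearI)
  have D: "((\<lambda>y. f y v) has_derivative frechet_derivative (\<lambda>y. f y v) (at x)) (at x)" for v
    using assms(4) by (simp add: frechet_derivative_works[symmetric])
  fix v w and c :: real
  have "((\<lambda>y. f y (v + w)) has_derivative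
      (\<lambda>h. frechet_derivative (\<lambda>y. f y v) (at x) h + frechet_derivative (\<lambda>y. f y w) (at x) h)) (at x)"
    by (rule has_derivative_transform_within_open[OF has_derivative_add[OF D D] assms(1,2)])
      (simp add: assms(3) linear_add)
  from fun_cong[OF frechet_derivative_at[OF this]]
  show "frechet_derivative (\<lambda>y. f y (v + w)) (at x) u
      = frechet_derivative (\<lambda>y. f y v) (at x) u + frechet_derivative (\<lambda>y. f y w) (at x) u" by simp
  have "((\<lambda>y. f y (c *\<^sub>R v)) has_derivative (\<lambda>h. c *\<^sub>R frechet_derivative (\<lambda>y. f y v) (at x) h)) (at x)"
    by (rule has_derivative_transform_within_open[OF has_derivative_scaleR_right[OF D] assms(1,2)])
      (simp add: assms(3) linear_cmul)
  from fun_cong[OF frechet_derivative_at[OF this]]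
  show "frechet_derivative (\<lambda>y. f y (c *\<^sub>R v)) (at x) u = c *\<^sub>R frechet_derivative (\<lambda>y. f y v) (at x) u"
    by simp
qed

lemma smooth_on_linear_apply:
  fixes f :: "'d::euclidean_space \<Rightarrow> 'e::euclidean_space \<Rightarrow> 'f::real_normed_vector"
  assumes "open S" "\<And>y. y \<in> S \<Longrightarrow> linear (f y)" "\<And>v. smooth_on S (\<lambda>y. f y v)" "smooth_on S X"
  shows "smooth_on S (\<lambda>y. f y (X y))"
proof (rule smooth_on_cong[OF assms(1)])
  show "smooth_on S (\<lambda>y. \<Sum>b\<in>Basis. (X y \<bullet> b) *\<^sub>R f y b)"
    using assms by (intro smooth_on_sum smooth_on_scaleR smooth_on_inner_left) auto
  show "(\<Sum>b\<in>Basis. (X y \<bullet> b) *\<^sub>R f y b) = f y (X y)" if "y \<in> S" for y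
    by (rule linear_euclidean_expansion[OF assms(2)[OF that], symmetric])
qed

lemma bilinear_imp_multilinear: "bilinear B \<Longrightarrow> multilinear 2 (\<lambda>vs. B (vs ! 0) (vs ! 1))"
  unfolding multilinear_def
proof (intro allI impI)
  fix vs :: "'a list" and r :: nat
  assume "bilinear B" "length vs = 2" "r < 2"
  then show "linear (\<lambda>v. B (vs[r := v] ! 0) (vs[r := v] ! 1))"
    by (cases "r = 0") (auto simp: bilinear_def nth_list_update)
qed

lemma has_derivative_bilinear_field:
  fixes B :: "'e::euclidean_space \<Rightarrow> 'e \<Rightarrow> 'e \<Rightarrow> 'f::real_normed_vector"
    and \<phi> :: "'d::real_normed_vector \<Rightarrow> 'e"
  assumes V: "open V" "\<phi> x \<in> V" and bl: "\<And>y. y \<in> V \<Longrightarrow> bilinear (B y)"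
    and dB: "\<And>u v. (\<lambda>y. B y u v) differentiable (at (\<phi> x))"
    and d: "(\<phi> has_derivative \<phi>') (at x)" "(a has_derivative a') (at x)" "(b has_derivative b') (at x)"
  shows "((\<lambda>y. B (\<phi> y) (a y) (b y)) has_derivative
    (\<lambda>h. frechet_derivative (\<lambda>y. B y (a x) (b x)) (at (\<phi> x)) (\<phi>' h)
       + B (\<phi> x) (a' h) (b x) + B (\<phi> x) (a x) (b' h))) (at x)"
proof -
  have "((\<lambda>y. B (\<phi> y) (map (\<lambda>a. a y) [a, b] ! 0) (map (\<lambda>a. a y) [a, b] ! 1)) has_derivative
    (\<lambda>h. frechet_derivative (\<lambda>y. B y (map (\<lambda>a. a x) [a, b] ! 0) (map (\<lambda>a. a x) [a, b] ! 1)) (at (\<phi> x)) (\<phi>' h)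
       + (\<Sum>r<2. B (\<phi> x) ((map (\<lambda>a. a x) [a, b])[r := (if r = 0 then a' else b') h] ! 0)
            ((map (\<lambda>a. a x) [a, b])[r := (if r = 0 then a' else b') h] ! 1)))) (at x)"
    by (rule has_derivative_multilinear[where V=V and \<phi>=\<phi> and n=2
          and T="\<lambda>y vs. B y (vs ! 0) (vs ! 1)"])
      (use V bl[THEN bilinear_imp_multilinear] dB d in \<open>auto simp: less_2_cases_iff\<close>)
  then show ?thesis by (simp add: numeral_2_eq_2 add.assoc)
qed

section \<open>Nondegenerate forms\<close>

text \<open>The signature is arbitrary: nondegeneracy takes the role of positivity, and the
  Euclidean inner product of \<open>'e\<close> serves only for coordinates and for identifying
  covectors with vectors.\<close>

locale nondegenerate_form =
  fixes g :: "'e::euclidean_space \<Rightarrow> 'e \<Rightarrow> real"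
  assumes bilinear: "bilinear g"
    and sym: "g u v = g v u"
    and nondegenerate: "(\<And>w. g u w = 0) \<Longrightarrow> u = 0"
begin

lemma linear_left: "linear (\<lambda>u. g u w)" and linear_right: "linear (g u)"
  using bilinear by (auto simp: bilinear_def)

lemmas left_simps = linear_add[OF linear_left] linear_diff[OF linear_left] linear_cmul[OF linear_left]
  linear_0[OF linear_left] linear_neg[OF linear_left]

lemmas right_simps = linear_add[OF linear_right] linear_diff[OF linear_right] linear_cmul[OF linear_right]
  linear_0[OF linear_right] linear_neg[OF linear_right]

lemma eqI: "(\<And>w. g u w = g v w) \<Longrightarrow> u = v"
  using nondegenerate[of "u - v"] by (simp add: left_simps)

text \<open>Lowering an index, with the resulting covector written as a vector through the Euclidean
  inner product.\<close>

definition flat :: "'e \<Rightarrow> 'e" where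
  "flat u = (\<Sum>b\<in>Basis. g u b *\<^sub>R b)"

lemma flat_inner: "flat u \<bullet> w = g u w"
  by (subst linear_euclidean_expansion[OF linear_right])
    (auto simp: flat_def inner_sum_left inner_commute[of w] intro!: sum.cong)

lemma linear_flat: "linear flat"
  by (rule linearI) (simp_all add: flat_def left_simps scaleR_add_left sum.distrib scaleR_sum_right)

lemma inj_flat: "inj flat"
  by (rule injI, rule eqI) (metis flat_inner)

text \<open>Raising an index: nondegeneracy makes \<open>flat\<close> injective, hence surjective in
  finite dimension.\<close>

lemma representation: "linear \<phi> \<Longrightarrow> \<exists>u. \<forall>w. g u w = \<phi> w"
proof -
  assume \<phi>: "linear \<phi>"
  obtain u where "flat u = (\<Sum>b\<in>Basis. \<phi> b *\<^sub>R b)"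
    using linear_injective_imp_surjective[OF linear_flat inj_flat] by (metis surj_def)
  then have "g u w = \<phi> w" for w
    using flat_inner[of u w] linear_euclidean_expansion[OF \<phi>, of w]
    by (simp add: inner_sum_left inner_commute[of w] mult.commute)
  then show ?thesis by blast
qed

lemma linear_representation:
  assumes "\<And>v. linear (B v)" "\<And>w. linear (\<lambda>v. B v w)"
  obtains A where "linear A" "\<And>v w. g (A v) w = B v w"
proof -
  obtain A where A: "\<And>v w. g (A v) w = B v w" using representation[OF assms(1)] by metis
  have "linear A"
    by (rule linearI; rule eqI)
      (simp_all add: A left_simps linear_add[OF assms(2)] linear_cmul[OF assms(2)])
  with A show thesis using that by blast
qed

end

text \<open>Traces are written as sums over the standard basis; this identity makes them invariant
  under conjugation by a linear isomorphism.\<close>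

lemma trace_commute:
  fixes f :: "'a::euclidean_space \<Rightarrow> 'b::euclidean_space" and h :: "'b \<Rightarrow> 'a"
  assumes "linear f" "linear h"
  shows "(\<Sum>b\<in>Basis. f (h b) \<bullet> b) = (\<Sum>c\<in>Basis. h (f c) \<bullet> c)"
proof -
  have "(\<Sum>b\<in>Basis. f (h b) \<bullet> b) = (\<Sum>b\<in>Basis. \<Sum>c\<in>Basis. (h b \<bullet> c) * (f c \<bullet> b))"
    by (subst linear_euclidean_expansion[OF assms(1)]) (simp add: inner_sum_left)
  also have "\<dots> = (\<Sum>c\<in>Basis. \<Sum>b\<in>Basis. (f c \<bullet> b) * (h b \<bullet> c))"
    by (subst sum.swap) (simp add: mult.commute)
  also have "\<dots> = (\<Sum>c\<in>Basis. h (f c) \<bullet> c)"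
    by (subst (2) linear_euclidean_expansion[OF assms(2)]) (simp add: inner_sum_left)
  finally show ?thesis .
qed

section \<open>Curvature of a metric on an open set\<close>

locale local_metric =
  fixes U :: "'e::euclidean_space set" and G :: "'e \<Rightarrow> 'e \<Rightarrow> 'e \<Rightarrow> real"
  assumes open_U: "open U"
    and form: "x \<in> U \<Longrightarrow> nondegenerate_form (G x)"
    and smooth: "smooth_on U (\<lambda>x. G x u w)"
begin

abbreviation dG :: "'e \<Rightarrow> 'e \<Rightarrow> 'e \<Rightarrow> 'e \<Rightarrow> real" where
  "dG x u v w \<equiv> frechet_derivative (\<lambda>y. G y v w) (at x) u"

lemma G_bilinear: "x \<in> U \<Longrightarrow> bilinear (G x)"
  using form by (simp add: nondegenerate_form_def)

lemma G_linear_left: "x \<in> U \<Longrightarrow> linear (\<lambda>u. G x u w)"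
  and G_linear_right: "x \<in> U \<Longrightarrow> linear (G x u)"
  using nondegenerate_form.linear_left nondegenerate_form.linear_right form by blast+

lemma G_sym: "x \<in> U \<Longrightarrow> G x u v = G x v u"
  using form nondegenerate_form.sym by blast

lemma dG_sym: "x \<in> U \<Longrightarrow> dG x u v w = dG x u w v"
  by (subst frechet_derivative_cong_open[OF open_U, of _ "\<lambda>y. G y v w" "\<lambda>y. G y w v"])
    (auto simp: G_sym)

lemma dG_linear:
  assumes "x \<in> U"
  shows "linear (\<lambda>u. dG x u v w)" "linear (\<lambda>v. dG x u v w)" "linear (\<lambda>w. dG x u v w)"
proof -
  have d: "(\<lambda>y. G y v w) differentiable (at x)" for v w
    using smooth_on_differentiable[OF smooth assms] .
  show "linear (\<lambda>u. dG x u v w)" using linear_frechet_derivative[OF d] .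
  show "linear (\<lambda>v. dG x u v w)"
    by (rule linear_frechet_derivative_parameter[OF open_U assms]) (auto intro: d G_linear_left)
  show "linear (\<lambda>w. dG x u v w)"
    by (rule linear_frechet_derivative_parameter[OF open_U assms]) (auto intro: d G_linear_right)
qed

text \<open>Koszul's formula for constant vector fields, whose brackets vanish: the Christoffel
  symbols of the first kind.\<close>

definition koszul :: "'e \<Rightarrow> 'e \<Rightarrow> 'e \<Rightarrow> 'e \<Rightarrow> real" where
  "koszul x u v w = (dG x u v w + dG x v u w - dG x w u v) / 2"

text \<open>The predicate inside the \<open>THE\<close> of \<open>levi_civita\<close>, named so that
  existence and uniqueness can be stated.\<close>

definition metric_connection :: "'e \<Rightarrow> ('e \<Rightarrow> 'e \<Rightarrow> 'e) \<Rightarrow> bool" where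
  "metric_connection x \<Gamma> \<longleftrightarrow> bilinear \<Gamma> \<and> (\<forall>u v. \<Gamma> u v = \<Gamma> v u) \<and>
     (\<forall>u v w. dG x u v w = G x (\<Gamma> u v) w + G x v (\<Gamma> u w))"

text \<open>Inserting metric compatibility into the three terms of \<open>koszul\<close> leaves,
  after cancellation by the two symmetries, twice the same product. Since \<open>\<Gamma>\<close> is
  arbitrary, this also yields uniqueness.\<close>

lemma metric_connection_koszul:
  assumes x: "x \<in> U" and \<Gamma>: "metric_connection x \<Gamma>"
  shows "G x (\<Gamma> u v) w = koszul x u v w"
proof -
  have m: "dG x u v w = G x (\<Gamma> u v) w + G x v (\<Gamma> u w)" for u v w
    using \<Gamma> by (simp add: metric_connection_def)
  have s: "\<Gamma> u v = \<Gamma> v u" for u v using \<Gamma> by (simp add: metric_connection_def)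
  show ?thesis
    unfolding koszul_def m using s[of u v] s[of u w] s[of v w]
      G_sym[OF x, of v "\<Gamma> w u"] G_sym[OF x, of v] G_sym[OF x, of u]
    by simp
qed

text \<open>For fixed \<open>u\<close> and \<open>v\<close> the Koszul expression is linear in
  \<open>w\<close>, hence represented by a vector; bilinearity, symmetry and metric compatibility
  are then read off the formula.\<close>

lemma metric_connection_exists:
  assumes x: "x \<in> U"
  shows "\<exists>\<Gamma>. metric_connection x \<Gamma>"
proof -
  interpret nondegenerate_form "G x" by (rule form[OF x])
  note l = dG_linear[OF x]
  have "linear (koszul x u v)" for u v
    by (rule linearI) (simp_all add: koszul_def linear_add[OF l(1)] linear_add[OF l(3)]
        linear_cmul[OF l(1)] linear_cmul[OF l(3)] field_simps)
  then have ex: "\<exists>z. \<forall>w. G x z w = koszul x u v w" for u v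
    by (rule representation)
  define \<Gamma> where "\<Gamma> u v = (SOME z. \<forall>w. G x z w = koszul x u v w)" for u v
  have \<Gamma>: "G x (\<Gamma> u v) w = koszul x u v w" for u v w
    using someI_ex[OF ex[of u v]] unfolding \<Gamma>_def by (rule spec)
  have "linear (\<lambda>u. \<Gamma> u v)" for v
    by (rule linearI; rule eqI) (simp_all add: \<Gamma> left_simps koszul_def
        linear_add[OF l(1)] linear_add[OF l(2)] linear_cmul[OF l(1)] linear_cmul[OF l(2)] field_simps)
  moreover have \<Gamma>s: "\<Gamma> u v = \<Gamma> v u" for u v
  proof (rule eqI)
    show "G x (\<Gamma> u v) w = G x (\<Gamma> v u) w" for w
      using dG_sym[OF x, of u v w] by (simp add: \<Gamma> koszul_def)
  qed
  ultimately have "bilinear \<Gamma>" by (simp add: bilinear_def)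
  moreover have "dG x u v w = G x (\<Gamma> u v) w + G x v (\<Gamma> u w)" for u v w
    using dG_sym[OF x, of v w u] dG_sym[OF x, of w u v] dG_sym[OF x, of u v w]
    unfolding sym[of v] \<Gamma> koszul_def by (simp add: field_simps)
  ultimately show ?thesis using \<Gamma>s by (auto simp: metric_connection_def)
qed

lemma metric_connection_unique:
  assumes "x \<in> U" "metric_connection x \<Gamma>" "metric_connection x \<Gamma>'"
  shows "\<Gamma> = \<Gamma>'"
  by (intro ext nondegenerate_form.eqI[OF form[OF assms(1)]])
    (simp add: metric_connection_koszul[OF assms(1,2)] metric_connection_koszul[OF assms(1,3)])

lemma levi_civita_eqI: "x \<in> U \<Longrightarrow> metric_connection x \<Gamma> \<Longrightarrow> levi_civita G x = \<Gamma>"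
  unfolding levi_civita_def metric_connection_def[symmetric]
  by (rule the_equality) (auto intro: metric_connection_unique)

lemma levi_civita_metric_connection: "x \<in> U \<Longrightarrow> metric_connection x (levi_civita G x)"
  using metric_connection_exists levi_civita_eqI by metis

lemma levi_civita_bilinear: "x \<in> U \<Longrightarrow> bilinear (levi_civita G x)"
  and levi_civita_sym: "x \<in> U \<Longrightarrow> levi_civita G x u v = levi_civita G x v u"
  and levi_civita_metric: "x \<in> U \<Longrightarrow> dG x u v w = G x (levi_civita G x u v) w + G x v (levi_civita G x u w)"
  using levi_civita_metric_connection by (auto simp: metric_connection_def)

lemma levi_civita_linear:
  "x \<in> U \<Longrightarrow> linear (\<lambda>u. levi_civita G x u v)" "x \<in> U \<Longrightarrow> linear (levi_civita G x u)"
  using levi_civita_bilinear by (auto simp: bilinear_def)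

text \<open>Koszul's formula says that \<open>flat\<close> of the connection has the Euclidean
  components \<open>koszul x u v b\<close>: a linear equation with smooth coefficients and smooth
  right-hand side. The operator \<open>?A\<close> is \<open>flat\<close> written out, so that its
  dependence on the point is visible.\<close>

lemma levi_civita_smooth: "smooth_on U (\<lambda>x. levi_civita G x u v)"
proof (rule linear_equation_solution_smooth[OF open_U])
  let ?A = "\<lambda>x u. \<Sum>b\<in>Basis. G x u b *\<^sub>R b"
  have A: "?A x = nondegenerate_form.flat (G x)" if "x \<in> U" for x
    by (intro ext) (simp add: nondegenerate_form.flat_def[OF form[OF that]])
  show "linear (?A x)" "inj (?A x)" if "x \<in> U" for x
    using A[OF that] nondegenerate_form.linear_flat nondegenerate_form.inj_flat form[OF that]
    by metis+
  show "smooth_on U (\<lambda>x. ?A x u)" for u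
    by (intro smooth_on_sum smooth_on_scaleR_left open_U smooth)
  have "smooth_on U (\<lambda>x. (1/2) * (dG x u v w + dG x v u w - dG x w u v))" for w
    by (intro smooth_on_mult smooth_on_const smooth_on_add smooth_on_diff open_U
        smooth_on_frechet_derivative smooth)
  then have "smooth_on U (\<lambda>x. koszul x u v w)" for w by (simp add: koszul_def)
  then show "smooth_on U (\<lambda>x. \<Sum>b\<in>Basis. koszul x u v b *\<^sub>R b)"
    by (intro smooth_on_sum smooth_on_scaleR_left open_U)
  show "?A x (levi_civita G x u v) = (\<Sum>b\<in>Basis. koszul x u v b *\<^sub>R b)" if "x \<in> U" for x
    by (simp add: metric_connection_koszul[OF that levi_civita_metric_connection[OF that]])
qed

lemma levi_civita_differentiable: "x \<in> U \<Longrightarrow> (\<lambda>y. levi_civita G y u v) differentiable (at x)"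
  by (rule smooth_on_differentiable[OF levi_civita_smooth])

abbreviation d\<Gamma> :: "'e \<Rightarrow> 'e \<Rightarrow> 'e \<Rightarrow> 'e \<Rightarrow> 'e" where
  "d\<Gamma> x u v w \<equiv> frechet_derivative (\<lambda>y. levi_civita G y v w) (at x) u"

lemma d\<Gamma>_linear:
  assumes "x \<in> U"
  shows "linear (\<lambda>u. d\<Gamma> x u v w)" "linear (\<lambda>v. d\<Gamma> x u v w)" "linear (\<lambda>w. d\<Gamma> x u v w)"
proof -
  note d = levi_civita_differentiable[OF assms]
  show "linear (\<lambda>u. d\<Gamma> x u v w)" using linear_frechet_derivative[OF d] .
  show "linear (\<lambda>v. d\<Gamma> x u v w)"
    by (rule linear_frechet_derivative_parameter[OF open_U assms]) (auto intro: d levi_civita_linear)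
  show "linear (\<lambda>w. d\<Gamma> x u v w)"
    by (rule linear_frechet_derivative_parameter[OF open_U assms]) (auto intro: d levi_civita_linear)
qed

lemma curvature_op_linear:
  assumes x: "x \<in> U"
  shows "linear (\<lambda>u. curvature_op G x u v w)" "linear (\<lambda>v. curvature_op G x u v w)"
    "linear (\<lambda>w. curvature_op G x u v w)"
proof -
  note l = d\<Gamma>_linear[OF x] and c = levi_civita_linear[OF x]
  have k: "linear (\<lambda>u. levi_civita G x (f u) v)" "linear (\<lambda>u. levi_civita G x v (f u))"
    if "linear f" for f v
    using linear_compose[OF that c(1)] linear_compose[OF that c(2)] by (simp_all add: comp_def)
  show "linear (\<lambda>u. curvature_op G x u v w)" "linear (\<lambda>v. curvature_op G x u v w)"
    "linear (\<lambda>w. curvature_op G x u v w)"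
    unfolding curvature_op_def
    by (intro linear_compose_sub linear_compose_add l k linear_ident)+
qed

lemma curvature_op_smooth: "smooth_on U (\<lambda>x. curvature_op G x u v w)"
  unfolding curvature_op_def
  by (intro smooth_on_add smooth_on_diff open_U smooth_on_frechet_derivative levi_civita_smooth
      smooth_on_linear_apply[of U "\<lambda>x. levi_civita G x u" for u] levi_civita_linear) auto

lemma curvature_tensor_multilinear:
  assumes x: "x \<in> U"
  shows "multilinear 4 (curvature_tensor G x)"
  unfolding multilinear_def
proof (intro allI impI)
  fix vs :: "'e list" and r :: nat
  assume "length vs = 4" "r < 4"
  then obtain a b c d where vs: "vs = [a, b, c, d]"
    by (auto simp: length_Suc_conv eval_nat_numeral)
  have k: "linear (\<lambda>u. G x (f u) v)" if "linear f" for f :: "'e \<Rightarrow> 'e" and v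
    using linear_compose[OF that G_linear_left[OF x]] by (simp add: comp_def)
  have "r = 0 \<or> r = 1 \<or> r = 2 \<or> r = 3" using \<open>r < 4\<close> by auto
  then show "linear (\<lambda>v. curvature_tensor G x (vs[r := v]))"
    by (elim disjE) (simp_all add: vs curvature_tensor_def k curvature_op_linear[OF x] G_linear_right[OF x]
        numeral_2_eq_2 numeral_3_eq_3)
qed

lemma curvature_tensor_smooth: "smooth_on U (\<lambda>x. curvature_tensor G x vs)"
  unfolding curvature_tensor_def
  by (rule smooth_on_linear_apply[of U "\<lambda>x u. G x u w" for w])
    (auto intro: open_U G_linear_left smooth curvature_op_smooth)

lemma cov_deriv_multilinear:
  assumes ml: "\<And>y. y \<in> U \<Longrightarrow> multilinear n (T y)"
    and sm: "\<And>vs. length vs = n \<Longrightarrow> smooth_on U (\<lambda>y. T y vs)" and x: "x \<in> U"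
  shows "multilinear (Suc n) (cov_deriv G T x)"
  unfolding multilinear_def
proof (intro allI impI)
  fix us :: "'e list" and r
  assume "length us = Suc n" and r: "r < Suc n"
  then obtain u vs where us: "us = u # vs" and len: "length vs = n" by (auto simp: length_Suc_conv)
  note d = smooth_on_differentiable[OF sm x]
  have Tl: "linear (\<lambda>v. T x (ws[s := f v]))" if "linear f" "length ws = n" "s < n"
    for f :: "'e \<Rightarrow> 'e" and ws s
    using linear_compose[OF that(1) multilinearD[OF ml[OF x] that(2,3)]] by (simp add: comp_def)
  show "linear (\<lambda>v. cov_deriv G T x (us[r := v]))"
  proof (cases r)
    case 0
    have "linear (\<lambda>u. frechet_derivative (\<lambda>y. T y vs) (at x) u
        - (\<Sum>s<n. T x (vs[s := levi_civita G x u (vs ! s)])))"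
      using linear_frechet_derivative[OF d[OF len]] Tl levi_civita_linear[OF x] len
      by (intro linear_compose_sub linear_compose_sum) auto
    then show ?thesis by (simp add: us 0 cov_deriv_def Let_def len)
  next
    case (Suc s)
    with r have s: "s < n" by simp
    have "linear (\<lambda>v. T x (vs[s := v, q := levi_civita G x u (vs[s := v] ! q)]))" if q: "q < n" for q
    \<comment> \<open>If the connection acts on the varied slot itself, the second update overwrites
      the first and \<open>T\<close> is composed with the connection; otherwise the two updates
      commute.\<close>
    proof (cases "q = s")
      case True
      then show ?thesis using Tl[OF levi_civita_linear(2)[OF x] len s] len s by simp
    next
      case False
      then have "vs[s := v, q := levi_civita G x u (vs[s := v] ! q)]
          = vs[q := levi_civita G x u (vs ! q), s := v]" for v
        by (simp add: list_update_swap)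
      then show ?thesis using Tl[OF linear_ident, of "vs[q := levi_civita G x u (vs ! q)]" s] len s
        by simp
    qed
    moreover have "linear (\<lambda>v. frechet_derivative (\<lambda>y. T y (vs[s := v])) (at x) u)"
      by (rule linear_frechet_derivative_parameter[OF open_U x])
        (use multilinearD[OF ml len s] d len in auto)
    ultimately have "linear (\<lambda>v. frechet_derivative (\<lambda>y. T y (vs[s := v])) (at x) u
        - (\<Sum>q<n. T x (vs[s := v, q := levi_civita G x u (vs[s := v] ! q)])))"
      by (intro linear_compose_sub linear_compose_sum) auto
    then show ?thesis by (simp add: us Suc cov_deriv_def Let_def len)
  qed
qed

lemma cov_deriv_smooth:
  assumes ml: "\<And>y. y \<in> U \<Longrightarrow> multilinear n (T y)"
    and sm: "\<And>vs. length vs = n \<Longrightarrow> smooth_on U (\<lambda>y. T y vs)" and len: "length us = Suc n"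
  shows "smooth_on U (\<lambda>x. cov_deriv G T x us)"
proof -
  obtain u vs where us: "us = u # vs" and len: "length vs = n"
    using len by (auto simp: length_Suc_conv)
  have "smooth_on U (\<lambda>x. T x (vs[r := levi_civita G x u (vs ! r)]))" if "r < n" for r
    by (rule smooth_on_linear_apply[of U "\<lambda>x v. T x (vs[r := v])"])
      (use len that multilinearD[OF ml len that] sm open_U levi_civita_smooth in auto)
  then have "smooth_on U (\<lambda>x. frechet_derivative (\<lambda>y. T y vs) (at x) u
      - (\<Sum>r<n. T x (vs[r := levi_civita G x u (vs ! r)])))"
    using sm len by (intro smooth_on_diff smooth_on_sum open_U smooth_on_frechet_derivative) auto
  then show ?thesis by (simp add: us cov_deriv_def Let_def len)
qed

text \<open>Both properties go through one induction: multilinearity of the next derivative needs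
  the present one to be differentiable, and its smoothness needs linearity in each slot, because the
  connection inserts vectors that depend on the point.\<close>

lemma nabla_curvature_multilinear_smooth:
  "(\<forall>x\<in>U. multilinear (l + 4) (nabla_curvature G l x)) \<and>
   (\<forall>vs. length vs = l + 4 \<longrightarrow> smooth_on U (\<lambda>x. nabla_curvature G l x vs))"
proof (induction l)
  case 0
  then show ?case by (simp add: curvature_tensor_multilinear curvature_tensor_smooth)
next
  case (Suc l)
  then show ?case
    using cov_deriv_multilinear[of "l + 4" "nabla_curvature G l"]
      cov_deriv_smooth[of "l + 4" "nabla_curvature G l"] by simp
qed

lemmas nabla_curvature_multilinear = nabla_curvature_multilinear_smooth[THEN conjunct1, rule_format]
lemmas nabla_curvature_smooth = nabla_curvature_multilinear_smooth[THEN conjunct2, rule_format]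

lemma ricci_linear:
  assumes x: "x \<in> U"
  shows "linear (ricci G x v)" "linear (\<lambda>v. ricci G x v w)"
proof -
  note l = curvature_op_linear[OF x]
  show "linear (ricci G x v)" "linear (\<lambda>v. ricci G x v w)"
    by (rule linearI; simp add: ricci_def linear_add[OF l(2)] linear_add[OF l(3)] linear_cmul[OF l(2)]
        linear_cmul[OF l(3)] inner_add_left sum.distrib sum_distrib_left)+
qed

lemma ricci_op_eqI:
  assumes x: "x \<in> U" and A: "linear A" "\<And>v w. G x (A v) w = ricci G x v w"
  shows "ricci_op G x = A"
  unfolding ricci_op_def
proof (rule the_equality)
  interpret nondegenerate_form "G x" by (rule form[OF x])
  show "A' = A" if "linear A' \<and> (\<forall>v w. G x (A' v) w = ricci G x v w)" for A'
    using that A by (intro ext eqI) simp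
qed (use A in auto)

lemma ricci_op_spec:
  assumes x: "x \<in> U"
  shows "linear (ricci_op G x)" "G x (ricci_op G x v) w = ricci G x v w"
proof -
  obtain A where "linear A" "\<And>v w. G x (A v) w = ricci G x v w"
    using nondegenerate_form.linear_representation[OF form[OF x] ricci_linear[OF x]] by metis
  with ricci_op_eqI[OF x] show "linear (ricci_op G x)" "G x (ricci_op G x v) w = ricci G x v w"
    by metis+
qed

end

section \<open>Scalar curvature under pointwise linear isometries\<close>

lemma local_metric_subset:
  "local_metric U G \<Longrightarrow> open V \<Longrightarrow> V \<subseteq> U \<Longrightarrow> local_metric V G"
  unfolding local_metric_def using smooth_on_subset by blast

lemma linear_left_right_inverse:
  assumes "linear L" "\<And>u. M (L u) = u" "\<And>u. L (M u) = u"
  shows "linear M"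
proof (rule linearI)
  show "M (u + v) = M u + M v" for u v
    using assms(2)[of "M u + M v"] by (simp add: linear_add[OF assms(1)] assms(3))
  show "M (c *\<^sub>R u) = c *\<^sub>R M u" for c u
    using assms(2)[of "c *\<^sub>R M u"] by (simp add: linear_cmul[OF assms(1)] assms(3))
qed

text \<open>A kernel vector would be \<open>g1\<close>-orthogonal to everything; equality of
  dimensions then turns injectivity into bijectivity.\<close>

lemma linear_isometry_bij:
  fixes L :: "'e::euclidean_space \<Rightarrow> 'e"
  assumes "nondegenerate_form g1" "linear L" "k \<noteq> 0" "\<And>u w. g2 (L u) (L w) = k * g1 u w"
    and "\<And>w. g2 0 w = 0"
  shows "bij L"
proof -
  have "u = 0" if "L u = 0" for u
  proof (rule nondegenerate_form.nondegenerate[OF assms(1)])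
    show "g1 u w = 0" for w using assms(3) assms(4)[of u w] assms(5) that by simp
  qed
  then have "inj L" using assms(2) linear_injective_0 by blast
  then show ?thesis using linear_injective_imp_surjective[OF assms(2)] by (simp add: bij_def)
qed

text \<open>Purely algebraic: the map \<open>L\<close> lives at the two points only and need not be
  the derivative of anything, as required for 0-curvature homogeneity. It intertwines the curvature
  operators, and the two traces are invariant under conjugation by \<open>L\<close>.\<close>

lemma scalar_curvature_local_cong:
  fixes G1 G2 :: "'e::euclidean_space \<Rightarrow> 'e \<Rightarrow> 'e \<Rightarrow> real"
  assumes m1: "local_metric U1 G1" "x \<in> U1" and m2: "local_metric U2 G2" "y \<in> U2"
    and L: "linear L" and iso: "\<And>u w. G2 y (L u) (L w) = G1 x u w"
    and R: "\<And>u v w z. curvature_tensor G2 y [L u, L v, L w, L z] = curvature_tensor G1 x [u, v, w, z]"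
  shows "scalar_curvature_local G2 y = scalar_curvature_local G1 x"
proof -
  interpret m1: local_metric U1 G1 by fact
  interpret m2: local_metric U2 G2 by fact
  interpret f1: nondegenerate_form "G1 x" by (rule m1.form[OF m1(2)])
  interpret f2: nondegenerate_form "G2 y" by (rule m2.form[OF m2(2)])
  have "bij L" using linear_isometry_bij[OF f1.nondegenerate_form_axioms L, of 1 "G2 y"] iso f2.left_simps by simp
  then obtain M where M_L: "\<And>u. M (L u) = u" and L_M: "\<And>u. L (M u) = u"
    using bij_inv_eq_iff by metis
  have M: "linear M" by (rule linear_left_right_inverse[OF L M_L L_M])
  have LI: "u = v" if "\<And>w. G2 y u (L w) = G2 y v (L w)" for u v
    by (rule f2.eqI) (metis L_M that)
  have LR: "curvature_op G2 y (L u) (L v) (L w) = L (curvature_op G1 x u v w)" for u v w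
    using R[of u v w] by (intro LI) (simp add: curvature_tensor_def iso numeral_2_eq_2 numeral_3_eq_3)
  have ric: "ricci G2 y (L v) (L w) = ricci G1 x v w" for v w
  proof -
    \<comment> \<open>The basis vector \<open>b\<close> is written as \<open>L (M b)\<close>, which
      exposes a conjugate of the operator for \<open>G1\<close> inside the trace.\<close>
    have "ricci G2 y (L v) (L w) = (\<Sum>b\<in>Basis. L (curvature_op G1 x (M b) v w) \<bullet> b)"
      unfolding ricci_def LR[symmetric] L_M ..
    also have "\<dots> = (\<Sum>c\<in>Basis. curvature_op G1 x (M (L c)) v w \<bullet> c)"
      using linear_compose[OF M m1.curvature_op_linear(1)[OF m1(2)]]
      by (intro trace_commute L) (simp add: comp_def)
    finally show ?thesis by (simp add: M_L ricci_def)
  qed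
  have A: "ricci_op G2 y (L v) = L (ricci_op G1 x v)" for v
    by (rule LI) (simp add: m2.ricci_op_spec[OF m2(2)] iso ric m1.ricci_op_spec[OF m1(2)])
  have "scalar_curvature_local G2 y = (\<Sum>b\<in>Basis. L (ricci_op G1 x (M b)) \<bullet> b)"
    unfolding scalar_curvature_local_def A[symmetric] L_M ..
  also have "\<dots> = (\<Sum>c\<in>Basis. ricci_op G1 x (M (L c)) \<bullet> c)"
    using linear_compose[OF M m1.ricci_op_spec(1)[OF m1(2)]]
    by (intro trace_commute L) (simp add: comp_def)
  finally show ?thesis by (simp add: M_L scalar_curvature_local_def)
qed

section \<open>Naturality under local homotheties\<close>

text \<open>\<open>F\<close> is the coordinate representative of a homothety between two possibly
  different charts. It need only map \<open>U\<close> into \<open>V\<close>, so restrictions to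
  small domains and the identity between two expressions of a metric are covered.\<close>

locale local_homothety = m1: local_metric U G1 + m2: local_metric V G2
  for U :: "'e::euclidean_space set" and G1 and V :: "'e set" and G2 +
  fixes F :: "'e \<Rightarrow> 'e" and k :: real
  assumes F_smooth: "smooth_on U F" and F_maps: "x \<in> U \<Longrightarrow> F x \<in> V" and k_nonzero: "k \<noteq> 0"
    and F_metric: "x \<in> U \<Longrightarrow>
      G2 (F x) (frechet_derivative F (at x) u) (frechet_derivative F (at x) w) = k * G1 x u w"
begin

abbreviation "DF x u \<equiv> frechet_derivative F (at x) u"
abbreviation "D2F x u v \<equiv> frechet_derivative (\<lambda>y. DF y v) (at x) u"
abbreviation "\<Gamma>1 \<equiv> levi_civita G1"
abbreviation "\<Gamma>2 \<equiv> levi_civita G2"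

lemma DF_smooth: "smooth_on U (\<lambda>x. DF x v)"
  by (rule smooth_on_frechet_derivative[OF F_smooth])

lemma DF_has_derivative: "x \<in> U \<Longrightarrow> ((\<lambda>y. DF y v) has_derivative (\<lambda>u. D2F x u v)) (at x)"
  by (rule smooth_on_has_derivative[OF DF_smooth])

lemma F_has_derivative: "x \<in> U \<Longrightarrow> (F has_derivative DF x) (at x)"
  by (rule smooth_on_has_derivative[OF F_smooth])

lemma DF_linear: "x \<in> U \<Longrightarrow> linear (DF x)"
  by (rule has_derivative_linear[OF F_has_derivative])

lemma DF_bij:
  assumes "x \<in> U"
  shows "bij (DF x)"
  using linear_isometry_bij[OF m1.form[OF assms] DF_linear[OF assms] k_nonzero, of "G2 (F x)"]
    F_metric[OF assms] nondegenerate_form.left_simps(4)[OF m2.form[OF F_maps[OF assms]]] by blast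

lemma D2F_sym: "x \<in> U \<Longrightarrow> D2F x u v = D2F x v u"
  by (rule second_derivative_symmetric[OF m1.open_U _ F_smooth])

lemma D2F_linear: "x \<in> U \<Longrightarrow> linear (\<lambda>u. D2F x u v)"
  by (rule has_derivative_linear[OF DF_has_derivative])

text \<open>The inhomogeneous transformation law of Christoffel symbols. Applying the inverse of
  \<open>DF x\<close> to the right side gives a candidate \<open>\<Gamma>\<close>: it is symmetric
  because \<open>D2F\<close> is, it is metric because \<open>F_metric\<close> can be differentiated,
  and uniqueness identifies it with the connection of \<open>G1\<close>.\<close>

lemma levi_civita_natural:
  assumes x: "x \<in> U"
  shows "DF x (\<Gamma>1 x u v) = D2F x u v + \<Gamma>2 (F x) (DF x u) (DF x v)"
proof -
  obtain M where MF: "\<And>u. M (DF x u) = u" and FM: "\<And>u. DF x (M u) = u"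
    using DF_bij[OF x] bij_inv_eq_iff by metis
  note lF = linear_add[OF DF_linear[OF x]] linear_cmul[OF DF_linear[OF x]]
  have M: "linear M" by (rule linear_left_right_inverse[OF DF_linear[OF x] MF FM])
  note Fx = F_maps[OF x]
  define \<Gamma> where "\<Gamma> u v = M (D2F x u v + \<Gamma>2 (F x) (DF x u) (DF x v))" for u v
  have s: "\<Gamma> u v = \<Gamma> v u" for u v
    using D2F_sym[OF x, of u v] m2.levi_civita_sym[OF Fx, of "DF x u" "DF x v"] by (simp add: \<Gamma>_def)
  have "linear (\<lambda>u. \<Gamma> u v)" for v
    by (rule linearI) (simp_all add: \<Gamma>_def linear_add[OF M] linear_cmul[OF M] linear_add[OF D2F_linear[OF x]]
        linear_cmul[OF D2F_linear[OF x]] lF linear_add[OF m2.levi_civita_linear(1)[OF Fx]]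
        linear_cmul[OF m2.levi_civita_linear(1)[OF Fx]] algebra_simps)
  then have "bilinear \<Gamma>" unfolding bilinear_def using s by simp
  moreover have "m1.dG x u v w = G1 x (\<Gamma> u v) w + G1 x v (\<Gamma> u w)" for u v w
  proof -
    interpret f1: nondegenerate_form "G1 x" by (rule m1.form[OF x])
    interpret f2: nondegenerate_form "G2 (F x)" by (rule m2.form[OF Fx])
    \<comment> \<open>The two derivatives of the identity \<open>F_metric\<close>: this one from the
      product rule on its left side, the other from its right side, where the constant
      \<open>k\<close> factors out and finally cancels.\<close>
    have "((\<lambda>y. G2 (F y) (DF y v) (DF y w)) has_derivative
      (\<lambda>h. m2.dG (F x) (DF x h) (DF x v) (DF x w)
         + G2 (F x) (D2F x h v) (DF x w) + G2 (F x) (DF x v) (D2F x h w))) (at x)"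
      by (rule has_derivative_bilinear_field[where V=V and \<phi>=F and B=G2])
        (use m2.open_U Fx x m2.G_bilinear smooth_on_differentiable[OF m2.smooth Fx] F_has_derivative DF_has_derivative in auto)
    then have "((\<lambda>y. k * G1 y v w) has_derivative
      (\<lambda>h. m2.dG (F x) (DF x h) (DF x v) (DF x w)
         + G2 (F x) (D2F x h v) (DF x w) + G2 (F x) (DF x v) (D2F x h w))) (at x)"
      by (rule has_derivative_transform_within_open[OF _ m1.open_U x]) (rule F_metric)
    moreover have "((\<lambda>y. k * G1 y v w) has_derivative (\<lambda>h. k * m1.dG x h v w)) (at x)"
      by (intro has_derivative_mult_right smooth_on_has_derivative[OF m1.smooth] x)
    ultimately have "(\<lambda>h. k * m1.dG x h v w) = (\<lambda>h. m2.dG (F x) (DF x h) (DF x v) (DF x w)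
         + G2 (F x) (D2F x h v) (DF x w) + G2 (F x) (DF x v) (D2F x h w))"
      using has_derivative_unique by blast
    then have "k * m1.dG x u v w = m2.dG (F x) (DF x u) (DF x v) (DF x w)
         + G2 (F x) (D2F x u v) (DF x w) + G2 (F x) (DF x v) (D2F x u w)"
      by (rule fun_cong)
    also have "\<dots> = G2 (F x) (DF x (\<Gamma> u v)) (DF x w) + G2 (F x) (DF x v) (DF x (\<Gamma> u w))"
      unfolding m2.levi_civita_metric[OF Fx] by (simp add: \<Gamma>_def FM f2.left_simps f2.right_simps)
    also have "\<dots> = k * (G1 x (\<Gamma> u v) w + G1 x v (\<Gamma> u w))"
      by (simp add: F_metric[OF x] distrib_left)
    finally show ?thesis using k_nonzero by simp
  qed
  ultimately have "\<Gamma>1 x = \<Gamma>"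
    using s by (intro m1.levi_civita_eqI[OF x]) (simp add: m1.metric_connection_def)
  then show ?thesis by (simp add: \<Gamma>_def FM)
qed

text \<open>The derivative of the transformation law of the connection is antisymmetrised in
  \<open>u\<close> and \<open>v\<close>; all terms containing second or third derivatives of
  \<open>F\<close> cancel.\<close>

lemma curvature_op_natural:
  assumes x: "x \<in> U"
  shows "DF x (curvature_op G1 x u v w) = curvature_op G2 (F x) (DF x u) (DF x v) (DF x w)"
proof -
  note Fx = F_maps[OF x]
  note lF = linear_add[OF DF_linear[OF x]] linear_diff[OF DF_linear[OF x]]
  let ?D3 = "\<lambda>u v w. frechet_derivative (\<lambda>y. D2F y v w) (at x) u"
  have D3_sym: "?D3 u v w = ?D3 v u w" for u v w
    by (rule second_derivative_symmetric[OF m1.open_U x DF_smooth])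
  have D: "DF x (m1.d\<Gamma> x u v w) = ?D3 u v w + m2.d\<Gamma> (F x) (DF x u) (DF x v) (DF x w)
      + \<Gamma>2 (F x) (D2F x u v) (DF x w) + \<Gamma>2 (F x) (DF x v) (D2F x u w) - D2F x u (\<Gamma>1 x v w)" for u v w
  proof -
    have "((\<lambda>y. \<Gamma>2 (F y) (DF y v) (DF y w)) has_derivative
      (\<lambda>h. m2.d\<Gamma> (F x) (DF x h) (DF x v) (DF x w)
         + \<Gamma>2 (F x) (D2F x h v) (DF x w) + \<Gamma>2 (F x) (DF x v) (D2F x h w))) (at x)"
      by (rule has_derivative_bilinear_field[where V=V and \<phi>=F and B=\<Gamma>2])
        (use m2.open_U Fx x m2.levi_civita_bilinear m2.levi_civita_differentiable[OF Fx] F_has_derivative DF_has_derivative in auto)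
    then have "((\<lambda>y. D2F y v w + \<Gamma>2 (F y) (DF y v) (DF y w)) has_derivative
      (\<lambda>h. ?D3 h v w + (m2.d\<Gamma> (F x) (DF x h) (DF x v) (DF x w)
         + \<Gamma>2 (F x) (D2F x h v) (DF x w) + \<Gamma>2 (F x) (DF x v) (D2F x h w)))) (at x)"
      by (intro has_derivative_add smooth_on_has_derivative[OF smooth_on_frechet_derivative[OF DF_smooth]] x)
    then have 1: "((\<lambda>y. DF y (\<Gamma>1 y v w)) has_derivative
      (\<lambda>h. ?D3 h v w + (m2.d\<Gamma> (F x) (DF x h) (DF x v) (DF x w)
         + \<Gamma>2 (F x) (D2F x h v) (DF x w) + \<Gamma>2 (F x) (DF x v) (D2F x h w)))) (at x)"
      by (rule has_derivative_transform_within_open[OF _ m1.open_U x]) (simp add: levi_civita_natural)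
    \<comment> \<open>The same function is differentiated a second time, now by the product rule for
      \<open>DF y\<close> applied to a moving vector; comparison with \<open>1\<close> isolates
      \<open>DF x\<close> of the derivative of the connection.\<close>
    have "((\<lambda>y. \<Sum>b\<in>Basis. (\<Gamma>1 y v w \<bullet> b) *\<^sub>R DF y b) has_derivative
        (\<lambda>h. \<Sum>b\<in>Basis. (\<Gamma>1 x v w \<bullet> b) *\<^sub>R D2F x h b + (m1.d\<Gamma> x h v w \<bullet> b) *\<^sub>R DF x b)) (at x)"
      by (intro has_derivative_sum has_derivative_scaleR has_derivative_inner_left DF_has_derivative x
          smooth_on_has_derivative[OF m1.levi_civita_smooth])
    then have "((\<lambda>y. DF y (\<Gamma>1 y v w)) has_derivative
        (\<lambda>h. \<Sum>b\<in>Basis. (\<Gamma>1 x v w \<bullet> b) *\<^sub>R D2F x h b + (m1.d\<Gamma> x h v w \<bullet> b) *\<^sub>R DF x b)) (at x)"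
      by (rule has_derivative_transform_within_open[OF _ m1.open_U x])
        (rule linear_euclidean_expansion[OF DF_linear, symmetric])
    from fun_cong[OF has_derivative_unique[OF 1 this], of u]
    have "?D3 u v w + (m2.d\<Gamma> (F x) (DF x u) (DF x v) (DF x w)
         + \<Gamma>2 (F x) (D2F x u v) (DF x w) + \<Gamma>2 (F x) (DF x v) (D2F x u w))
       = (\<Sum>b\<in>Basis. (\<Gamma>1 x v w \<bullet> b) *\<^sub>R D2F x u b) + (\<Sum>b\<in>Basis. (m1.d\<Gamma> x u v w \<bullet> b) *\<^sub>R DF x b)"
      by (simp add: sum.distrib)
    also have "(\<Sum>b\<in>Basis. (m1.d\<Gamma> x u v w \<bullet> b) *\<^sub>R DF x b) = DF x (m1.d\<Gamma> x u v w)"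
      by (rule linear_euclidean_expansion[OF DF_linear[OF x], symmetric])
    also have "(\<Sum>b\<in>Basis. (\<Gamma>1 x v w \<bullet> b) *\<^sub>R D2F x u b) = D2F x u (\<Gamma>1 x v w)"
      using linear_euclidean_expansion[OF D2F_linear[OF x, of u], of "\<Gamma>1 x v w"]
      by (simp add: D2F_sym[OF x, of u])
    finally show ?thesis by (simp add: algebra_simps)
  qed
  have \<Gamma>\<Gamma>: "DF x (\<Gamma>1 x u (\<Gamma>1 x v w)) = D2F x u (\<Gamma>1 x v w) + \<Gamma>2 (F x) (DF x u) (D2F x v w)
      + \<Gamma>2 (F x) (DF x u) (\<Gamma>2 (F x) (DF x v) (DF x w))" for u v w
    by (simp add: levi_civita_natural[OF x] linear_add[OF m2.levi_civita_linear(2)[OF Fx]])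
  show ?thesis
    \<comment> \<open>Third derivatives cancel by their symmetry, the terms
      \<open>D2F x u (\<Gamma>1 x v w)\<close> between \<open>D\<close> and
      \<open>\<Gamma>\<Gamma>\<close>, and the remaining \<open>D2F\<close> terms by symmetry of
      \<open>D2F\<close> and across the two exchanged halves.\<close>
    unfolding curvature_op_def lF D \<Gamma>\<Gamma> D3_sym[where u=v and v=u and w=w] D2F_sym[OF x, of v u] by simp
qed

text \<open>The factor is \<open>k\<close> for every \<open>l\<close>: it enters once, when
  \<open>curvature_tensor\<close> lowers an index with the metric, and covariant differentiation
  does not see it. In the induction step the \<open>D2F\<close> terms of the product rule are
  exactly the inhomogeneous terms of \<open>levi_civita_natural\<close>.\<close>

lemma nabla_curvature_natural:
  "x \<in> U \<Longrightarrow> length vs = l + 4 \<Longrightarrow>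
    nabla_curvature G2 l (F x) (map (DF x) vs) = k * nabla_curvature G1 l x vs"
proof (induction l arbitrary: x vs)
  case 0
  then show ?case
    by (simp add: curvature_tensor_def curvature_op_natural[symmetric] F_metric)
next
  case (Suc l)
  note x = \<open>x \<in> U\<close> and Fx = F_maps[OF \<open>x \<in> U\<close>]
  let ?T1 = "nabla_curvature G1 l" and ?T2 = "nabla_curvature G2 l"
  obtain u ws where vs: "vs = u # ws" and len: "length ws = l + 4"
    using Suc.prems(2) by (cases vs) auto
  let ?Fw = "map (DF x) ws"
  have ml: "multilinear (l + 4) (?T2 y)" if "y \<in> V" for y
    using m2.nabla_curvature_multilinear[OF that] .
  have "((\<lambda>y. ?T2 (F y) (map (\<lambda>a. a y) (map (\<lambda>w y. DF y w) ws))) has_derivative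
    (\<lambda>h. frechet_derivative (\<lambda>y. ?T2 y (map (\<lambda>a. a x) (map (\<lambda>w y. DF y w) ws))) (at (F x)) (DF x h)
       + (\<Sum>r<l + 4. ?T2 (F x) ((map (\<lambda>a. a x) (map (\<lambda>w y. DF y w) ws))[r := D2F x h (ws ! r)])))) (at x)"
    by (rule has_derivative_multilinear[where V=V and \<phi>=F and n="l + 4" and T="?T2"])
      (use m2.open_U Fx ml smooth_on_differentiable[OF m2.nabla_curvature_smooth Fx] len
        F_has_derivative[OF x] DF_has_derivative[OF x] in auto)
  then have "((\<lambda>y. ?T2 (F y) (map (DF y) ws)) has_derivative
    (\<lambda>h. frechet_derivative (\<lambda>y. ?T2 y ?Fw) (at (F x)) (DF x h)
       + (\<Sum>r<l + 4. ?T2 (F x) (?Fw[r := D2F x h (ws ! r)])))) (at x)"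
    by (simp add: comp_def)
  then have "((\<lambda>y. k * ?T1 y ws) has_derivative
    (\<lambda>h. frechet_derivative (\<lambda>y. ?T2 y ?Fw) (at (F x)) (DF x h)
       + (\<Sum>r<l + 4. ?T2 (F x) (?Fw[r := D2F x h (ws ! r)])))) (at x)"
    by (rule has_derivative_transform_within_open[OF _ m1.open_U x]) (rule Suc.IH[OF _ len])
  moreover have "((\<lambda>y. k * ?T1 y ws) has_derivative (\<lambda>h. k * frechet_derivative (\<lambda>y. ?T1 y ws) (at x) h)) (at x)"
    by (intro has_derivative_mult_right smooth_on_has_derivative[OF m1.nabla_curvature_smooth[OF len] x])
  ultimately have "(\<lambda>h. k * frechet_derivative (\<lambda>y. ?T1 y ws) (at x) h) =
    (\<lambda>h. frechet_derivative (\<lambda>y. ?T2 y ?Fw) (at (F x)) (DF x h)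
       + (\<Sum>r<l + 4. ?T2 (F x) (?Fw[r := D2F x h (ws ! r)])))"
    using has_derivative_unique by blast
  from fun_cong[OF this, of u]
  have D: "k * frechet_derivative (\<lambda>y. ?T1 y ws) (at x) u
    = frechet_derivative (\<lambda>y. ?T2 y ?Fw) (at (F x)) (DF x u)
       + (\<Sum>r<l + 4. ?T2 (F x) (?Fw[r := D2F x u (ws ! r)]))" .
  \<comment> \<open>Slot by slot, the connection term for \<open>G1\<close> splits into the one for
    \<open>G2\<close> and a \<open>D2F\<close> term, which cancels against the matching summand of
    \<open>D\<close>.\<close>
  have "k * ?T1 x (ws[r := \<Gamma>1 x u (ws ! r)]) = ?T2 (F x) (?Fw[r := D2F x u (ws ! r)])
      + ?T2 (F x) (?Fw[r := \<Gamma>2 (F x) (DF x u) (?Fw ! r)])" if r: "r < l + 4" for r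
  proof -
    have "k * ?T1 x (ws[r := \<Gamma>1 x u (ws ! r)]) = ?T2 (F x) (?Fw[r := DF x (\<Gamma>1 x u (ws ! r))])"
      using Suc.IH[OF x, of "ws[r := \<Gamma>1 x u (ws ! r)]"] len by (simp add: map_update)
    then show ?thesis
      using linear_add[OF multilinearD[OF ml[OF Fx] _ r, of ?Fw]] len r
      by (simp add: levi_civita_natural[OF x])
  qed
  then show ?case
    by (simp add: vs cov_deriv_def Let_def len right_diff_distrib D sum_distrib_left sum.distrib)
qed

end

section \<open>The warped product in a chart\<close>

lemma has_derivative_compose_snd:
  "(h has_derivative h') (at (snd q)) \<Longrightarrow> ((\<lambda>q. h (snd q)) has_derivative (\<lambda>v. h' (snd v))) (at q)"
  using diff_chain_at[of snd snd q h h'] has_derivative_snd[OF has_derivative_ident, of "at q"]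
  by (simp add: comp_def)

lemma smooth_on_compose_snd:
  fixes h :: "'e::euclidean_space \<Rightarrow> 'f::real_normed_vector" and A :: "'d::euclidean_space set"
  assumes "open A" "open U" "smooth_on U h"
  shows "smooth_on (A \<times> U) (\<lambda>q. h (snd q))"
proof -
  have "Ck_on k U h \<Longrightarrow> Ck_on k (A \<times> U) (\<lambda>q. h (snd q))" for k
  proof (induction k arbitrary: h)
    case 0
    have "continuous_on (A \<times> U) (\<lambda>q. h (snd q))"
      by (rule continuous_on_compose2[of U h]) (use 0 in \<open>auto intro: continuous_intros\<close>)
    then show ?case by simp
  next
    case (Suc k)
    show ?case
    proof (rule Ck_on_SucI)
      show "((\<lambda>q. h (snd q)) has_derivative (\<lambda>v. frechet_derivative h (at (snd q)) (snd v))) (at q)"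
        if "q \<in> A \<times> U" for q
        by (rule has_derivative_compose_snd) (use Suc.prems that in \<open>auto simp: frechet_derivative_works[symmetric]\<close>)
    qed (use Suc assms in \<open>auto intro: open_Times\<close>)
  qed
  then show ?thesis using assms(3) by (simp add: smooth_on_def)
qed

lemma has_derivative_exp_fst:
  "((\<lambda>q. exp (t * fst q)) has_derivative (\<lambda>v. (t * fst v) * exp (t * fst q))) (at (q :: real \<times> 'e::real_normed_vector))"
  by (auto intro!: derivative_eq_intros)

lemma smooth_on_exp_fst:
  fixes S :: "(real \<times> 'e::euclidean_space) set"
  assumes "open S"
  shows "smooth_on S (\<lambda>q. exp (t * fst q))"
  unfolding smooth_on_def
proof
  show "Ck_on k S (\<lambda>q. exp (t * fst q))" for k
  proof (induction k)
    case 0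
    show ?case by (auto intro!: continuous_intros)
  next
    case (Suc k)
    show ?case
      by (rule Ck_on_SucI[OF assms has_derivative_exp_fst])
        (rule Ck_on_bounded_bilinear[OF bounded_bilinear_mult assms Ck_on_const Suc])
  qed
qed

lemma sum_Basis_prod:
  "(\<Sum>b\<in>Basis. f b) = (\<Sum>b\<in>Basis. f (b :: 'a::euclidean_space, 0)) + (\<Sum>b\<in>Basis. f (0, b :: 'b::euclidean_space))"
  unfolding Basis_prod_def
  by (subst sum.union_disjoint) (auto simp: Basis_prod_def sum.reindex inj_on_def)

definition warped_local ::
  "real \<Rightarrow> ('e \<Rightarrow> 'e \<Rightarrow> 'e \<Rightarrow> real) \<Rightarrow> real \<times> 'e \<Rightarrow> real \<times> 'e \<Rightarrow> real \<times> 'e::euclidean_space \<Rightarrow> real" where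
  "warped_local t G q u w = exp (t * fst q) * (fst u * fst w + G (snd q) (snd u) (snd w))"

context local_metric
begin

lemma warped_local_metric: "local_metric (UNIV \<times> U) (warped_local t G)"
proof (rule local_metric.intro)
  show op: "open ((UNIV :: real set) \<times> U)" by (intro open_Times open_UNIV open_U)
  show "smooth_on (UNIV \<times> U) (\<lambda>q. warped_local t G q u w)" for u w
    unfolding warped_local_def
    by (intro smooth_on_mult smooth_on_add op smooth_on_exp_fst smooth_on_const
        smooth_on_compose_snd open_U smooth open_UNIV)
  fix q :: "real \<times> 'e" assume "q \<in> UNIV \<times> U"
  then interpret nondegenerate_form "G (snd q)" using form by auto
  show "nondegenerate_form (warped_local t G q)"
  proof (rule nondegenerate_form.intro)
    show "bilinear (warped_local t G q)"
      unfolding bilinear_def warped_local_def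
      by (intro allI conjI; rule linearI) (simp_all add: left_simps right_simps algebra_simps)
    show "warped_local t G q u v = warped_local t G q v u" for u v
      by (simp add: warped_local_def sym[of "snd u"] mult.commute)
    show "u = 0" if "\<And>w. warped_local t G q u w = 0" for u
    proof (rule prod_eqI)
      show "fst u = fst 0" using that[of "(1, 0)"] by (simp add: warped_local_def right_simps)
      have "G (snd q) (snd u) w = 0" for w using that[of "(0, w)"] by (simp add: warped_local_def)
      then show "snd u = snd 0" using nondegenerate by simp
    qed
  qed
qed

text \<open>The conformal change formula \<open>\<nabla>_u w + d\<phi>(u) w + d\<phi>(w) u - g(u,w)
  grad \<phi>\<close> for the product metric \<open>g = dx^2 + g_N\<close> and
  \<open>\<phi> = t x / 2\<close>, since the conformal factor is \<open>exp (2 \<phi>)\<close>; the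
  gradient of \<open>\<phi>\<close> is \<open>t / 2\<close> times the unit vector in direction
  x.\<close>

definition warped_connection :: "real \<Rightarrow> 'e \<Rightarrow> real \<times> 'e \<Rightarrow> real \<times> 'e \<Rightarrow> real \<times> 'e" where
  "warped_connection t y u w = ((t / 2) * (fst u * fst w - G y (snd u) (snd w)),
     levi_civita G y (snd u) (snd w) + (t / 2) *\<^sub>R (fst u *\<^sub>R snd w + fst w *\<^sub>R snd u))"

lemma levi_civita_warped:
  assumes q: "q \<in> UNIV \<times> U"
  shows "levi_civita (warped_local t G) q = warped_connection t (snd q)"
proof -
  interpret w: local_metric "UNIV \<times> U" "warped_local t G" by (rule warped_local_metric)
  have y: "snd q \<in> U" using q by auto
  interpret nondegenerate_form "G (snd q)" by (rule form[OF y])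
  note l = levi_civita_linear[OF y]
  have s: "warped_connection t (snd q) u v = warped_connection t (snd q) v u" for u v
    by (simp add: warped_connection_def sym[of "snd u"] levi_civita_sym[OF y, of "snd u"] mult.commute add.commute)
  have "linear (\<lambda>u. warped_connection t (snd q) u v)" for v
    by (rule linearI) (simp_all add: warped_connection_def left_simps linear_add[OF l(1)] linear_cmul[OF l(1)]
        algebra_simps)
  then have "bilinear (warped_connection t (snd q))" unfolding bilinear_def using s by simp
  moreover have "w.dG q u v w = warped_local t G q (warped_connection t (snd q) u v) w
      + warped_local t G q v (warped_connection t (snd q) u w)" for u v w
  proof -
    have "((\<lambda>q. exp (t * fst q) * (fst v * fst w + G (snd q) (snd v) (snd w))) has_derivative
      (\<lambda>u. exp (t * fst q) * (0 + dG (snd q) (snd u) (snd v) (snd w))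
         + ((t * fst u) * exp (t * fst q)) * (fst v * fst w + G (snd q) (snd v) (snd w)))) (at q)"
      by (intro has_derivative_mult has_derivative_exp_fst has_derivative_add has_derivative_const
          has_derivative_compose_snd smooth_on_has_derivative[OF smooth] y)
    from fun_cong[OF frechet_derivative_at[OF this], of u]
    have "w.dG q u v w = exp (t * fst q) * dG (snd q) (snd u) (snd v) (snd w)
         + ((t * fst u) * exp (t * fst q)) * (fst v * fst w + G (snd q) (snd v) (snd w))"
      by (simp add: warped_local_def)
    then show ?thesis
      by (simp add: warped_local_def warped_connection_def levi_civita_metric[OF y] left_simps right_simps
          sym[of "snd w" "snd u"] sym[of "snd v" "snd u"] algebra_simps)
  qed
  ultimately show ?thesis
    using s by (intro w.levi_civita_eqI[OF q]) (simp add: w.metric_connection_def)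
qed

text \<open>The curvature of a cone: the radial direction is in its kernel, and the correction has
  the form of constant curvature \<open>t^2/4\<close> with respect to \<open>G\<close>. The constant
  is the square of the \<open>t / 2\<close> in \<open>warped_connection\<close>.\<close>

lemma curvature_op_warped:
  assumes q: "q \<in> UNIV \<times> U"
  shows "curvature_op (warped_local t G) q u v w =
    (0, curvature_op G (snd q) (snd u) (snd v) (snd w)
      + (t\<^sup>2 / 4) *\<^sub>R (G (snd q) (snd u) (snd w) *\<^sub>R snd v - G (snd q) (snd v) (snd w) *\<^sub>R snd u))"
proof -
  have y: "snd q \<in> U" using q by auto
  interpret nondegenerate_form "G (snd q)" by (rule form[OF y])
  note l = levi_civita_linear[OF y]
  have op: "open ((UNIV :: real set) \<times> U)" by (intro open_Times open_UNIV open_U)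
  have D: "frechet_derivative (\<lambda>q. levi_civita (warped_local t G) q v w) (at q) u
     = (- (t / 2) * dG (snd q) (snd u) (snd v) (snd w), d\<Gamma> (snd q) (snd u) (snd v) (snd w))" for u v w
  proof -
    have "((\<lambda>q. ((t / 2) * (fst v * fst w - G (snd q) (snd v) (snd w)),
       levi_civita G (snd q) (snd v) (snd w) + (t / 2) *\<^sub>R (fst v *\<^sub>R snd w + fst w *\<^sub>R snd v))) has_derivative
      (\<lambda>u. ((t / 2) * (0 - dG (snd q) (snd u) (snd v) (snd w)), d\<Gamma> (snd q) (snd u) (snd v) (snd w) + 0))) (at q)"
      by (intro has_derivative_Pair has_derivative_mult_right has_derivative_diff has_derivative_add has_derivative_const
          has_derivative_compose_snd smooth_on_has_derivative[OF smooth]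
          smooth_on_has_derivative[OF levi_civita_smooth] y)
    then have "((\<lambda>q. levi_civita (warped_local t G) q v w) has_derivative
      (\<lambda>u. ((t / 2) * (0 - dG (snd q) (snd u) (snd v) (snd w)), d\<Gamma> (snd q) (snd u) (snd v) (snd w) + 0))) (at q)"
      by (rule has_derivative_transform_within_open[OF _ op q])
        (simp add: levi_civita_warped warped_connection_def)
    from fun_cong[OF frechet_derivative_at[OF this], of u] show ?thesis by simp
  qed
  show ?thesis
    unfolding curvature_op_def D levi_civita_warped[OF q] warped_connection_def
    by (simp add: levi_civita_metric[OF y] levi_civita_sym[OF y, of "snd v" "snd u"]
        left_simps right_simps linear_add[OF l(1)] linear_add[OF l(2)] linear_cmul[OF l(1)] linear_cmul[OF l(2)]
        sym[of "snd v" "snd u"] sym[of "levi_civita G (snd q) (snd v) (snd w)"] power2_eq_square algebra_simps)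
qed

lemma ricci_warped:
  assumes q: "q \<in> UNIV \<times> U"
  shows "ricci (warped_local t G) q v w
    = ricci G (snd q) (snd v) (snd w) - (t\<^sup>2 / 4) * (real DIM('e) - 1) * G (snd q) (snd v) (snd w)"
proof -
  have y: "snd q \<in> U" using q by auto
  interpret nondegenerate_form "G (snd q)" by (rule form[OF y])
  define c where "c = t\<^sup>2 / 4"
  \<comment> \<open>The trace of the rank-one map sending \<open>u\<close> to
    \<open>G(u, w) v\<close>; the other half of the correction is a multiple of the identity and
    contributes the dimension.\<close>
  have tr: "(\<Sum>b\<in>Basis. G (snd q) b (snd w) * (snd v \<bullet> b)) = G (snd q) (snd v) (snd w)"
    using linear_euclidean_expansion[OF linear_left, of "snd v" "snd w"] by (simp add: mult.commute)
  have "ricci (warped_local t G) q v w = (\<Sum>b\<in>Basis. curvature_op G (snd q) b (snd v) (snd w) \<bullet> b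
     + c * (G (snd q) b (snd w) * (snd v \<bullet> b) - G (snd q) (snd v) (snd w)))"
    by (simp add: c_def ricci_def sum_Basis_prod curvature_op_warped[OF q] inner_add_left inner_diff_left)
  also have "\<dots> = ricci G (snd q) (snd v) (snd w)
     + c * (G (snd q) (snd v) (snd w) - real DIM('e) * G (snd q) (snd v) (snd w))"
    by (simp add: sum.distrib sum_distrib_left[symmetric] sum_subtractf tr ricci_def)
  finally show ?thesis by (simp add: c_def field_simps)
qed

lemma scalar_curvature_warped:
  assumes q: "q \<in> UNIV \<times> U"
  shows "scalar_curvature_local (warped_local t G) q
    = exp (- (t * fst q)) * (scalar_curvature_local G (snd q) - real DIM('e) * (real DIM('e) - 1) / 4 * t\<^sup>2)"
proof -
  interpret w: local_metric "UNIV \<times> U" "warped_local t G" by (rule warped_local_metric)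
  have y: "snd q \<in> U" using q by auto
  interpret nondegenerate_form "G (snd q)" by (rule form[OF y])
  \<comment> \<open>The Ricci constant of the correction, hence the additional factor
    \<open>DIM('e) - 1\<close>; its trace over N supplies the remaining factor
    \<open>DIM('e)\<close>. Raising the index with the warped metric divides by
    \<open>exp (t * fst q)\<close>, and this is where the dependence on x comes from.\<close>
  define c where "c = (t\<^sup>2 / 4) * (real DIM('e) - 1)"
  let ?A = "\<lambda>v. (0 :: real, exp (- (t * fst q)) *\<^sub>R (ricci_op G (snd q) (snd v) - c *\<^sub>R snd v))"
  note A = ricci_op_spec[OF y]
  have "ricci_op (warped_local t G) q = ?A"
  proof (rule w.ricci_op_eqI[OF q])
    show "linear ?A"
      by (rule linearI) (simp_all add: linear_add[OF A(1)] linear_cmul[OF A(1)] algebra_simps)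
    have E: "exp (t * fst q) * (exp (- (t * fst q)) * r) = r" for r
      by (simp add: exp_minus field_simps)
    show "warped_local t G q (?A v) w = ricci (warped_local t G) q v w" for v w
      by (simp add: warped_local_def left_simps A(2) ricci_warped[OF q] c_def E)
  qed
  then have "scalar_curvature_local (warped_local t G) q
     = (\<Sum>b\<in>Basis. exp (- (t * fst q)) * (ricci_op G (snd q) b \<bullet> b - c))"
    by (simp add: scalar_curvature_local_def sum_Basis_prod inner_diff_left)
  also have "\<dots> = exp (- (t * fst q)) * (scalar_curvature_local G (snd q) - real DIM('e) * c)"
    by (simp add: sum_distrib_left[symmetric] sum_subtractf scalar_curvature_local_def)
  finally show ?thesis by (simp add: c_def algebra_simps)
qed

end

section \<open>Tangent vectors and differentials in charts\<close>

lemma tlincomb_apply: "tlincomb a v b w i = a *\<^sub>R v i + b *\<^sub>R w i"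
  by (simp add: tlincomb_def)

locale atlas =
  fixes M :: "('i, 'a, 'e::euclidean_space) manifold"
  assumes charts_cover: "(\<Union>i\<in>index M. cdom M i) = points M"
    and cdom_open: "i \<in> index M \<Longrightarrow> openin (mtop M) (cdom M i)"
    and chart_image_open: "i \<in> index M \<Longrightarrow> open (cmap M i ` cdom M i)"
    and chart_homeomorphic: "i \<in> index M \<Longrightarrow> homeomorphic_map (subtopology (mtop M) (cdom M i))
      (top_of_set (cmap M i ` cdom M i)) (cmap M i)"
    and transition_smooth: "i \<in> index M \<Longrightarrow> j \<in> index M \<Longrightarrow>
      smooth_on (cmap M i ` (cdom M i \<inter> cdom M j)) (cmap M j \<circ> cinv M i)"
begin

lemma charts_at_iff: "i \<in> charts_at M p \<longleftrightarrow> i \<in> index M \<and> p \<in> cdom M i"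
  by (simp add: charts_at_def)

lemma chart_at_in: "p \<in> points M \<Longrightarrow> chart_at M p \<in> charts_at M p"
  unfolding chart_at_def
  by (rule someI_ex) (use charts_cover in \<open>auto simp: charts_at_def\<close>)

lemma chart_inj: "i \<in> index M \<Longrightarrow> inj_on (cmap M i) (cdom M i)"
  using homeomorphic_imp_injective_map[OF chart_homeomorphic] openin_subset[OF cdom_open]
  by (simp add: topspace_subtopology Int_absorb1)

lemma cinv_cmap: "i \<in> index M \<Longrightarrow> p \<in> cdom M i \<Longrightarrow> cinv M i (cmap M i p) = p"
  by (simp add: cinv_def chart_inj)

lemma cinv_cmap_at: "i \<in> charts_at M p \<Longrightarrow> cinv M i (cmap M i p) = p"
  by (simp add: charts_at_iff cinv_cmap)

lemma chart_image_openin: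
  assumes i: "i \<in> index M" and W: "openin (mtop M) W"
  shows "open (cmap M i ` (W \<inter> cdom M i))"
proof -
  have "openin (subtopology (mtop M) (cdom M i)) (W \<inter> cdom M i)"
    using W by (auto simp: openin_subtopology)
  then have "openin (top_of_set (cmap M i ` cdom M i)) (cmap M i ` (W \<inter> cdom M i))"
    using homeomorphic_map_openness_eq[OF chart_homeomorphic[OF i]] by blast
  then show ?thesis using openin_open_trans chart_image_open[OF i] by blast
qed

lemma transition_has_derivative:
  assumes "i \<in> charts_at M p" "j \<in> charts_at M p"
  shows "((cmap M j \<circ> cinv M i) has_derivative
    frechet_derivative (cmap M j \<circ> cinv M i) (at (cmap M i p))) (at (cmap M i p))"
  using assms by (intro smooth_on_has_derivative[OF transition_smooth]) (auto simp: charts_at_iff)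

text \<open>The chain rule through a chart transition. With \<open>H\<close> a third chart it gives
  the cocycle identity for transitions, with \<open>H\<close> a map followed by a target chart it
  makes differentials independent of the source chart.\<close>

lemma change_of_chart:
  fixes H :: "'a \<Rightarrow> 'f::real_normed_vector"
  assumes i: "i \<in> charts_at M p" and j: "j \<in> charts_at M p"
    and H: "(H \<circ> cinv M j) differentiable (at (cmap M j p))"
  shows "((H \<circ> cinv M i) has_derivative (\<lambda>v. frechet_derivative (H \<circ> cinv M j) (at (cmap M j p))
     (frechet_derivative (cmap M j \<circ> cinv M i) (at (cmap M i p)) v))) (at (cmap M i p))"
proof -
  let ?S = "cmap M i ` (cdom M j \<inter> cdom M i)"
  have S: "open ?S" "cmap M i p \<in> ?S"
    using chart_image_openin cdom_open i j by (auto simp: charts_at_iff)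
  have p: "(cmap M j \<circ> cinv M i) (cmap M i p) = cmap M j p" using cinv_cmap_at[OF i] by simp
  have "((H \<circ> cinv M j) has_derivative frechet_derivative (H \<circ> cinv M j) (at (cmap M j p)))
      (at ((cmap M j \<circ> cinv M i) (cmap M i p)))"
    unfolding p using H by (simp add: frechet_derivative_works[symmetric])
  from diff_chain_at[OF transition_has_derivative[OF i j] this]
  have "(((H \<circ> cinv M j) \<circ> (cmap M j \<circ> cinv M i)) has_derivative
    (\<lambda>v. frechet_derivative (H \<circ> cinv M j) (at (cmap M j p))
     (frechet_derivative (cmap M j \<circ> cinv M i) (at (cmap M i p)) v))) (at (cmap M i p))"
    by (simp add: comp_def)
  then show ?thesis
    by (rule has_derivative_transform_within_open[OF _ S])
      (use i j in \<open>auto simp: charts_at_iff cinv_cmap\<close>)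
qed

lemma transition_compose:
  assumes "i \<in> charts_at M p" "j \<in> charts_at M p" "k \<in> charts_at M p"
  shows "frechet_derivative (cmap M k \<circ> cinv M j) (at (cmap M j p))
     (frechet_derivative (cmap M j \<circ> cinv M i) (at (cmap M i p)) v)
    = frechet_derivative (cmap M k \<circ> cinv M i) (at (cmap M i p)) v"
  using fun_cong[OF frechet_derivative_at[OF change_of_chart[OF assms(1,2), of "cmap M k"]]]
    transition_has_derivative[OF assms(2,3)] by (metis differentiableI)

lemma transition_self:
  assumes "i \<in> charts_at M p"
  shows "frechet_derivative (cmap M i \<circ> cinv M i) (at (cmap M i p)) v = v"
proof -
  have "frechet_derivative (\<lambda>x. x) (at (cmap M i p)) = frechet_derivative (cmap M i \<circ> cinv M i) (at (cmap M i p))"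
    by (rule frechet_derivative_cong_open[of "cmap M i ` cdom M i"])
      (use assms chart_image_open in \<open>auto simp: charts_at_iff cinv_cmap\<close>)
  then show ?thesis by (metis frechet_derivative_ident)
qed

lemma tvec_in_tangent_space: "i \<in> charts_at M p \<Longrightarrow> tvec M i p u \<in> tangent_space M p"
  by (simp add: tangent_space_def tvec_def transition_compose)

lemma tvec_component: "i \<in> charts_at M p \<Longrightarrow> tvec M i p u i = u"
  by (simp add: tvec_def transition_self)

lemma tangent_vector_component:
  "v \<in> tangent_space M p \<Longrightarrow> i \<in> charts_at M p \<Longrightarrow> j \<in> charts_at M p \<Longrightarrow>
    v j = frechet_derivative (cmap M j \<circ> cinv M i) (at (cmap M i p)) (v i)"
  unfolding tangent_space_def by blast

text \<open>Taking one component identifies the tangent space with \<open>'e\<close>, the inverse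
  being \<open>tvec\<close>; all work with tangent vectors goes through this. Outside
  \<open>charts_at M p\<close> both families are 0 by convention.\<close>

lemma tvec_of_component:
  assumes "v \<in> tangent_space M p" "i \<in> charts_at M p"
  shows "tvec M i p (v i) = v"
proof
  fix j
  show "tvec M i p (v i) j = v j"
  proof (cases "j \<in> charts_at M p")
    case True
    then show ?thesis
      by (simp only: tvec_def if_True tangent_vector_component[OF assms True, symmetric])
  next
    case False
    moreover have "v j = 0" using assms(1) False unfolding tangent_space_def by blast
    ultimately show ?thesis by (simp add: tvec_def)
  qed
qed

lemma tangent_vector_eqI:
  "v \<in> tangent_space M p \<Longrightarrow> w \<in> tangent_space M p \<Longrightarrow> i \<in> charts_at M p \<Longrightarrow> v i = w i \<Longrightarrow> v = w"
  using tvec_of_component by metis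

lemma tvec_lincomb:
  assumes i: "i \<in> charts_at M p"
  shows "tvec M i p (a *\<^sub>R u + b *\<^sub>R w) = tlincomb a (tvec M i p u) b (tvec M i p w)"
proof
  fix j
  show "tvec M i p (a *\<^sub>R u + b *\<^sub>R w) j = tlincomb a (tvec M i p u) b (tvec M i p w) j"
  proof (cases "j \<in> charts_at M p")
    case True
    have "linear (frechet_derivative (cmap M j \<circ> cinv M i) (at (cmap M i p)))"
      by (rule has_derivative_linear[OF transition_has_derivative[OF i True]])
    then show ?thesis by (simp add: tvec_def tlincomb_def True linear_add linear_cmul)
  qed (simp add: tvec_def tlincomb_def)
qed

lemma tlincomb_in_tangent_space:
  assumes "p \<in> points M" "v \<in> tangent_space M p" "w \<in> tangent_space M p"
  shows "tlincomb a v b w \<in> tangent_space M p"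
proof -
  note i = chart_at_in[OF assms(1)]
  have "tlincomb a v b w = tvec M (chart_at M p) p (a *\<^sub>R v (chart_at M p) + b *\<^sub>R w (chart_at M p))"
    using tvec_of_component[OF _ i] assms by (simp add: tvec_lincomb[OF i])
  then show ?thesis using tvec_in_tangent_space[OF i] by simp
qed

end

lemma smooth_manifold_imp_atlas: "smooth_manifold M \<Longrightarrow> atlas M"
  by (simp add: smooth_manifold_def atlas_def)

section \<open>Coordinate representatives and differentials of maps\<close>

definition representative :: "('i, 'a, 'e::euclidean_space) manifold \<Rightarrow>
    ('j, 'b, 'f::euclidean_space) manifold \<Rightarrow> ('a \<Rightarrow> 'b) \<Rightarrow> 'i \<Rightarrow> 'j \<Rightarrow> 'e \<Rightarrow> 'f" where
  "representative M M' T i j = cmap M' j \<circ> T \<circ> cinv M i"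

definition representative_domain :: "('i, 'a, 'e::euclidean_space) manifold \<Rightarrow> 'a set \<Rightarrow>
    ('j, 'b, 'f::euclidean_space) manifold \<Rightarrow> ('a \<Rightarrow> 'b) \<Rightarrow> 'i \<Rightarrow> 'j \<Rightarrow> 'e set" where
  "representative_domain M W M' T i j = cmap M i ` {p \<in> W \<inter> cdom M i. T p \<in> cdom M' j}"

locale smooth_local_map = M: atlas M + M': atlas M'
  for M :: "('i, 'a, 'e::euclidean_space) manifold" and M' :: "('j, 'b, 'f::euclidean_space) manifold" +
  fixes W :: "'a set" and T :: "'a \<Rightarrow> 'b"
  assumes W_open: "openin (mtop M) W" and T_smooth: "smooth_map_on M W M' T"
begin

lemma W_subset: "p \<in> W \<Longrightarrow> p \<in> points M"
  using openin_subset[OF W_open] by auto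

lemma T_maps: "p \<in> W \<Longrightarrow> T p \<in> points M'"
  using T_smooth W_subset continuous_map_image_subset_topspace[of "subtopology (mtop M) W" "mtop M'" T]
  by (auto simp: smooth_map_on_def topspace_subtopology)

lemma representative_domain_open:
  assumes "i \<in> index M" "j \<in> index M'"
  shows "open (representative_domain M W M' T i j)"
proof -
  have "openin (subtopology (mtop M) W) {p \<in> topspace (subtopology (mtop M) W). T p \<in> cdom M' j}"
    using T_smooth M'.cdom_open[OF assms(2)]
    by (intro openin_continuous_map_preimage) (auto simp: smooth_map_on_def)
  then have "openin (mtop M) {p \<in> topspace (subtopology (mtop M) W). T p \<in> cdom M' j}"
    by (rule openin_trans_full[OF _ W_open])
  from M.chart_image_openin[OF assms(1) this]
  show ?thesis
    unfolding representative_domain_def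
    by (rule back_subst[where P="open"]) (use W_subset in \<open>auto simp: topspace_subtopology\<close>)
qed

lemma representative_smooth:
  "i \<in> index M \<Longrightarrow> j \<in> index M' \<Longrightarrow>
    smooth_on (representative_domain M W M' T i j) (representative M M' T i j)"
  using T_smooth by (simp add: smooth_map_on_def representative_domain_def representative_def)

lemma representative_domain_memI:
  "p \<in> W \<Longrightarrow> i \<in> charts_at M p \<Longrightarrow> j \<in> charts_at M' (T p) \<Longrightarrow>
    cmap M i p \<in> representative_domain M W M' T i j"
  by (auto simp: representative_domain_def M.charts_at_iff M'.charts_at_iff)

lemma representative_has_derivative:
  assumes "p \<in> W" "i \<in> charts_at M p" "j \<in> charts_at M' (T p)"
  shows "(representative M M' T i j has_derivative
    frechet_derivative (representative M M' T i j) (at (cmap M i p))) (at (cmap M i p))"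
  using assms representative_domain_memI[OF assms] M.charts_at_iff M'.charts_at_iff
  by (intro smooth_on_has_derivative[OF representative_smooth]) auto

text \<open>\<open>differential\<close> is defined with the source chart
  \<open>chart_at M p\<close>; the transformation law of \<open>v\<close> cancels this choice, so
  any chart around \<open>p\<close> may be used.\<close>

lemma differential_component:
  assumes p: "p \<in> W" and i: "i \<in> charts_at M p" and j: "j \<in> charts_at M' (T p)"
    and v: "v \<in> tangent_space M p"
  shows "differential M M' T p v j
    = frechet_derivative (representative M M' T i j) (at (cmap M i p)) (v i)"
proof -
  let ?c = "chart_at M p"
  have c: "?c \<in> charts_at M p" using M.chart_at_in W_subset p by blast
  have "((cmap M' j \<circ> T) \<circ> cinv M i) differentiable (at (cmap M i p))"
    using representative_has_derivative[OF p i j] by (auto simp: representative_def differentiable_def)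
  from fun_cong[OF frechet_derivative_at[OF M.change_of_chart[OF c i this]], of "v ?c"]
  show ?thesis
    using j M.tangent_vector_component[OF v c i] by (simp add: differential_def representative_def)
qed

lemma differential_in_tangent_space:
  assumes p: "p \<in> W" and v: "v \<in> tangent_space M p"
  shows "differential M M' T p v \<in> tangent_space M' (T p)"
proof -
  define i where "i = chart_at M p"
  have i: "i \<in> charts_at M p" unfolding i_def using M.chart_at_in W_subset p by blast
  have "differential M M' T p v k = frechet_derivative (cmap M' k \<circ> cinv M' j) (at (cmap M' j (T p)))
      (differential M M' T p v j)"
    if j: "j \<in> charts_at M' (T p)" and k: "k \<in> charts_at M' (T p)" for j k
  proof -
    have S: "open (representative_domain M W M' T i j)" "cmap M i p \<in> representative_domain M W M' T i j"
      using representative_domain_open representative_domain_memI[OF p i j] i j M.charts_at_iff M'.charts_at_iff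
      by blast+
    have "representative M M' T i j (cmap M i p) = cmap M' j (T p)"
      using M.cinv_cmap_at[OF i] by (simp add: representative_def)
    then have "((cmap M' k \<circ> cinv M' j) has_derivative
      frechet_derivative (cmap M' k \<circ> cinv M' j) (at (cmap M' j (T p)))) (at (representative M M' T i j (cmap M i p)))"
      using M'.transition_has_derivative[OF j k] by simp
    from diff_chain_at[OF representative_has_derivative[OF p i j] this]
    have "(representative M M' T i k has_derivative
      frechet_derivative (cmap M' k \<circ> cinv M' j) (at (cmap M' j (T p)))
        \<circ> frechet_derivative (representative M M' T i j) (at (cmap M i p))) (at (cmap M i p))"
      by (rule has_derivative_transform_within_open[OF _ S])
        (use i j in \<open>auto simp: representative_domain_def representative_def M.charts_at_iff M'.charts_at_iff
            M.cinv_cmap M'.cinv_cmap\<close>)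
    from fun_cong[OF frechet_derivative_at[OF this], of "v i"]
    show ?thesis by (simp add: differential_component[OF p i j v] differential_component[OF p i k v])
  qed
  moreover have "differential M M' T p v j = 0" if "j \<notin> charts_at M' (T p)" for j
    using that by (simp add: differential_def)
  ultimately show ?thesis unfolding tangent_space_def by blast
qed

lemma differential_tvec:
  assumes p: "p \<in> W" and i: "i \<in> charts_at M p" and j: "j \<in> charts_at M' (T p)"
  shows "differential M M' T p (tvec M i p u)
    = tvec M' j (T p) (frechet_derivative (representative M M' T i j) (at (cmap M i p)) u)"
  by (rule M'.tangent_vector_eqI[OF _ _ j])
    (simp_all add: differential_in_tangent_space p M.tvec_in_tangent_space i M'.tvec_in_tangent_space j
      differential_component[OF p i j] M.tvec_component M'.tvec_component)

lemma differential_lincomb: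
  assumes p: "p \<in> W" and v: "v \<in> tangent_space M p" and w: "w \<in> tangent_space M p"
  shows "differential M M' T p (tlincomb a v b w)
    = tlincomb a (differential M M' T p v) b (differential M M' T p w)"
proof -
  have P: "p \<in> points M" "T p \<in> points M'" using W_subset T_maps p by auto
  note i = M.chart_at_in[OF P(1)] and j = M'.chart_at_in[OF P(2)]
  show ?thesis
    by (rule M'.tangent_vector_eqI[OF _ _ j])
      (simp_all add: differential_in_tangent_space[OF p] M.tlincomb_in_tangent_space[OF P(1)]
        M'.tlincomb_in_tangent_space[OF P(2)] v w differential_component[OF p i j]
        tlincomb_apply
        linear_add[OF has_derivative_linear[OF representative_has_derivative[OF p i j]]]
        linear_cmul[OF has_derivative_linear[OF representative_has_derivative[OF p i j]]])
qed

end

section \<open>Homotheties and curvature\<close>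

locale metric_atlas = atlas M for M :: "('i, 'a, 'e::euclidean_space) manifold" +
  fixes g :: "('i, 'a, 'e) metric_field"
  assumes g_sym: "p \<in> points M \<Longrightarrow> v \<in> tangent_space M p \<Longrightarrow> w \<in> tangent_space M p \<Longrightarrow> g p v w = g p w v"
    and g_linear: "p \<in> points M \<Longrightarrow> v \<in> tangent_space M p \<Longrightarrow> v' \<in> tangent_space M p \<Longrightarrow>
      w \<in> tangent_space M p \<Longrightarrow> g p (tlincomb a v b v') w = a * g p v w + b * g p v' w"
    and g_nondegenerate: "p \<in> points M \<Longrightarrow> v \<in> tangent_space M p \<Longrightarrow>
      (\<And>w. w \<in> tangent_space M p \<Longrightarrow> g p v w = 0) \<Longrightarrow> v = (\<lambda>_. 0)"
    and g_smooth: "i \<in> index M \<Longrightarrow> smooth_on (cmap M i ` cdom M i) (\<lambda>x. metric_in_chart M g i x \<xi> \<eta>)"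

lemma pseudo_riemannian_imp_metric_atlas: "pseudo_riemannian M g \<Longrightarrow> metric_atlas M g"
  by (simp add: pseudo_riemannian_def metric_atlas_def metric_atlas_axioms_def smooth_manifold_imp_atlas)

context metric_atlas
begin

lemma metric_in_chart_at:
  "i \<in> charts_at M p \<Longrightarrow> metric_in_chart M g i (cmap M i p) u w = g p (tvec M i p u) (tvec M i p w)"
  by (simp add: metric_in_chart_def cinv_cmap_at)

lemma points_of_chart: "i \<in> charts_at M p \<Longrightarrow> p \<in> points M"
  using charts_cover by (auto simp: charts_at_iff)

lemma local_metric_in_chart:
  assumes i: "i \<in> index M"
  shows "local_metric (cmap M i ` cdom M i) (metric_in_chart M g i)"
proof (rule local_metric.intro)
  show "open (cmap M i ` cdom M i)" by (rule chart_image_open[OF i])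
  show "smooth_on (cmap M i ` cdom M i) (\<lambda>x. metric_in_chart M g i x u w)" for u w
    by (rule g_smooth[OF i])
  fix x assume "x \<in> cmap M i ` cdom M i"
  then obtain p where x: "x = cmap M i p" and ip: "i \<in> charts_at M p" using i by (auto simp: charts_at_iff)
  note p = points_of_chart[OF ip]
  note tv = tvec_in_tangent_space[OF ip]
  note m = metric_in_chart_at[OF ip, folded x]
  show "nondegenerate_form (metric_in_chart M g i x)"
  proof (rule nondegenerate_form.intro)
    show s: "metric_in_chart M g i x u w = metric_in_chart M g i x w u" for u w
      unfolding m by (rule g_sym[OF p tv tv])
    have c: "metric_in_chart M g i x (a *\<^sub>R u + b *\<^sub>R u') w
        = a * metric_in_chart M g i x u w + b * metric_in_chart M g i x u' w" for a b u u' w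
      unfolding m tvec_lincomb[OF ip] by (rule g_linear[OF p tv tv tv])
    have "linear (\<lambda>u. metric_in_chart M g i x u w)" for w
      by (rule linearI) (use c[of 1 _ 1] c[of _ _ 0] in simp_all)
    then show "bilinear (metric_in_chart M g i x)" unfolding bilinear_def using s by simp
    show "u = 0" if "\<And>w. metric_in_chart M g i x u w = 0" for u
    proof -
      have "g p (tvec M i p u) w = 0" if w: "w \<in> tangent_space M p" for w
        using \<open>\<And>w. metric_in_chart M g i x u w = 0\<close>[of "w i"]
        unfolding m tvec_of_component[OF w ip] .
      from g_nondegenerate[OF p tv this] show "u = 0" using tvec_component[OF ip, of u] by metis
    qed
  qed
qed

lemma g_components:
  assumes "i \<in> charts_at M p" "v \<in> tangent_space M p" "w \<in> tangent_space M p"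
  shows "g p v w = metric_in_chart M g i (cmap M i p) (v i) (w i)"
  using assms by (simp add: metric_in_chart_at tvec_of_component)

text \<open>Bijectivity comes for free: in components \<open>\<Phi>\<close> is a linear map
  \<open>L\<close> that preserves nondegenerate forms on spaces of equal dimension.\<close>

lemma linear_isometryI_component:
  assumes P: "P \<in> points M" "Q \<in> points M"
    and maps: "\<And>v. v \<in> tangent_space M P \<Longrightarrow> \<Phi> v \<in> tangent_space M Q"
    and lin: "\<And>v w a b. v \<in> tangent_space M P \<Longrightarrow> w \<in> tangent_space M P \<Longrightarrow>
      \<Phi> (tlincomb a v b w) = tlincomb a (\<Phi> v) b (\<Phi> w)"
    and iso: "\<And>v w. v \<in> tangent_space M P \<Longrightarrow> w \<in> tangent_space M P \<Longrightarrow> g Q (\<Phi> v) (\<Phi> w) = g P v w"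
  shows "linear_isometry M g P Q \<Phi>"
proof -
  define i j where "i = chart_at M P" and "j = chart_at M Q"
  have i: "i \<in> charts_at M P" and j: "j \<in> charts_at M Q" using chart_at_in P by (auto simp: i_def j_def)
  define L where "L u = \<Phi> (tvec M i P u) j" for u
  note tv = tvec_in_tangent_space[OF i]
  have Lc: "L (a *\<^sub>R u + b *\<^sub>R w) = a *\<^sub>R L u + b *\<^sub>R L w" for a b u w
    by (simp add: L_def tvec_lincomb[OF i] lin tv tlincomb_apply)
  have L: "linear L" by (rule linearI) (use Lc[of 1 _ 1] Lc[of _ _ 0] in simp_all)
  have \<Phi>: "\<Phi> v = tvec M j Q (L (v i))" if "v \<in> tangent_space M P" for v
    using that by (simp add: L_def tvec_of_component i j maps)
  interpret m1: nondegenerate_form "metric_in_chart M g i (cmap M i P)"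
    using local_metric.form[OF local_metric_in_chart] i charts_at_iff by blast
  interpret m2: nondegenerate_form "metric_in_chart M g j (cmap M j Q)"
    using local_metric.form[OF local_metric_in_chart] j charts_at_iff by blast
  have "bij L"
  proof (rule linear_isometry_bij[OF m1.nondegenerate_form_axioms L, of 1 "metric_in_chart M g j (cmap M j Q)"])
    show "metric_in_chart M g j (cmap M j Q) (L u) (L w) = 1 * metric_in_chart M g i (cmap M i P) u w" for u w
      using iso[OF tv tv, of u w] g_components[OF j maps[OF tv] maps[OF tv], of u w]
      by (simp add: metric_in_chart_at[OF i] L_def)
  qed (simp_all add: m2.left_simps)
  then obtain L' where L': "\<And>u. L' (L u) = u" "\<And>u. L (L' u) = u" using bij_inv_eq_iff by metis
  have "bij_betw \<Phi> (tangent_space M P) (tangent_space M Q)"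
  proof (rule bij_betw_byWitness[where f'="\<lambda>w. tvec M i P (L' (w j))"])
    show "\<forall>v\<in>tangent_space M P. tvec M i P (L' (\<Phi> v j)) = v"
      by (simp add: \<Phi> tvec_component[OF j] L' tvec_of_component i)
    show "\<forall>w\<in>tangent_space M Q. \<Phi> (tvec M i P (L' (w j))) = w"
      by (simp add: \<Phi> tv tvec_component[OF i] L' tvec_of_component j)
  qed (use maps tv in auto)
  then show ?thesis using lin iso by (simp add: linear_isometry_def)
qed

text \<open>The components are taken in \<open>chart_at M P\<close> and \<open>chart_at M Q\<close>,
  the charts in which \<open>nabla_R\<close> and \<open>scalar_curvature\<close> are evaluated;
  there the hypothesis becomes that of \<open>scalar_curvature_local_cong\<close>.\<close>

lemma scalar_curvature_linear_isometry:
  assumes P: "P \<in> points M" "Q \<in> points M" and \<Phi>: "linear_isometry M g P Q \<Phi>"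
    and R: "\<And>vs. set vs \<subseteq> tangent_space M P \<Longrightarrow> length vs = 4 \<Longrightarrow>
      nabla_R M g 0 Q (map \<Phi> vs) = nabla_R M g 0 P vs"
  shows "scalar_curvature M g Q = scalar_curvature M g P"
proof -
  define i j where "i = chart_at M P" and "j = chart_at M Q"
  have i: "i \<in> charts_at M P" and j: "j \<in> charts_at M Q" using chart_at_in P by (auto simp: i_def j_def)
  define L where "L u = \<Phi> (tvec M i P u) j" for u
  note tv = tvec_in_tangent_space[OF i]
  have maps: "\<Phi> v \<in> tangent_space M Q" if "v \<in> tangent_space M P" for v
    using \<Phi> that by (auto simp: linear_isometry_def bij_betw_def)
  have Lc: "L (a *\<^sub>R u + b *\<^sub>R w) = a *\<^sub>R L u + b *\<^sub>R L w" for a b u w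
    using \<Phi> by (simp add: linear_isometry_def L_def tvec_lincomb[OF i] tv tlincomb_apply)
  have L: "linear L" by (rule linearI) (use Lc[of 1 _ 1] Lc[of _ _ 0] in simp_all)
  have "scalar_curvature_local (metric_in_chart M g j) (cmap M j Q)
      = scalar_curvature_local (metric_in_chart M g i) (cmap M i P)"
  proof (rule scalar_curvature_local_cong[OF _ _ _ _ L])
    show "local_metric (cmap M i ` cdom M i) (metric_in_chart M g i)" "cmap M i P \<in> cmap M i ` cdom M i"
      "local_metric (cmap M j ` cdom M j) (metric_in_chart M g j)" "cmap M j Q \<in> cmap M j ` cdom M j"
      using i j by (auto simp: charts_at_iff intro: local_metric_in_chart)
    show "metric_in_chart M g j (cmap M j Q) (L u) (L w) = metric_in_chart M g i (cmap M i P) u w" for u w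
      using \<Phi> g_components[OF j maps[OF tv] maps[OF tv], of u w]
      by (simp add: metric_in_chart_at[OF i] L_def linear_isometry_def tv)
    show "curvature_tensor (metric_in_chart M g j) (cmap M j Q) [L u, L v, L w, L z]
      = curvature_tensor (metric_in_chart M g i) (cmap M i P) [u, v, w, z]" for u v w z
      using R[of "map (tvec M i P) [u, v, w, z]"]
      by (simp add: tv nabla_R_def i_def[symmetric] j_def[symmetric] tvec_component[OF i] L_def)
  qed
  then show ?thesis by (simp add: scalar_curvature_def Let_def i_def j_def)
qed

end

lemma multilinear_scale:
  "multilinear n T \<Longrightarrow> length vs = n \<Longrightarrow> T (map (\<lambda>v. a *\<^sub>R v) vs) = a ^ n *\<^sub>R T vs"
proof (induction vs arbitrary: n T)
  case (Cons v vs)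
  then obtain m where n: "n = Suc m" "length vs = m" by auto
  have "T (a *\<^sub>R v # map (\<lambda>v. a *\<^sub>R v) vs) = a ^ m *\<^sub>R T (a *\<^sub>R v # vs)"
    by (rule Cons.IH[OF multilinear_Cons n(2)]) (use Cons.prems n in simp)
  also have "T (a *\<^sub>R v # vs) = a *\<^sub>R T (v # vs)"
    using linear_cmul[OF multilinear_Cons_linear[of m T vs]] Cons.prems n by simp
  finally show ?case by (simp add: n mult.commute)
qed simp

text \<open>Serves two cases: global homotheties, where \<open>W\<close> is the whole manifold and
  \<open>k\<close> is a square, and local isometries, where \<open>W\<close> is a neighbourhood and
  \<open>k = 1\<close>.\<close>

locale local_homothety_map = metric_atlas M g + smooth_local_map M M W T
  for M :: "('i, 'a, 'e::euclidean_space) manifold" and g W T +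
  fixes k :: real
  assumes k_nonzero: "k \<noteq> 0" and pulls_back: "pulls_back_to_multiple M g W T k"
begin

lemma representative_local_homothety:
  assumes i: "i \<in> index M" and j: "j \<in> index M"
  shows "local_homothety (representative_domain M W M T i j) (metric_in_chart M g i)
    (cmap M j ` cdom M j) (metric_in_chart M g j) (representative M M T i j) k"
proof (intro local_homothety.intro local_homothety_axioms.intro)
  let ?S = "representative_domain M W M T i j"
  show "local_metric ?S (metric_in_chart M g i)"
    by (rule local_metric_subset[OF local_metric_in_chart[OF i] representative_domain_open[OF i j]])
      (auto simp: representative_domain_def)
  show "local_metric (cmap M j ` cdom M j) (metric_in_chart M g j)" by (rule local_metric_in_chart[OF j])
  show "smooth_on ?S (representative M M T i j)" by (rule representative_smooth[OF i j])
  show "k \<noteq> 0" by (rule k_nonzero)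
  fix x assume "x \<in> ?S"
  then obtain p where x: "x = cmap M i p" and p: "p \<in> W" and ip: "i \<in> charts_at M p"
    and jp: "j \<in> charts_at M (T p)"
    using i j by (auto simp: representative_domain_def charts_at_iff)
  have Tx: "representative M M T i j x = cmap M j (T p)"
    by (simp add: x representative_def cinv_cmap_at[OF ip])
  show "representative M M T i j x \<in> cmap M j ` cdom M j" using jp by (simp add: Tx charts_at_iff)
  show "metric_in_chart M g j (representative M M T i j x)
      (frechet_derivative (representative M M T i j) (at x) u)
      (frechet_derivative (representative M M T i j) (at x) w) = k * metric_in_chart M g i x u w" for u w
    unfolding Tx metric_in_chart_at[OF jp] unfolding x differential_tvec[OF p ip jp, symmetric] metric_in_chart_at[OF ip]
    using pulls_back p tvec_in_tangent_space[OF ip] by (simp add: pulls_back_to_multiple_def)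
qed

lemma nabla_R_differential:
  assumes P: "P \<in> W" and vs: "set vs \<subseteq> tangent_space M P" "length vs = l + 4"
  shows "nabla_R M g l (T P) (map (differential M M T P) vs) = k * nabla_R M g l P vs"
proof -
  define i j where "i = chart_at M P" and "j = chart_at M (T P)"
  have i: "i \<in> charts_at M P" and j: "j \<in> charts_at M (T P)"
    using chart_at_in W_subset[OF P] T_maps[OF P] by (auto simp: i_def j_def)
  interpret local_homothety "representative_domain M W M T i j" "metric_in_chart M g i"
    "cmap M j ` cdom M j" "metric_in_chart M g j" "representative M M T i j" k
    using i j by (intro representative_local_homothety) (auto simp: charts_at_iff)
  have comps: "map (\<lambda>v. v j) (map (differential M M T P) vs) = map (DF (cmap M i P)) (map (\<lambda>v. v i) vs)"
    using vs differential_component[OF P i j] by auto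
  have TP: "cmap M j (T P) = representative M M T i j (cmap M i P)"
    by (simp add: representative_def cinv_cmap_at[OF i])
  show ?thesis
    unfolding nabla_R_def Let_def i_def[symmetric] j_def[symmetric] comps TP
    by (rule nabla_curvature_natural[OF representative_domain_memI[OF P i j]]) (simp add: vs)
qed

text \<open>Dividing the differential by \<open>c\<close> removes the factor \<open>c^2\<close> from
  the metric. In the curvature the \<open>l + 4\<close> slots contribute \<open>c\<close> to the
  power \<open>- (l + 4)\<close> and naturality contributes \<open>c^2\<close>, together
  \<open>c\<close> to the power \<open>- l - 2\<close>. The \<open>tlincomb\<close> with second
  coefficient 0 is just multiplication by \<open>1 / c\<close>.\<close>

lemma scaled_differential:
  assumes P: "P \<in> W" and k: "k = c\<^sup>2"
  defines "\<Phi> \<equiv> \<lambda>v. tlincomb (1 / c) (differential M M T P v) 0 (differential M M T P v)"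
  shows "linear_isometry M g P (T P) \<Phi>"
    and "set vs \<subseteq> tangent_space M P \<Longrightarrow> length vs = l + 4 \<Longrightarrow>
      nabla_R M g l (T P) (map \<Phi> vs) = c powi (- int l - 2) * nabla_R M g l P vs"
proof -
  have pts: "P \<in> points M" "T P \<in> points M" using W_subset T_maps P by auto
  have c: "c \<noteq> 0" using k k_nonzero by auto
  note d = differential_in_tangent_space[OF P]
  show "linear_isometry M g P (T P) \<Phi>"
  proof (rule linear_isometryI_component[OF pts])
    show \<Phi>: "\<Phi> v \<in> tangent_space M (T P)" if "v \<in> tangent_space M P" for v
      unfolding \<Phi>_def using tlincomb_in_tangent_space[OF pts(2) d d] that by blast
    show "\<Phi> (tlincomb a v b w) = tlincomb a (\<Phi> v) b (\<Phi> w)"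
      if "v \<in> tangent_space M P" "w \<in> tangent_space M P" for v w a b
      unfolding \<Phi>_def differential_lincomb[OF P that] by (auto simp: tlincomb_def algebra_simps)
    show "g (T P) (\<Phi> v) (\<Phi> w) = g P v w" if v: "v \<in> tangent_space M P" and w: "w \<in> tangent_space M P" for v w
    proof -
      have "g (T P) (\<Phi> v) (\<Phi> w) = (1 / c) * g (T P) (differential M M T P v) (\<Phi> w)"
        using g_linear[OF pts(2) d d \<Phi>, OF v v w, of "1 / c" 0] by (simp add: \<Phi>_def)
      also have "g (T P) (differential M M T P v) (\<Phi> w) = g (T P) (\<Phi> w) (differential M M T P v)"
        using g_sym[OF pts(2) d \<Phi>] v w by blast
      also have "\<dots> = (1 / c) * g (T P) (differential M M T P w) (differential M M T P v)"
        using g_linear[OF pts(2) d d d, OF w w v, of "1 / c" 0] by (simp add: \<Phi>_def)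
      also have "g (T P) (differential M M T P w) (differential M M T P v) = c\<^sup>2 * g P v w"
        using pulls_back P v w g_sym[OF pts(1) v w] by (simp add: pulls_back_to_multiple_def k)
      finally show ?thesis using c by (simp add: power2_eq_square)
    qed
  qed
  assume vs: "set vs \<subseteq> tangent_space M P" "length vs = l + 4"
  let ?j = "chart_at M (T P)"
  let ?T = "nabla_curvature (metric_in_chart M g ?j) l (cmap M ?j (T P))"
  have j: "?j \<in> charts_at M (T P)" by (rule chart_at_in[OF pts(2)])
  have "?T (map (\<lambda>w. (1 / c) *\<^sub>R w) (map (\<lambda>v. differential M M T P v ?j) vs))
     = (1 / c) ^ (l + 4) *\<^sub>R ?T (map (\<lambda>v. differential M M T P v ?j) vs)"
    by (rule multilinear_scale[OF local_metric.nabla_curvature_multilinear[OF local_metric_in_chart]])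
      (use j vs in \<open>auto simp: charts_at_iff\<close>)
  then have "nabla_R M g l (T P) (map \<Phi> vs) = (1 / c) ^ (l + 4) * nabla_R M g l (T P) (map (differential M M T P) vs)"
    by (simp add: nabla_R_def Let_def comp_def \<Phi>_def tlincomb_def)
  also have "\<dots> = (1 / c) ^ (l + 4) * c\<^sup>2 * nabla_R M g l P vs"
    by (simp add: nabla_R_differential[OF P vs] k)
  also have "(1 / c) ^ (l + 4) * c\<^sup>2 = c powi (- int (l + 2))"
  proof -
    have "(1 / c) ^ (l + 4) * c\<^sup>2 = inverse (c ^ (l + 2))"
      using c by (simp add: field_simps power_add power2_eq_square eval_nat_numeral)
    then show ?thesis by (simp only: power_int_minus power_int_of_nat)
  qed
  also have "- int (l + 2) = - int l - 2" by simp
  finally show "nabla_R M g l (T P) (map \<Phi> vs) = c powi (- int l - 2) * nabla_R M g l P vs" .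
qed

lemma scalar_curvature_isometry:
  assumes P: "P \<in> W" and k: "k = 1"
  shows "scalar_curvature M g (T P) = scalar_curvature M g P"
proof -
  have "k = 1\<^sup>2" using k by simp
  note s = scaled_differential[OF P this]
  show ?thesis
    by (rule scalar_curvature_linear_isometry[OF _ _ s(1)]) (use W_subset T_maps P s(2)[of _ 0] in auto)
qed

end

context metric_atlas
begin

lemma local_homothety_mapI:
  "diffeo_on M W M V T \<Longrightarrow> k \<noteq> 0 \<Longrightarrow> pulls_back_to_multiple M g W T k \<Longrightarrow> local_homothety_map M g W T k"
  by (intro local_homothety_map.intro smooth_local_map.intro smooth_local_map_axioms.intro
      local_homothety_map_axioms.intro)
    (auto simp: diffeo_on_def intro: metric_atlas_axioms atlas_axioms)

lemma homothety_homogeneous_imp_curvature: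
  assumes "homothety_homogeneous M g"
  shows "homothety_curvature_homogeneous k M g"
  unfolding homothety_curvature_homogeneous_def
proof (intro ballI)
  fix P Q assume P: "P \<in> points M" and Q: "Q \<in> points M"
  then obtain T c where T: "diffeo_on M (points M) M (points M) T" and c: "c \<noteq> 0"
    and pb: "pulls_back_to_multiple M g (points M) T (c\<^sup>2)" and Q: "T P = Q"
    using assms unfolding homothety_homogeneous_def homothety_def by blast
  interpret local_homothety_map M g "points M" T "c\<^sup>2"
    by (rule local_homothety_mapI[OF T _ pb]) (use c in simp)
  show "\<exists>\<Phi> c. linear_isometry M g P Q \<Phi> \<and> c \<noteq> 0 \<and>
      (\<forall>l\<le>k. \<forall>vs. set vs \<subseteq> tangent_space M P \<and> length vs = l + 4 \<longrightarrow>
         nabla_R M g l Q (map \<Phi> vs) = c powi (- int l - 2) * nabla_R M g l P vs)"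
    using scaled_differential[OF P refl] c unfolding Q by blast
qed

lemma locally_homogeneous_scalar_curvature:
  assumes "locally_homogeneous M g" "P \<in> points M" "Q \<in> points M"
  shows "scalar_curvature M g Q = scalar_curvature M g P"
proof -
  obtain T W V where T: "P \<in> W" "diffeo_on M W M V T" "pulls_back_to_multiple M g W T 1" "T P = Q"
    using assms unfolding locally_homogeneous_def by blast
  interpret local_homothety_map M g W T 1
    by (rule local_homothety_mapI[OF T(2) _ T(3)]) simp
  show ?thesis using scalar_curvature_isometry[OF T(1)] T(4) by simp
qed

lemma homogeneous_imp_locally_homogeneous: "homogeneous M g \<Longrightarrow> locally_homogeneous M g"
  unfolding locally_homogeneous_def
proof (intro ballI)
  fix P Q assume "homogeneous M g" "P \<in> points M" "Q \<in> points M"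
  then obtain T where "isometry M g T" "T P = Q" unfolding homogeneous_def by blast
  with \<open>P \<in> points M\<close> \<open>Q \<in> points M\<close>
  show "\<exists>T W V. P \<in> W \<and> Q \<in> V \<and> diffeo_on M W M V T \<and> pulls_back_to_multiple M g W T 1 \<and> T P = Q"
    unfolding isometry_def by (intro exI[of _ T] exI[of _ "points M"]) simp
qed

lemma curvature_homogeneous_scalar_curvature:
  assumes "curvature_homogeneous 0 M g" "P \<in> points M" "Q \<in> points M"
  shows "scalar_curvature M g Q = scalar_curvature M g P"
proof -
  obtain \<Phi> where \<Phi>: "linear_isometry M g P Q \<Phi>" "\<And>vs. set vs \<subseteq> tangent_space M P \<Longrightarrow> length vs = 4 \<Longrightarrow>
      nabla_R M g 0 Q (map \<Phi> vs) = nabla_R M g 0 P vs"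
    using assms unfolding curvature_homogeneous_def by (metis add_0 le_refl)
  then show ?thesis using scalar_curvature_linear_isometry assms by blast
qed

end

section \<open>The manifolds \<open>\<M>\<^sub>t\<close>\<close>

text \<open>The identity map is a homothety of factor 1 between the two metrics on \<open>U\<close>,
  so naturality applies, although \<open>G1\<close> and \<open>G2\<close> may differ as functions
  outside \<open>U\<close>.\<close>

lemma scalar_curvature_local_germ:
  assumes "local_metric U G1" "local_metric U G2" "x \<in> U" "\<And>y u w. y \<in> U \<Longrightarrow> G1 y u w = G2 y u w"
  shows "scalar_curvature_local G1 x = scalar_curvature_local G2 x"
proof -
  have "open U" using assms(2) by (simp add: local_metric_def)
  then have "smooth_on U (\<lambda>x. x)"
    by (rule smooth_on_SucI[OF _ has_derivative_ident smooth_on_const])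
  then interpret local_homothety U G2 U G1 "\<lambda>x. x" 1
    using assms by (intro local_homothety.intro local_homothety_axioms.intro) auto
  show ?thesis
    by (rule scalar_curvature_local_cong[OF assms(2,3,1,3) linear_ident])
      (use assms(3,4) nabla_curvature_natural[OF assms(3), of _ 0] in auto)
qed

text \<open>Reduces the metric axioms on tangent vectors to one nondegenerate form on components for
  each chart and point, which for the warped metric is \<open>warped_local\<close>.\<close>

lemma metric_atlasI:
  assumes "atlas M"
    and B: "\<And>i p. i \<in> charts_at M p \<Longrightarrow> nondegenerate_form (B i p)"
    and g: "\<And>i p v w. i \<in> charts_at M p \<Longrightarrow> v \<in> tangent_space M p \<Longrightarrow> w \<in> tangent_space M p \<Longrightarrow>
      g p v w = B i p (v i) (w i)"
    and smooth: "\<And>i u w. i \<in> index M \<Longrightarrow> smooth_on (cmap M i ` cdom M i) (\<lambda>x. metric_in_chart M g i x u w)"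
  shows "metric_atlas M g"
proof -
  interpret atlas M by fact
  show ?thesis
  proof (intro metric_atlas.intro metric_atlas_axioms.intro)
    show "atlas M" by fact
    show "smooth_on (cmap M i ` cdom M i) (\<lambda>x. metric_in_chart M g i x u w)" if "i \<in> index M" for i u w
      by (rule smooth[OF that])
    fix p v assume p: "p \<in> points M" and v: "v \<in> tangent_space M p"
    define i where "i = chart_at M p"
    have i: "i \<in> charts_at M p" unfolding i_def by (rule chart_at_in[OF p])
    interpret nondegenerate_form "B i p" by (rule B[OF i])
    show "g p v w = g p w v" if "w \<in> tangent_space M p" for w
      using sym that v by (simp add: g[OF i])
    show "g p (tlincomb a v b v') w = a * g p v w + b * g p v' w"
      if "v' \<in> tangent_space M p" "w \<in> tangent_space M p" for a b v' w
      using that v by (simp add: g[OF i] tlincomb_in_tangent_space[OF p] tlincomb_apply left_simps)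
    show "v = (\<lambda>_. 0)" if z: "\<And>w. w \<in> tangent_space M p \<Longrightarrow> g p v w = 0"
    proof -
      have "B i p (v i) u = 0" for u
        using z[OF tvec_in_tangent_space[OF i], of u] g[OF i v tvec_in_tangent_space[OF i], of u]
        by (simp add: tvec_component[OF i])
      then have vi: "v i = 0" by (rule nondegenerate)
      \<comment> \<open>The zero family as the trivial combination of \<open>v\<close> with itself;
        \<open>v\<close> is compared with it through the single component \<open>i\<close>.\<close>
      have "(\<lambda>_. 0) \<in> tangent_space M p"
        using tlincomb_in_tangent_space[OF p v v, of 0 0] by (simp add: tlincomb_def)
      from tangent_vector_eqI[OF v this i] show ?thesis by (simp add: vi)
    qed
  qed
qed

section \<open>The atlas and the tangent spaces of the product with the line\<close>

lemma has_derivative_shift_product: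
  fixes q :: "real \<times> 'e::real_normed_vector"
  assumes "(h has_derivative h') (at (snd q))"
  shows "((\<lambda>q. (fst q + s, h (snd q))) has_derivative (\<lambda>v. (fst v, h' (snd v)))) (at q)"
proof -
  have "((\<lambda>q. (fst q + s, h (snd q))) has_derivative (\<lambda>v. (fst v + 0, h' (snd v)))) (at q)"
    by (intro has_derivative_Pair has_derivative_add has_derivative_const has_derivative_compose_snd assms
        has_derivative_fst has_derivative_ident)
  then show ?thesis by simp
qed

text \<open>One shape covers both kinds of coordinate maps on the product: chart transitions with
  \<open>s = 0\<close>, and representatives of the homotheties with the translation length
  \<open>s\<close>.\<close>

lemma smooth_on_shift_product:
  fixes h :: "'e::euclidean_space \<Rightarrow> 'f::euclidean_space"
  assumes U: "open U" and h: "smooth_on U h"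
  shows "smooth_on (UNIV \<times> U) (\<lambda>q :: real \<times> 'e. (fst q + s, h (snd q)))"
proof (rule smooth_on_SucI)
  show op: "open ((UNIV :: real set) \<times> U)" using U by (intro open_Times open_UNIV)
  show "((\<lambda>q. (fst q + s, h (snd q))) has_derivative
      (\<lambda>v. (fst v, frechet_derivative h (at (snd q)) (snd v)))) (at q)" if "q \<in> UNIV \<times> U" for q
    using that by (intro has_derivative_shift_product smooth_on_has_derivative[OF h]) auto
  have bl: "bounded_linear (\<lambda>u :: 'f. (0 :: real, u))"
    by (intro bounded_linear_Pair bounded_linear_zero bounded_linear_ident)
  have "smooth_on (UNIV \<times> U) (\<lambda>q :: real \<times> 'e. (fst v, 0) + (0, frechet_derivative h (at (snd q)) (snd v)))" for v :: "real \<times> 'e"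
    by (intro smooth_on_add op smooth_on_const smooth_on_bounded_linear[OF bl op]
        smooth_on_compose_snd[OF open_UNIV U] smooth_on_frechet_derivative[OF h])
  then show "smooth_on (UNIV \<times> U) (\<lambda>q :: real \<times> 'e. (fst v, frechet_derivative h (at (snd q)) (snd v)))" for v :: "real \<times> 'e"
    by simp
qed

lemma line_times_simps:
  "mtop (line_times N) = prod_topology euclideanreal (mtop N)" "index (line_times N) = index N"
  "cdom (line_times N) i = UNIV \<times> cdom N i" "cmap (line_times N) i q = (fst q, cmap N i (snd q))"
  "points (line_times N) = UNIV \<times> points N"
  by (simp_all add: line_times_def case_prod_beta)

lemma line_times_chart_image: "cmap (line_times N) i ` (UNIV \<times> A) = UNIV \<times> cmap N i ` A"
  by (auto simp: line_times_simps image_iff)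

lemma charts_at_line_times: "charts_at (line_times N) q = charts_at N (snd q)"
  by (auto simp: charts_at_def line_times_simps mem_Times_iff)

text \<open>The two \<open>SOME\<close> choices range over the same index set and so coincide;
  curvature at \<open>(x, p)\<close> is evaluated in the product of the line with the very chart
  used at \<open>p\<close>.\<close>

lemma chart_at_line_times: "chart_at (line_times N) q = chart_at N (snd q)"
  by (simp add: chart_at_def charts_at_line_times)

context atlas
begin

lemma cinv_line_times:
  assumes "i \<in> index M" "y \<in> cmap M i ` cdom M i"
  shows "cinv (line_times M) i (x, y) = (x, cinv M i y)"
  unfolding cinv_def
proof (rule inv_into_f_eq)
  show "inj_on (cmap (line_times M) i) (cdom (line_times M) i)"
    using chart_inj[OF assms(1)] by (auto simp: inj_on_def line_times_simps)
qed (use assms in \<open>auto simp: line_times_simps inv_into_into f_inv_into_f\<close>)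

lemma line_times_transition:
  assumes "i \<in> index M" "y \<in> cmap M i ` cdom M i"
  shows "(cmap (line_times M) j \<circ> cinv (line_times M) i) (x, y) = (x, (cmap M j \<circ> cinv M i) y)"
  using cinv_line_times[OF assms] by (simp add: line_times_simps)

lemma atlas_line_times: "atlas (line_times M)"
proof (rule atlas.intro)
  show "(\<Union>i\<in>index (line_times M). cdom (line_times M) i) = points (line_times M)"
    using charts_cover by (auto simp: line_times_simps)
  fix i assume i': "i \<in> index (line_times M)"
  then have i: "i \<in> index M" by (simp add: line_times_simps)
  show "openin (mtop (line_times M)) (cdom (line_times M) i)"
    using cdom_open[OF i] by (simp add: line_times_simps openin_prod_Times_iff)
  show "open (cmap (line_times M) i ` cdom (line_times M) i)"
    unfolding line_times_simps(3) line_times_chart_image by (intro open_Times open_UNIV chart_image_open i)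
  obtain h where h: "homeomorphic_maps (subtopology (mtop M) (cdom M i)) (top_of_set (cmap M i ` cdom M i)) (cmap M i) h"
    using chart_homeomorphic[OF i] by (auto simp: homeomorphic_map_maps)
  have "homeomorphic_maps (prod_topology (subtopology euclideanreal UNIV) (subtopology (mtop M) (cdom M i)))
      (prod_topology (top_of_set UNIV) (top_of_set (cmap M i ` cdom M i)))
      (\<lambda>(x, p). (x, cmap M i p)) (\<lambda>(x, p). (x, h p))"
    using h by (simp add: homeomorphic_maps_prod homeomorphic_maps_id[unfolded id_def])
  moreover have "top_of_set (UNIV \<times> B) = prod_topology euclideanreal (top_of_set B)" for B :: "'e set"
    using subtopology_Times[of euclideanreal euclidean UNIV B] by simp
  ultimately show "homeomorphic_map (subtopology (mtop (line_times M)) (cdom (line_times M) i))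
     (top_of_set (cmap (line_times M) i ` cdom (line_times M) i)) (cmap (line_times M) i)"
    unfolding line_times_simps(3) line_times_chart_image
    by (auto simp: homeomorphic_map_maps line_times_def subtopology_Times)
  fix j assume "j \<in> index (line_times M)"
  then have j: "j \<in> index M" by (simp add: line_times_simps)
  let ?S = "cmap M i ` (cdom M i \<inter> cdom M j)"
  have S: "open ?S" using chart_image_openin[OF i cdom_open[OF j]] by (simp add: Int_commute)
  have "smooth_on (UNIV \<times> ?S) (cmap (line_times M) j \<circ> cinv (line_times M) i)"
  proof (rule smooth_on_cong)
    show "open ((UNIV :: real set) \<times> ?S)" using S by (intro open_Times open_UNIV)
    show "smooth_on (UNIV \<times> ?S) (\<lambda>q :: real \<times> 'e. (fst q + 0, (cmap M j \<circ> cinv M i) (snd q)))"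
      by (rule smooth_on_shift_product[OF S transition_smooth[OF i j]])
    show "(fst q + 0, (cmap M j \<circ> cinv M i) (snd q)) = (cmap (line_times M) j \<circ> cinv (line_times M) i) q"
      if "q \<in> UNIV \<times> ?S" for q :: "real \<times> 'e"
      using that line_times_transition[OF i, of "snd q" j "fst q"] by auto
  qed
  then show "smooth_on (cmap (line_times M) i ` (cdom (line_times M) i \<inter> cdom (line_times M) j))
      (cmap (line_times M) j \<circ> cinv (line_times M) i)"
    unfolding line_times_simps(3) Times_Int_Times Int_UNIV_left line_times_chart_image by simp
qed

lemma line_times_transition_derivative:
  assumes i: "i \<in> charts_at M (snd q)" and j: "j \<in> charts_at M (snd q)"
  shows "frechet_derivative (cmap (line_times M) j \<circ> cinv (line_times M) i) (at (cmap (line_times M) i q)) v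
    = (fst v, frechet_derivative (cmap M j \<circ> cinv M i) (at (cmap M i (snd q))) (snd v))"
proof -
  have i': "i \<in> index M" using i by (simp add: charts_at_iff)
  have "((\<lambda>q. (fst q + 0, (cmap M j \<circ> cinv M i) (snd q))) has_derivative
     (\<lambda>v. (fst v, frechet_derivative (cmap M j \<circ> cinv M i) (at (cmap M i (snd q))) (snd v))))
     (at (cmap (line_times M) i q))"
    by (rule has_derivative_shift_product) (use transition_has_derivative[OF i j] in \<open>simp add: line_times_simps comp_def\<close>)
  then have "((cmap (line_times M) j \<circ> cinv (line_times M) i) has_derivative
     (\<lambda>v. (fst v, frechet_derivative (cmap M j \<circ> cinv M i) (at (cmap M i (snd q))) (snd v))))
     (at (cmap (line_times M) i q))"
  proof (rule has_derivative_transform_within_open)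
    show "open ((UNIV :: real set) \<times> cmap M i ` cdom M i)" using chart_image_open[OF i'] by (intro open_Times open_UNIV)
    show "cmap (line_times M) i q \<in> UNIV \<times> cmap M i ` cdom M i" using i by (simp add: line_times_simps charts_at_iff)
    show "(fst r + 0, (cmap M j \<circ> cinv M i) (snd r)) = (cmap (line_times M) j \<circ> cinv (line_times M) i) r"
      if "r \<in> UNIV \<times> cmap M i ` cdom M i" for r :: "real \<times> 'e"
      using that line_times_transition[OF i', of "snd r" j "fst r"] by auto
  qed
  from fun_cong[OF frechet_derivative_at[OF this], of v] show ?thesis by simp
qed

text \<open>The differential of the projection to the second factor, in components. It is again a
  tangent vector because the transitions of the product are the identity times those of
  \<open>M\<close>.\<close>

definition horizontal :: "('i, real \<times> 'e) tvector \<Rightarrow> ('i, 'e) tvector" where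
  "horizontal v = (\<lambda>i. snd (v i))"

lemma horizontal_in_tangent_space:
  assumes "v \<in> tangent_space (line_times M) q"
  shows "horizontal v \<in> tangent_space M (snd q)"
proof -
  have "snd (v j) = frechet_derivative (cmap M j \<circ> cinv M i) (at (cmap M i (snd q))) (snd (v i))"
    if "i \<in> charts_at M (snd q)" "j \<in> charts_at M (snd q)" for i j
  proof -
    have "v j = frechet_derivative (cmap (line_times M) j \<circ> cinv (line_times M) i) (at (cmap (line_times M) i q)) (v i)"
      using assms that unfolding tangent_space_def charts_at_line_times by blast
    then show ?thesis using line_times_transition_derivative[OF that, of "v i"] by simp
  qed
  moreover have "snd (v i) = 0" if "i \<notin> charts_at M (snd q)" for i
  proof -
    have "v i = 0" using assms that unfolding tangent_space_def charts_at_line_times by blast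
    then show ?thesis by simp
  qed
  ultimately show ?thesis unfolding tangent_space_def horizontal_def by blast
qed

text \<open>The coordinate \<open>x\<close> is the first component in every chart of the product and
  is fixed by all transitions.\<close>

lemma dfun_fst_line_times:
  assumes q: "q \<in> points (line_times M)" and v: "v \<in> tangent_space (line_times M) q"
    and i: "i \<in> charts_at M (snd q)"
  shows "dfun (line_times M) fst q v = fst (v i)"
proof -
  define c where "c = chart_at M (snd q)"
  have c: "c \<in> charts_at M (snd q)" unfolding c_def using q by (intro chart_at_in) (auto simp: line_times_simps)
  have "frechet_derivative (fst \<circ> cinv (line_times M) c) (at (cmap (line_times M) c q))
      = frechet_derivative fst (at (cmap (line_times M) c q))"
    by (rule frechet_derivative_cong_open[of "UNIV \<times> cmap M c ` cdom M c"])
      (use c chart_image_open in \<open>auto simp: charts_at_iff cinv_line_times line_times_simps intro: open_Times\<close>)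
  also have "\<dots> = fst"
    using has_derivative_fst[OF has_derivative_ident] by (metis frechet_derivative_at)
  finally have "dfun (line_times M) fst q v = fst (v c)"
    by (simp add: dfun_def chart_at_line_times c_def)
  moreover have "v i = frechet_derivative (cmap (line_times M) i \<circ> cinv (line_times M) c) (at (cmap (line_times M) c q)) (v c)"
    using v c i unfolding tangent_space_def charts_at_line_times by blast
  ultimately show ?thesis using line_times_transition_derivative[OF c i, of "v c"] by simp
qed

lemma differential_snd_line_times:
  assumes q: "q \<in> points (line_times M)" and v: "v \<in> tangent_space (line_times M) q"
  shows "differential (line_times M) M snd q v = horizontal v"
proof
  fix j
  define c where "c = chart_at M (snd q)"
  have c: "c \<in> charts_at M (snd q)" unfolding c_def using q by (intro chart_at_in) (auto simp: line_times_simps)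
  show "differential (line_times M) M snd q v j = horizontal v j"
  proof (cases "j \<in> charts_at M (snd q)")
    case j: True
    have S: "open ((UNIV :: real set) \<times> cmap M c ` cdom M c)" "cmap (line_times M) c q \<in> UNIV \<times> cmap M c ` cdom M c"
      using c chart_image_open by (auto simp: charts_at_iff line_times_simps intro: open_Times)
    have "((\<lambda>r. (cmap M j \<circ> cinv M c) (snd r)) has_derivative
      (\<lambda>v. frechet_derivative (cmap M j \<circ> cinv M c) (at (cmap M c (snd q))) (snd v))) (at (cmap (line_times M) c q))"
      by (rule has_derivative_compose_snd) (use transition_has_derivative[OF c j] in \<open>simp add: line_times_simps comp_def\<close>)
    then have "((cmap M j \<circ> snd \<circ> cinv (line_times M) c) has_derivative
      (\<lambda>v. frechet_derivative (cmap M j \<circ> cinv M c) (at (cmap M c (snd q))) (snd v))) (at (cmap (line_times M) c q))"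
      by (rule has_derivative_transform_within_open[OF _ S])
        (use c in \<open>auto simp: charts_at_iff cinv_line_times\<close>)
    from fun_cong[OF frechet_derivative_at[OF this], of "v c"]
    have "differential (line_times M) M snd q v j
      = frechet_derivative (cmap M j \<circ> cinv M c) (at (cmap M c (snd q))) (horizontal v c)"
      using j by (simp add: differential_def chart_at_line_times c_def horizontal_def)
    then show ?thesis
      using tangent_vector_component[OF horizontal_in_tangent_space[OF v] c j] by simp
  next
    case False
    then have "horizontal v j = 0"
      using horizontal_in_tangent_space[OF v] unfolding tangent_space_def by blast
    then show ?thesis using False by (simp add: differential_def)
  qed
qed

lemma warped_metric_eq:
  assumes q: "q \<in> points (line_times M)" and i: "i \<in> charts_at M (snd q)"
    and "v \<in> tangent_space (line_times M) q" "w \<in> tangent_space (line_times M) q"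
  shows "warped_metric t M g q v w
    = exp (t * fst q) * (fst (v i) * fst (w i) + g (snd q) (horizontal v) (horizontal w))"
  using assms by (simp add: warped_metric_def dfun_fst_line_times[OF q _ i] differential_snd_line_times)

end

context metric_atlas
begin

lemma warped_metric_components:
  assumes i: "i \<in> charts_at M (snd q)"
    and v: "v \<in> tangent_space (line_times M) q" and w: "w \<in> tangent_space (line_times M) q"
  shows "warped_metric t M g q v w
    = warped_local t (metric_in_chart M g i) (cmap (line_times M) i q) (v i) (w i)"
proof -
  have q: "q \<in> points (line_times M)" using points_of_chart[OF i] by (simp add: line_times_simps mem_Times_iff)
  show ?thesis
    using g_components[OF i horizontal_in_tangent_space[OF v] horizontal_in_tangent_space[OF w]]
    by (simp add: warped_metric_eq[OF q i v w] warped_local_def line_times_simps horizontal_def)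
qed

text \<open>Agreement is claimed on the chart image only, since \<open>cinv\<close> is arbitrary
  elsewhere; the passage to curvature therefore goes through
  \<open>scalar_curvature_local_germ\<close>.\<close>

lemma warped_metric_in_chart:
  assumes i: "i \<in> index M" and x: "x \<in> UNIV \<times> cmap M i ` cdom M i"
  shows "metric_in_chart (line_times M) (warped_metric t M g) i x u w
    = warped_local t (metric_in_chart M g i) x u w"
proof -
  interpret L: atlas "line_times M" by (rule atlas_line_times)
  obtain q where q: "x = cmap (line_times M) i q" and iq: "i \<in> charts_at M (snd q)"
    using x i by (auto simp: line_times_simps charts_at_iff)
  have iq': "i \<in> charts_at (line_times M) q" using iq by (simp add: charts_at_line_times)
  show ?thesis
    unfolding metric_in_chart_def[of "line_times M"]
    by (simp add: q L.cinv_cmap_at[OF iq'] warped_metric_components[OF iq] L.tvec_in_tangent_space[OF iq']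
        L.tvec_component[OF iq'])
qed

lemma metric_atlas_line_times: "metric_atlas (line_times M) (warped_metric t M g)"
proof (rule metric_atlasI[OF atlas_line_times])
  let ?B = "\<lambda>i q. warped_local t (metric_in_chart M g i) (cmap (line_times M) i q)"
  show "nondegenerate_form (?B i q)" if "i \<in> charts_at (line_times M) q" for i q
    using local_metric.form[OF local_metric.warped_local_metric[OF local_metric_in_chart[of i]]] that
    by (auto simp: charts_at_line_times charts_at_iff line_times_simps)
  show "warped_metric t M g q v w = ?B i q (v i) (w i)"
    if "i \<in> charts_at (line_times M) q" "v \<in> tangent_space (line_times M) q"
      "w \<in> tangent_space (line_times M) q" for i q v w
    using that by (simp add: warped_metric_components charts_at_line_times)
  fix i u w assume "i \<in> index (line_times M)"
  then have i: "i \<in> index M" by (simp add: line_times_simps)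
  interpret w: local_metric "UNIV \<times> cmap M i ` cdom M i" "warped_local t (metric_in_chart M g i)"
    by (rule local_metric.warped_local_metric[OF local_metric_in_chart[OF i]])
  show "smooth_on (cmap (line_times M) i ` cdom (line_times M) i)
      (\<lambda>x. metric_in_chart (line_times M) (warped_metric t M g) i x u w)"
    unfolding line_times_simps(3) line_times_chart_image
    by (rule smooth_on_cong[OF w.open_U w.smooth]) (simp add: warped_metric_in_chart[OF i])
qed

lemma scalar_curvature_line_times:
  assumes p: "p \<in> points M"
  shows "scalar_curvature (line_times M) (warped_metric t M g) (x, p)
    = exp (- (t * x)) * (scalar_curvature M g p - real DIM('e) * (real DIM('e) - 1) / 4 * t\<^sup>2)"
proof -
  interpret L: metric_atlas "line_times M" "warped_metric t M g" by (rule metric_atlas_line_times)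
  define i where "i = chart_at M p"
  have ip: "i \<in> charts_at M p" unfolding i_def by (rule chart_at_in[OF p])
  then have i: "i \<in> index M" by (simp add: charts_at_iff)
  interpret m: local_metric "cmap M i ` cdom M i" "metric_in_chart M g i" by (rule local_metric_in_chart[OF i])
  have mem: "cmap (line_times M) i (x, p) \<in> UNIV \<times> cmap M i ` cdom M i"
    using ip by (simp add: line_times_simps charts_at_iff)
  have "scalar_curvature_local (metric_in_chart (line_times M) (warped_metric t M g) i) (cmap (line_times M) i (x, p))
    = scalar_curvature_local (warped_local t (metric_in_chart M g i)) (cmap (line_times M) i (x, p))"
    by (rule scalar_curvature_local_germ[OF _ m.warped_local_metric mem warped_metric_in_chart[OF i]])
      (use L.local_metric_in_chart[of i] i in \<open>simp_all add: line_times_simps(2,3) line_times_chart_image\<close>)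
  then show ?thesis
    using m.scalar_curvature_warped[OF mem, of t]
    by (simp add: scalar_curvature_def Let_def chart_at_line_times i_def[symmetric] line_times_simps(4))
qed

end

section \<open>Homotheties of the product\<close>

lemma representative_domain_line_times:
  assumes "\<And>q. q \<in> points (line_times M) \<Longrightarrow> T' q = (fst q + s, T (snd q))"
  shows "representative_domain (line_times M) (points (line_times M)) (line_times M) T' i j
    = UNIV \<times> representative_domain M (points M) M T i j"
proof -
  have "{p \<in> points (line_times M) \<inter> cdom (line_times M) i. T' p \<in> cdom (line_times M) j}
      = UNIV \<times> {p \<in> points M \<inter> cdom M i. T p \<in> cdom M j}"
    using assms by (auto simp: line_times_simps)
  then show ?thesis by (simp add: representative_domain_def line_times_chart_image)
qed

context atlas
begin

lemma representative_line_times: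
  assumes T': "\<And>q. q \<in> points (line_times M) \<Longrightarrow> T' q = (fst q + s, T (snd q))"
    and i: "i \<in> index M"
    and x: "x \<in> UNIV \<times> representative_domain M (points M) M T i j"
  shows "representative (line_times M) (line_times M) T' i j x = (fst x + s, representative M M T i j (snd x))"
proof -
  obtain a p where p: "x = (a, cmap M i p)" "p \<in> points M" "p \<in> cdom M i"
    using x by (auto simp: representative_domain_def)
  have "cinv (line_times M) i x = (a, p)"
    using cinv_line_times[OF i, of "cmap M i p" a] p cinv_cmap[OF i p(3)] by simp
  then show ?thesis
    using p T'[of "(a, p)"] cinv_cmap[OF i p(3)] by (simp add: representative_def line_times_simps)
qed

text \<open>The shape of \<open>T'\<close> is prescribed on the points only, because the lemma must
  also apply to an \<open>inv_into\<close>, whose values are known only there.\<close>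

lemma smooth_map_line_times:
  assumes T: "smooth_map_on M (points M) M T"
    and T': "\<And>q. q \<in> points (line_times M) \<Longrightarrow> T' q = (fst q + s, T (snd q))"
  shows "smooth_map_on (line_times M) (points (line_times M)) (line_times M) T'"
  unfolding smooth_map_on_def
proof (intro conjI ballI)
  have "continuous_map (mtop M) (mtop M) T" using T by (simp add: smooth_map_on_def)
  then have "continuous_map (prod_topology euclideanreal (mtop M)) (prod_topology euclideanreal (mtop M))
      (\<lambda>(x, p). (x + s, T p))"
    by (subst continuous_map_prod_top) (auto intro!: continuous_intros)
  then have "continuous_map (mtop (line_times M)) (mtop (line_times M)) T'"
    unfolding line_times_simps(1) by (rule continuous_map_eq) (use T' in \<open>auto simp: line_times_simps\<close>)
  then show "continuous_map (subtopology (mtop (line_times M)) (points (line_times M))) (mtop (line_times M)) T'"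
    by simp
  fix i j assume "i \<in> index (line_times M)" "j \<in> index (line_times M)"
  then have i: "i \<in> index M" and j: "j \<in> index M" by (auto simp: line_times_simps)
  interpret smooth_local_map M M "points M" T
    by (intro smooth_local_map.intro smooth_local_map_axioms.intro atlas_axioms T) simp
  let ?D = "representative_domain M (points M) M T i j"
  have D: "open ?D" by (rule representative_domain_open[OF i j])
  have "smooth_on (UNIV \<times> ?D) (representative (line_times M) (line_times M) T' i j)"
  proof (rule smooth_on_cong)
    show "open ((UNIV :: real set) \<times> ?D)" using D by (intro open_Times open_UNIV)
    show "smooth_on (UNIV \<times> ?D) (\<lambda>x :: real \<times> 'e. (fst x + s, representative M M T i j (snd x)))"
      by (rule smooth_on_shift_product[OF D representative_smooth[OF i j]])
  qed (rule representative_line_times[OF T' i, symmetric])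
  then show "smooth_on (cmap (line_times M) i ` {p \<in> points (line_times M) \<inter> cdom (line_times M) i. T' p \<in> cdom (line_times M) j})
      (cmap (line_times M) j \<circ> T' \<circ> cinv (line_times M) i)"
    using representative_domain_line_times[of M T' s T i j] T'
    by (simp add: representative_domain_def representative_def)
qed

lemma diffeo_line_times:
  assumes T: "diffeo_on M (points M) M (points M) T"
  shows "diffeo_on (line_times M) (points (line_times M)) (line_times M) (points (line_times M))
    (\<lambda>q. (fst q + s, T (snd q)))"
  unfolding diffeo_on_def
proof (intro conjI)
  let ?T = "\<lambda>q. (fst q + s, T (snd q))" and ?I = "inv_into (points M) T"
  have bij: "bij_betw T (points M) (points M)" using T by (simp add: diffeo_on_def)
  show "openin (mtop (line_times M)) (points (line_times M))"
    "openin (mtop (line_times M)) (points (line_times M))" by simp_all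
  show bij': "bij_betw ?T (points (line_times M)) (points (line_times M))"
    by (rule bij_betw_byWitness[where f'="\<lambda>q. (fst q - s, ?I (snd q))"])
      (use bij in \<open>auto simp: line_times_simps bij_betw_inv_into_left bij_betw_inv_into_right
          intro: bij_betw_apply bij_betw_apply[OF bij_betw_inv_into]\<close>)
  show "smooth_map_on (line_times M) (points (line_times M)) (line_times M) ?T"
    by (rule smooth_map_line_times) (use T in \<open>auto simp: diffeo_on_def\<close>)
  show "smooth_map_on (line_times M) (points (line_times M)) (line_times M) (inv_into (points (line_times M)) ?T)"
  \<comment> \<open>The inverse has the same shape, with the inverse of \<open>T\<close> and the
    opposite translation.\<close>
  proof (rule smooth_map_line_times[where T="?I" and s="- s"])
    show "smooth_map_on M (points M) M ?I" using T by (simp add: diffeo_on_def)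
    fix q assume q: "q \<in> points (line_times M)"
    show "inv_into (points (line_times M)) ?T q = (fst q + - s, ?I (snd q))"
      by (rule inv_into_f_eq)
        (use q bij bij' in \<open>auto simp: line_times_simps bij_betw_imp_inj_on bij_betw_inv_into_right
          intro: bij_betw_apply[OF bij_betw_inv_into]\<close>)
  qed
qed

end

context metric_atlas
begin

lemma homothety_line_times:
  assumes "isometry M g T"
  shows "homothety (line_times M) (warped_metric t M g) (\<lambda>q. (fst q + s, T (snd q)))"
  unfolding homothety_def
proof (intro conjI exI)
  let ?L = "line_times M" and ?T = "\<lambda>q. (fst q + s, T (snd q))"
  have T: "diffeo_on M (points M) M (points M) T" and pb: "pulls_back_to_multiple M g (points M) T 1"
    using assms by (auto simp: isometry_def)
  show dL: "diffeo_on ?L (points ?L) ?L (points ?L) ?T" by (rule diffeo_line_times[OF T])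
  \<comment> \<open>Translation by \<open>s\<close> multiplies \<open>exp (t x)\<close> by
    \<open>exp (t s)\<close>, which has to be the square of the homothety constant; hence the half
    in the exponent.\<close>
  show "exp (t * s / 2) \<noteq> 0" by simp
  interpret T: smooth_local_map M M "points M" T
    using T by (intro smooth_local_map.intro smooth_local_map_axioms.intro atlas_axioms) (auto simp: diffeo_on_def)
  interpret L: atlas ?L by (rule atlas_line_times)
  interpret L: smooth_local_map ?L ?L "points ?L" ?T
    using dL by (intro smooth_local_map.intro smooth_local_map_axioms.intro L.atlas_axioms) (auto simp: diffeo_on_def)
  show "pulls_back_to_multiple ?L (warped_metric t M g) (points ?L) ?T ((exp (t * s / 2))\<^sup>2)"
    unfolding pulls_back_to_multiple_def
  proof (intro ballI)
    fix q v w assume q: "q \<in> points ?L" and v: "v \<in> tangent_space ?L q" and w: "w \<in> tangent_space ?L q"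
    have p: "snd q \<in> points M" using q by (auto simp: line_times_simps)
    define i j where "i = chart_at M (snd q)" and "j = chart_at M (T (snd q))"
    have i: "i \<in> charts_at M (snd q)" and j: "j \<in> charts_at M (T (snd q))"
      unfolding i_def j_def using chart_at_in p T.T_maps by blast+
    have iL: "i \<in> charts_at ?L q" and jL: "j \<in> charts_at ?L (?T q)" using i j by (simp_all add: charts_at_line_times)
    note TL = L.T_maps[OF q]
    have comp: "differential ?L ?L ?T q v j
      = (fst (v i), frechet_derivative (representative M M T i j) (at (cmap M i (snd q))) (snd (v i)))"
      if v: "v \<in> tangent_space ?L q" for v
    proof -
      have S: "open ((UNIV :: real set) \<times> representative_domain M (points M) M T i j)"
        using i j by (intro open_Times open_UNIV T.representative_domain_open) (auto simp: charts_at_iff)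
      have m: "cmap ?L i q \<in> UNIV \<times> representative_domain M (points M) M T i j"
        using T.representative_domain_memI[OF p i j] by (simp add: line_times_simps)
      have "((\<lambda>x. (fst x + s, representative M M T i j (snd x))) has_derivative
        (\<lambda>v. (fst v, frechet_derivative (representative M M T i j) (at (cmap M i (snd q))) (snd v)))) (at (cmap ?L i q))"
        by (rule has_derivative_shift_product)
          (use T.representative_has_derivative[OF p i j] in \<open>simp add: line_times_simps\<close>)
      then have "(representative ?L ?L ?T i j has_derivative
        (\<lambda>v. (fst v, frechet_derivative (representative M M T i j) (at (cmap M i (snd q))) (snd v)))) (at (cmap ?L i q))"
        by (rule has_derivative_transform_within_open[OF _ S m])
          (rule representative_line_times[symmetric], use i in \<open>auto simp: charts_at_iff\<close>)
      from fun_cong[OF frechet_derivative_at[OF this], of "v i"]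
      show ?thesis by (simp add: L.differential_component[OF q iL jL v])
    qed
    \<comment> \<open>The projection to \<open>M\<close> intertwines the product map with
      \<open>T\<close>; this allows the isometry property of \<open>T\<close> to be applied to the
      horizontal parts.\<close>
    have hor: "horizontal (differential ?L ?L ?T q v) = differential M M T (snd q) (horizontal v)"
      if v: "v \<in> tangent_space ?L q" for v
    proof (rule tangent_vector_eqI[OF _ _ j])
      show "horizontal (differential ?L ?L ?T q v) \<in> tangent_space M (T (snd q))"
        using horizontal_in_tangent_space[OF L.differential_in_tangent_space[OF q v]] by simp
      show "differential M M T (snd q) (horizontal v) \<in> tangent_space M (T (snd q))"
        by (rule T.differential_in_tangent_space[OF p horizontal_in_tangent_space[OF v]])
      show "horizontal (differential ?L ?L ?T q v) j = differential M M T (snd q) (horizontal v) j"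
        unfolding T.differential_component[OF p i j horizontal_in_tangent_space[OF v]]
        by (simp add: horizontal_def comp[OF v])
    qed
    have "warped_metric t M g (?T q) (differential ?L ?L ?T q v) (differential ?L ?L ?T q w)
      = exp (t * (fst q + s)) * (fst (v i) * fst (w i) + g (snd q) (horizontal v) (horizontal w))"
      using warped_metric_eq[OF TL _ L.differential_in_tangent_space[OF q v] L.differential_in_tangent_space[OF q w], of j t g]
        j pb p horizontal_in_tangent_space[OF v] horizontal_in_tangent_space[OF w]
      by (simp add: comp v w hor pulls_back_to_multiple_def)
    also have "exp (t * (fst q + s)) = (exp (t * s / 2))\<^sup>2 * exp (t * fst q)"
      by (simp add: power2_eq_square exp_add[symmetric] algebra_simps)
    also have "\<dots> * (fst (v i) * fst (w i) + g (snd q) (horizontal v) (horizontal w))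
       = (exp (t * s / 2))\<^sup>2 * warped_metric t M g q v w"
      by (simp add: warped_metric_eq[OF q i v w])
    finally show "warped_metric t M g (?T q) (differential ?L ?L ?T q v) (differential ?L ?L ?T q w)
      = (exp (t * s / 2))\<^sup>2 * warped_metric t M g q v w" .
  qed
qed

lemma homothety_homogeneous_line_times:
  assumes "homogeneous M g"
  shows "homothety_homogeneous (line_times M) (warped_metric t M g)"
  unfolding homothety_homogeneous_def
proof (intro ballI)
  fix P Q assume P: "P \<in> points (line_times M)" and Q: "Q \<in> points (line_times M)"
  then have "snd P \<in> points M" "snd Q \<in> points M" by (auto simp: line_times_simps)
  then obtain T where "isometry M g T" "T (snd P) = snd Q"
    using assms unfolding homogeneous_def by blast
  then show "\<exists>T. homothety (line_times M) (warped_metric t M g) T \<and> T P = Q"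
    using homothety_line_times[of T t "fst Q - fst P"]
    by (intro exI[of _ "\<lambda>q. (fst q + (fst Q - fst P), T (snd q))"]) simp
qed

end

theorem theorem1p6:
  fixes m :: nat
    and N :: "('i, 'a, 'e::euclidean_space) manifold"
    and gN :: "('i, 'a, 'e) metric_field"
  assumes "m \<ge> 3"
    and "DIM('e) = m - 1"
    and "pseudo_riemannian N gN"
    and "points N \<noteq> {}"
    and "homogeneous N gN"
  shows "\<exists>\<tau>. (\<forall>p\<in>points N. scalar_curvature N gN p = \<tau>) \<and>
    (\<forall>t. homothety_homogeneous (line_times N) (warped_metric t N gN) \<and>
         (\<forall>k. homothety_curvature_homogeneous k (line_times N) (warped_metric t N gN))) \<and>
    (\<forall>t. t \<noteq> 0 \<and> \<tau> - (real m - 1) * (real m - 2) / 4 * t\<^sup>2 \<noteq> 0 \<longrightarrow>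
         \<not> curvature_homogeneous 0 (line_times N) (warped_metric t N gN) \<and>
         \<not> locally_homogeneous (line_times N) (warped_metric t N gN))"
proof -
  interpret N: metric_atlas N gN by (rule pseudo_riemannian_imp_metric_atlas) fact
  obtain p where p: "p \<in> points N" using assms(4) by blast
  define \<tau> where "\<tau> = scalar_curvature N gN p"
  \<comment> \<open>Homogeneity is local homogeneity with the whole of N as neighbourhood, so
    constancy of \<open>\<tau>\<close> is the same invariance that rules out local homogeneity of
    the product.\<close>
  have "\<forall>q\<in>points N. scalar_curvature N gN q = \<tau>"
    unfolding \<tau>_def
    using N.locally_homogeneous_scalar_curvature[OF N.homogeneous_imp_locally_homogeneous[OF assms(5)] p] by blast
  moreover have "homothety_homogeneous (line_times N) (warped_metric t N gN)" for t
    by (rule N.homothety_homogeneous_line_times[OF assms(5)])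
  moreover have "homothety_curvature_homogeneous k (line_times N) (warped_metric t N gN)" for t k
    by (rule metric_atlas.homothety_homogeneous_imp_curvature[OF N.metric_atlas_line_times
        N.homothety_homogeneous_line_times[OF assms(5)]])
  moreover have "\<not> curvature_homogeneous 0 (line_times N) (warped_metric t N gN) \<and>
      \<not> locally_homogeneous (line_times N) (warped_metric t N gN)"
    if t: "t \<noteq> 0" "\<tau> - (real m - 1) * (real m - 2) / 4 * t\<^sup>2 \<noteq> 0" for t
  proof -
    interpret L: metric_atlas "line_times N" "warped_metric t N gN" by (rule N.metric_atlas_line_times)
    \<comment> \<open>With \<open>n = m - 1\<close> the factor \<open>n (n - 1)\<close> of the
      general formula becomes \<open>(m - 1) (m - 2)\<close>.\<close>
    have dim: "real DIM('e) = real m - 1" using assms(1,2) by simp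
    have scal: "scalar_curvature (line_times N) (warped_metric t N gN) (x, p)
        = exp (- (t * x)) * (\<tau> - (real m - 1) * (real m - 2) / 4 * t\<^sup>2)" for x
      using N.scalar_curvature_line_times[OF p, of t x] unfolding dim \<tau>_def by simp
    \<comment> \<open>Any two points over the same \<open>p\<close> with different first coordinates
      would do: here the scalar curvatures differ by the factor \<open>exp (- t)\<close>, which is
      not 1 as \<open>t \<noteq> 0\<close>, while the common bracket is nonzero by
      assumption.\<close>
    have "(0, p) \<in> points (line_times N)" "(1, p) \<in> points (line_times N)"
      using p by (auto simp: line_times_simps)
    moreover have "scalar_curvature (line_times N) (warped_metric t N gN) (1, p)
       \<noteq> scalar_curvature (line_times N) (warped_metric t N gN) (0, p)"
      unfolding scal using t by simp
    ultimately show ?thesis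
      using L.curvature_homogeneous_scalar_curvature L.locally_homogeneous_scalar_curvature by blast
  qed
  ultimately show ?thesis by blast
qed

end
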